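(* Let $R$ be a prime PI-ring. Then $\mathcal{P}^{\uparrow}(R) < \operatorname{PI}(R)$; that is, the $\mathcal{P}^{\uparrow}$-index of $R$ is finite and strictly smaller than the PI-class of $R$.
   Context: Rings are associative with $1$, not necessarily commutative; ideals are two-sided. A prime ideal $P$ of $R$ is a proper ideal such that $aRb\subseteq P$ implies $a\in P$ or $b\in P$; a ring is prime if its zero ideal is prime. A PI-ring is a ring satisfying a polynomial identity. By Posner's theorem a prime PI-ring $R$ embeds in a matrix algebra $M_n(C)$ over some commutative ring $C$; the minimal such $n$ is the PI-class of $R$, denoted $\operatorname{PI}(R)$. All chains considered are countable: a chain of prime ideals is a nonempty countable family of prime ideals totally ordered by inclusion, and a subchain is a nonempty subfamily. The index of a chain of prime ideals is the number (finite or infinite) of ideals that are unions of subchains of the chain and are not prime. The $\mathcal{P}^{\uparrow}$-index of $R$, denoted $\mathcal{P}^{\uparrow}(R)$, is the supremum of the indices of all chains of prime ideals in $R$ (a value in $\{0,1,2,\dots\}\cup\{\infty\}$). *)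

theory Defs
  imports
    "HOL-Algebra.Algebra"
    "HOL-Library.Poly_Mapping"
    "HOL-Library.Countable_Set"
    "HOL-Library.Extended_Nat"
begin

text \<open>
  Rings are the not necessarily commutative unital rings of HOL-Algebra, and \<open>ideal\<close> means
  two-sided ideal. The library's \<open>primeideal\<close> presupposes commutativity, so primeness is
  defined here elementwise, by \<open>aRb \<subseteq> P\<close>.
\<close>

definition nc_prime_ideal :: "'a set \<Rightarrow> ('a, 'm) ring_scheme \<Rightarrow> bool" where
  "nc_prime_ideal P R \<longleftrightarrow> ideal P R \<and> P \<noteq> carrier R \<and>
     (\<forall>a\<in>carrier R. \<forall>b\<in>carrier R.
        (\<forall>r\<in>carrier R. a \<otimes>\<^bsub>R\<^esub> r \<otimes>\<^bsub>R\<^esub> b \<in> P) \<longrightarrow> a \<in> P \<or> b \<in> P)"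

definition nc_prime_ring :: "('a, 'm) ring_scheme \<Rightarrow> bool" where
  "nc_prime_ring R \<longleftrightarrow> ring R \<and> nc_prime_ideal {\<zero>\<^bsub>R\<^esub>} R"


section \<open>Polynomial identities\<close>

text \<open>
  An element of the free ring \<open>\<int>\<langle>x\<^sub>0, x\<^sub>1, \<dots>\<rangle>\<close> is a finitely supported function from words in
  the indices of the variables to the integers.
\<close>

type_synonym nc_poly = "nat list \<Rightarrow>\<^sub>0 int"

definition nc_eval :: "('a, 'm) ring_scheme \<Rightarrow> nc_poly \<Rightarrow> (nat \<Rightarrow> 'a) \<Rightarrow> 'a" where
  "nc_eval R f x =
     (\<Oplus>\<^bsub>R\<^esub>w\<in>Poly_Mapping.keys f.
        [Poly_Mapping.lookup f w] \<cdot>\<^bsub>R\<^esub> foldr (\<otimes>\<^bsub>R\<^esub>) (map x w) \<one>\<^bsub>R\<^esub>)"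

text \<open>
  As usual over the integers, the polynomial is required to be monic: some monomial of highest
  degree has coefficient 1. Without a normalization of this kind, \<open>p x\<^sub>0\<close> would be an identity of
  every ring of characteristic \<open>p\<close>.
\<close>

definition nc_monic :: "nc_poly \<Rightarrow> bool" where
  "nc_monic f \<longleftrightarrow> (\<exists>w. Poly_Mapping.lookup f w = 1 \<and>
                       (\<forall>v\<in>Poly_Mapping.keys f. length v \<le> length w))"

definition PI_ring :: "('a, 'm) ring_scheme \<Rightarrow> bool" where
  "PI_ring R \<longleftrightarrow> ring R \<and>
     (\<exists>f. nc_monic f \<and> (\<forall>x. range x \<subseteq> carrier R \<longrightarrow> nc_eval R f x = \<zero>\<^bsub>R\<^esub>))"


section \<open>Matrix rings and the PI-class\<close>

definition matrix_ring :: "('c, 'm) ring_scheme \<Rightarrow> nat \<Rightarrow> (nat \<times> nat \<Rightarrow> 'c) ring" where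
  "matrix_ring C n =
     \<lparr>carrier = ({..<n} \<times> {..<n}) \<rightarrow>\<^sub>E carrier C,
      monoid.mult = (\<lambda>A B. \<lambda>(i, j)\<in>{..<n} \<times> {..<n}. \<Oplus>\<^bsub>C\<^esub>k\<in>{..<n}. A (i, k) \<otimes>\<^bsub>C\<^esub> B (k, j)),
      monoid.one = (\<lambda>(i, j)\<in>{..<n} \<times> {..<n}. if i = j then \<one>\<^bsub>C\<^esub> else \<zero>\<^bsub>C\<^esub>),
      ring.zero = (\<lambda>(i, j)\<in>{..<n} \<times> {..<n}. \<zero>\<^bsub>C\<^esub>),
      ring.add = (\<lambda>A B. \<lambda>(i, j)\<in>{..<n} \<times> {..<n}. A (i, j) \<oplus>\<^bsub>C\<^esub> B (i, j))\<rparr>"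

definition embeds_in_matrix_ring ::
    "('a, 'm) ring_scheme \<Rightarrow> ('c, 'k) ring_scheme \<Rightarrow> nat \<Rightarrow> bool" where
  "embeds_in_matrix_ring R C n \<longleftrightarrow>
     (\<exists>h\<in>ring_hom R (matrix_ring C n). inj_on h (carrier R))"

text \<open>
  The least \<open>n\<close> such that the ring embeds in \<open>M\<^sub>n(C)\<close> for some commutative ring \<open>C\<close>. HOL cannot
  quantify over the type of \<open>C\<close>; the type \<open>'a + nat\<close> chosen here loses nothing, because by
  \<open>embeds_in_matrix_ring_universal\<close> below a commutative ring over any other type can be replaced
  by one over this type.
\<close>

definition PI_class :: "('a, 'm) ring_scheme \<Rightarrow> nat" where
  "PI_class R = (LEAST n. \<exists>C :: ('a + nat) ring. cring C \<and> embeds_in_matrix_ring R C n)"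


section \<open>Chains of prime ideals and the index\<close>

definition prime_chain :: "('a, 'm) ring_scheme \<Rightarrow> 'a set set \<Rightarrow> bool" where
  "prime_chain R \<C> \<longleftrightarrow> \<C> \<noteq> {} \<and> countable \<C> \<and> subset.chain {P. nc_prime_ideal P R} \<C>"

definition nonprime_unions :: "('a, 'm) ring_scheme \<Rightarrow> 'a set set \<Rightarrow> 'a set set" where
  "nonprime_unions R \<C> = {\<Union>\<D> |\<D>. \<D> \<subseteq> \<C> \<and> \<D> \<noteq> {} \<and> \<not> nc_prime_ideal (\<Union>\<D>) R}"

definition chain_index :: "('a, 'm) ring_scheme \<Rightarrow> 'a set set \<Rightarrow> enat" where
  "chain_index R \<C> =
     (if finite (nonprime_unions R \<C>) then enat (card (nonprime_unions R \<C>)) else \<infinity>)"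

definition P_up_index :: "('a, 'm) ring_scheme \<Rightarrow> enat" where
  "P_up_index R = (SUP \<C>\<in>{\<C>. prime_chain R \<C>}. chain_index R \<C>)"


section \<open>Independence of the PI-class from the type of the commutative ring\<close>

lemma generate_ring_card_le:
  assumes inf: "infinite (UNIV :: 'b set)"
    and H: "|H| \<le>o |UNIV :: 'b set|"
  shows "|generate_ring S H| \<le>o |UNIV :: 'b set|"
proof -
  define step where "step = (\<lambda>K. K \<union> (a_inv S ` K)
      \<union> ((\<lambda>(a, b). a \<oplus>\<^bsub>S\<^esub> b) ` (K \<times> K)) \<union> ((\<lambda>(a, b). a \<otimes>\<^bsub>S\<^esub> b) ` (K \<times> K)))"
  define F where "F = (\<lambda>m. (step ^^ m) (insert \<one>\<^bsub>S\<^esub> H))"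
  note img = ordLeq_transitive[OF card_of_image]
  have un: "|A \<union> B| \<le>o |UNIV :: 'b set|"
    if "|A| \<le>o |UNIV :: 'b set|" "|B| \<le>o |UNIV :: 'b set|" for A B :: "'a set"
    by (rule card_of_Un_ordLeq_infinite[OF inf that])
  have tm: "|K \<times> K| \<le>o |UNIV :: 'b set|"
    if "|K| \<le>o |UNIV :: 'b set|" for K :: "'a set"
    using card_of_Times_ordLeq_infinite_Field[of "|UNIV :: 'b set|" K K] inf that
    by (simp add: Field_card_of card_of_Card_order)
  have one: "|{\<one>\<^bsub>S\<^esub>}| \<le>o |UNIV :: 'b set|"
    by (rule card_of_singl_ordLeq) simp
  have small: "|F m| \<le>o |UNIV :: 'b set|" for m
  proof (induction m)
    case 0
    show ?case using un[OF one H] by (simp add: F_def)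
  next
    case (Suc m)
    have "F (Suc m) = step (F m)" by (simp add: F_def)
    then show ?case
      unfolding step_def by (auto intro!: un img tm Suc)
  qed
  have nat: "|UNIV :: nat set| \<le>o |UNIV :: 'b set|"
    using inf infinite_iff_card_of_nat by blast
  have union: "|\<Union>m. F m| \<le>o |UNIV :: 'b set|"
    by (rule card_of_UNION_ordLeq_infinite[OF inf nat]) (auto intro: small)
  have mono: "F i \<subseteq> F j" if "i \<le> j" for i j
    using that by (induction rule: dec_induct) (auto simp: F_def step_def)
  have two: "\<exists>m. a \<in> F m \<and> b \<in> F m" if ab: "a \<in> F i" "b \<in> F j" for a b i j
    using ab mono[of i "max i j"] mono[of j "max i j"] by (intro exI[of _ "max i j"]) auto
  have sub: "h \<in> (\<Union>m. F m)" if "h \<in> generate_ring S H" for h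
    using that
  proof (induction rule: generate_ring.induct)
    case one
    show ?case by (auto simp: F_def intro!: exI[of _ 0])
  next
    case (incl h)
    then show ?case by (auto simp: F_def intro!: exI[of _ 0])
  next
    case (a_inv h)
    then obtain m where "h \<in> F m" by auto
    then have "\<ominus>\<^bsub>S\<^esub> h \<in> F (Suc m)" by (simp add: F_def step_def)
    then show ?case by blast
  next
    case (eng_add a b)
    then obtain m where "a \<in> F m" "b \<in> F m" using two by blast
    then have "a \<oplus>\<^bsub>S\<^esub> b \<in> F (Suc m)" by (force simp add: F_def step_def)
    then show ?case by blast
  next
    case (eng_mult a b)
    then obtain m where "a \<in> F m" "b \<in> F m" using two by blast
    then have "a \<otimes>\<^bsub>S\<^esub> b \<in> F (Suc m)" by (force simp add: F_def step_def)
    then show ?case by blast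
  qed
  then have "generate_ring S H \<subseteq> (\<Union>m. F m)" by blast
  then show ?thesis using union card_of_mono1 ordLeq_transitive by blast
qed

theorem embeds_in_matrix_ring_universal:
  fixes R :: "('a, 'm) ring_scheme" and S :: "('c, 'k) ring_scheme"
  assumes S: "cring S" and emb: "embeds_in_matrix_ring R S n"
  shows "\<exists>C :: ('a + nat) ring. cring C \<and> embeds_in_matrix_ring R C n"
proof -
  interpret S: cring S by (rule S)
  let ?I = "{..<n} \<times> {..<n}"
  obtain h where hom: "h \<in> ring_hom R (matrix_ring S n)" and inj: "inj_on h (carrier R)"
    using emb unfolding embeds_in_matrix_ring_def by blast
  have hE: "h x \<in> ?I \<rightarrow>\<^sub>E carrier S" if "x \<in> carrier R" for x
    using ring_hom_closed[OF hom that] by (simp add: matrix_ring_def)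
  define H where "H = (\<lambda>(x, p). h x p) ` (carrier R \<times> ?I)"
  define K where "K = generate_ring S H"
  let ?K = "S\<lparr>carrier := K\<rparr>"
  have HS: "H \<subseteq> carrier S" using hE by (fastforce simp: H_def)
  have sub: "subring K S" unfolding K_def by (rule S.generate_ring_is_subring[OF HS])
  have KS: "K \<subseteq> carrier S" by (rule subringE(1)[OF sub])
  have Kcr: "cring ?K" using S.subcringI'[OF sub] S.subcring_iff[OF KS] by blast
  interpret K: cring ?K by (rule Kcr)
  have hK: "h x (i, j) \<in> K" if "x \<in> carrier R" "i < n" "j < n" for x i j
    using that by (auto simp: K_def H_def intro!: generate_ring.incl image_eqI[of _ _ "(x, (i, j))"])
  have inf: "infinite (UNIV :: ('a + nat) set)"
    by simp
  have "|H| \<le>o |UNIV :: ('a + nat) set|"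
  proof -
    have a: "|carrier R| \<le>o |UNIV :: ('a + nat) set|"
      by (rule card_of_ordLeq[THEN iffD1]) (rule exI[of _ Inl], auto)
    have b: "|?I| \<le>o |UNIV :: ('a + nat) set|"
      using inf by (intro ordLess_imp_ordLeq finite_ordLess_infinite2) auto
    have "|carrier R \<times> ?I| \<le>o |UNIV :: ('a + nat) set|"
      using card_of_Times_ordLeq_infinite_Field[of "|UNIV :: ('a + nat) set|"] inf a b
      by (simp add: Field_card_of card_of_Card_order)
    then show ?thesis unfolding H_def using card_of_image ordLeq_transitive by blast
  qed
  then have "|K| \<le>o |UNIV :: ('a + nat) set|"
    unfolding K_def by (rule generate_ring_card_le[OF inf])
  then obtain g :: "'c \<Rightarrow> 'a + nat" where g: "inj_on g K"
    by (metis card_of_ordLeq)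
  let ?C = "image_ring g ?K"
  have giso: "g \<in> ring_iso ?K ?C"
    by (rule inj_imp_image_ring_iso) (simp add: g)
  have gh: "g \<in> ring_hom ?K ?C" using giso by (simp add: ring_iso_def)
  have Ccr: "cring ?C"
    using K.ring_iso_imp_img_cring[OF giso]
    by (simp add: image_ring_def image_group_def monoid.defs)
  interpret C: cring ?C by (rule Ccr)
  interpret g: ring_hom_cring ?K ?C g
    by unfold_locales (rule gh)
  interpret inc: ring_hom_cring ?K S "\<lambda>x. x"
    by unfold_locales (use KS in \<open>auto simp: ring_hom_def\<close>)
  have fin: "finsum ?C (\<lambda>k. g (f k)) A = g (finsum S f A)" if "f \<in> A \<rightarrow> K" for f :: "nat \<Rightarrow> 'c" and A
    using g.hom_finsum[of f A] inc.hom_finsum[of f A] that by (simp add: comp_def)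
  define \<phi> where "\<phi> = (\<lambda>x. \<lambda>(i, j)\<in>?I. g (h x (i, j)))"
  have closed: "\<phi> x \<in> carrier (matrix_ring ?C n)" if "x \<in> carrier R" for x
    using that hK by (auto simp: \<phi>_def matrix_ring_def image_ring_carrier)
  have ga: "g (a \<oplus>\<^bsub>S\<^esub> b) = g a \<oplus>\<^bsub>?C\<^esub> g b" "g (a \<otimes>\<^bsub>S\<^esub> b) = g a \<otimes>\<^bsub>?C\<^esub> g b"
    if "a \<in> K" "b \<in> K" for a b
    using g.hom_add[of a b] g.hom_mult[of a b] that by simp_all
  have g0: "g \<zero>\<^bsub>S\<^esub> = \<zero>\<^bsub>?C\<^esub>" "g \<one>\<^bsub>S\<^esub> = \<one>\<^bsub>?C\<^esub>"
    using g.hom_zero g.hom_one by simp_all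
  have mK: "a \<otimes>\<^bsub>S\<^esub> b \<in> K" if "a \<in> K" "b \<in> K" for a b
    using subringE(6)[OF sub] that by blast
  have "\<phi> \<in> ring_hom R (matrix_ring ?C n)"
  proof (rule ring_hom_memI)
    show "\<phi> x \<in> carrier (matrix_ring ?C n)" if "x \<in> carrier R" for x
      by (rule closed[OF that])
  next
    fix x y assume xy: "x \<in> carrier R" "y \<in> carrier R"
    have m: "h (x \<otimes>\<^bsub>R\<^esub> y) (i, j) = (\<Oplus>\<^bsub>S\<^esub>k\<in>{..<n}. h x (i, k) \<otimes>\<^bsub>S\<^esub> h y (k, j))"
      if "i < n" "j < n" for i j
      using ring_hom_mult[OF hom xy] that by (simp add: matrix_ring_def)
    have ad: "h (x \<oplus>\<^bsub>R\<^esub> y) (i, j) = h x (i, j) \<oplus>\<^bsub>S\<^esub> h y (i, j)" if "i < n" "j < n" for i j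
      using ring_hom_add[OF hom xy] that by (simp add: matrix_ring_def)
    have prod: "(\<Oplus>\<^bsub>?C\<^esub>k\<in>{..<n}. \<phi> x (i, k) \<otimes>\<^bsub>?C\<^esub> \<phi> y (k, j)) = g (h (x \<otimes>\<^bsub>R\<^esub> y) (i, j))"
      if ij: "i < n" "j < n" for i j
    proof -
      have "(\<Oplus>\<^bsub>?C\<^esub>k\<in>{..<n}. \<phi> x (i, k) \<otimes>\<^bsub>?C\<^esub> \<phi> y (k, j))
          = (\<Oplus>\<^bsub>?C\<^esub>k\<in>{..<n}. g (h x (i, k) \<otimes>\<^bsub>S\<^esub> h y (k, j)))"
      proof (rule C.finsum_cong')
        show "(\<lambda>k. g (h x (i, k) \<otimes>\<^bsub>S\<^esub> h y (k, j))) \<in> {..<n} \<rightarrow> carrier ?C"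
          using ij xy hK mK by (auto simp: image_ring_carrier)
      qed (use ij xy hK in \<open>auto simp: \<phi>_def ga\<close>)
      also have "\<dots> = g (\<Oplus>\<^bsub>S\<^esub>k\<in>{..<n}. h x (i, k) \<otimes>\<^bsub>S\<^esub> h y (k, j))"
        by (rule fin) (use ij xy hK mK in auto)
      finally show ?thesis using m ij by simp
    qed
    show "\<phi> (x \<otimes>\<^bsub>R\<^esub> y) = \<phi> x \<otimes>\<^bsub>matrix_ring ?C n\<^esub> \<phi> y"
      by (rule ext) (auto simp: matrix_ring_def restrict_def prod, auto simp: \<phi>_def split: if_splits)
    show "\<phi> (x \<oplus>\<^bsub>R\<^esub> y) = \<phi> x \<oplus>\<^bsub>matrix_ring ?C n\<^esub> \<phi> y"
      by (rule ext) (use xy hK in \<open>auto simp: matrix_ring_def restrict_def \<phi>_def ad ga\<close>)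
  next
    have o: "h \<one>\<^bsub>R\<^esub> (i, j) = (if i = j then \<one>\<^bsub>S\<^esub> else \<zero>\<^bsub>S\<^esub>)" if "i < n" "j < n" for i j
      using ring_hom_one[OF hom] that by (simp add: matrix_ring_def)
    show "\<phi> \<one>\<^bsub>R\<^esub> = \<one>\<^bsub>matrix_ring ?C n\<^esub>"
      by (rule ext) (auto simp: matrix_ring_def restrict_def \<phi>_def o g0)
  qed
  moreover have "inj_on \<phi> (carrier R)"
  proof (rule inj_onI)
    fix x y assume xy: "x \<in> carrier R" "y \<in> carrier R" and eq: "\<phi> x = \<phi> y"
    have "h x p = h y p" if pI: "p \<in> ?I" for p
    proof -
      obtain i j where p: "p = (i, j)" "i < n" "j < n" using pI by auto
      have "g (h x (i, j)) = g (h y (i, j))"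
        using fun_cong[OF eq, of "(i, j)"] p by (simp add: \<phi>_def)
      then show ?thesis using inj_onD[OF g] hK xy p by blast
    qed
    then have "h x = h y" by (rule PiE_ext[OF hE[OF xy(1)] hE[OF xy(2)]])
    then show "x = y" using inj xy by (auto dest: inj_onD)
  qed
  ultimately show ?thesis using Ccr unfolding embeds_in_matrix_ring_def by blast
qed

end

theory Submission
  imports Defs "HOL-Combinatorics.Multiset_Permutations"
begin

text \<open>
  Write \<open>c\<^sub>m\<close> for the Capelli polynomial in \<open>m\<close> alternating variables. Let \<open>P\<^sub>0\<close> belong to a chain of
  primes, suppose that \<open>R / P\<^sub>0\<close> satisfies \<open>c\<^sub>m\<^sub>+\<^sub>1\<close>, and that some value \<open>e\<close> of \<open>c\<^sub>m\<close> at
  \<open>a\<^sub>1, \<dots>, a\<^sub>m\<close> lies outside the union. Expanding \<open>c\<^sub>m\<^sub>+\<^sub>1\<close> along one variable shows that, up to the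
  denominator \<open>e\<close>, the \<open>a\<^sub>j\<close> act like a finite basis of \<open>R\<close>, so that \<open>x R y \<subseteq> \<Union>P\<^sub>i\<close> is decided by the
  finitely many \<open>x a\<^sub>j y\<close>, which lie in a single \<open>P\<^sub>i\<close>; hence the union is prime. Therefore the Capelli
  rank (the largest \<open>m\<close> for which \<open>c\<^sub>m\<close> is not an identity modulo the prime) drops strictly across every
  nonprime union.

  The rank of a prime PI-ring is a perfect square: nil ideals vanish, so every nonzero ideal contains a
  non-nilpotent \<open>a\<close>, and \<open>R[t]\<close> has a simple module on which \<open>a\<close> acts nontrivially, namely a quotient by a
  maximal left ideal containing \<open>1 - a t\<close>. Adjoining a maximal commutative set of endomorphisms to the
  action makes it dense over a commutative centralizer, and the identity bounds the dimension \<open>k\<close>; this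
  gives \<open>R \<rightarrow> M\<^sub>k(K)\<close>, with \<open>c\<^sub>k\<^sub>*\<^sub>k\<close> not an identity of \<open>R\<close>. The same representations embed \<open>R\<close> in some \<open>M\<^sub>n(C)\<close>.
  If \<open>R\<close> embeds in \<open>M\<^sub>n(C)\<close> then \<open>c\<^sub>m\<close> vanishes for \<open>m > n\<^sup>2\<close>, so ranks are among \<open>1, 4, \<dots>, n\<^sup>2\<close>, and a
  union of primes of rank 1 is prime: at most \<open>n - 1\<close> drops occur.
\<close>

subsection \<open>Finite sums\<close>

text \<open>Counting drops of the Capelli rank alone would bound the index by roughly the square of
  the PI-class. The bound \<open>n - 1\<close> depends on ranks of primes being squares, and squares
  come from full matrix algebras, that is, from simple modules. A prime PI-ring can have too few of
  these, since its Jacobson radical may be nonzero, as in a local domain. A central variable repairs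
  this: if \<open>a\<close> is not nilpotent, \<open>1 - a t\<close> has no left inverse. Capelli
  polynomials and linearized identities are multilinear, so they pass unchanged to any ring spanned
  over its center by an image of \<open>R\<close>; thus neither the variable nor the added scalars
  cost anything.

  A nonprime union has no quotient to which the square argument applies. Two different nonprime
  unions are therefore compared through a prime of the chain lying between them.

  Different elements are detected by representations of different sizes, all bounded by the degree
  of the identity. Primeness selects one size that detects every element; this embedding is also
  what makes the least \<open>n\<close> in \<open>PI_class\<close> meaningful.\<close>

lemma (in abelian_monoid) finsum_eq_zero:
  "(\<And>i. i \<in> A \<Longrightarrow> f i = \<zero>) \<Longrightarrow> finsum G f A = \<zero>"
  by (rule add.finprod_one_eqI)

text \<open>Serves evaluation at a vector, entries of matrices and components of products, which
  preserve sums without being ring homomorphisms. The condition at zero covers the empty sum and the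
  default value of infinite sums.\<close>

lemma finsum_additive:
  assumes G: "abelian_monoid G" and H: "abelian_monoid H"
    and h: "h \<in> carrier G \<rightarrow> carrier H" "h \<zero>\<^bsub>G\<^esub> = \<zero>\<^bsub>H\<^esub>"
      "\<And>u v. u \<in> carrier G \<Longrightarrow> v \<in> carrier G \<Longrightarrow> h (u \<oplus>\<^bsub>G\<^esub> v) = h u \<oplus>\<^bsub>H\<^esub> h v"
    and f: "f \<in> A \<rightarrow> carrier G"
  shows "h (finsum G f A) = finsum H (\<lambda>i. h (f i)) A"
proof -
  interpret G: abelian_monoid G by fact
  interpret H: abelian_monoid H by fact
  show ?thesis
    using f
  proof (induction A rule: infinite_finite_induct)
    case (insert a A)
    then have "(\<lambda>i. h (f i)) \<in> A \<rightarrow> carrier H" "h (f a) \<in> carrier H"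
      using h(1) by (auto simp: Pi_iff)
    then show ?case
      using insert by (simp add: h(3) Pi_iff)
  qed (simp_all add: h(2))
qed

lemma additive_int_multiple:
  assumes G: "abelian_group G" and H: "abelian_group H"
    and h: "h \<in> carrier G \<rightarrow> carrier H"
      "\<And>u v. u \<in> carrier G \<Longrightarrow> v \<in> carrier G \<Longrightarrow> h (u \<oplus>\<^bsub>G\<^esub> v) = h u \<oplus>\<^bsub>H\<^esub> h v"
    and a: "a \<in> carrier G"
  shows "h (add_pow G (k::int) a) = add_pow H k (h a)"
proof -
  interpret G: abelian_group G by fact
  interpret H: abelian_group H by fact
  have "group_hom (add_monoid G) (add_monoid H) h"
    using h by (intro group_hom.intro group_hom_axioms.intro G.a_group H.a_group) (auto simp: hom_def)
  then show ?thesis unfolding add_pow_def using group_hom.hom_int_pow a by fastforce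
qed

lemma (in abelian_monoid) finsum_split_off:
  assumes "finite A" "a \<in> A" "f \<in> A \<rightarrow> carrier G"
  shows "finsum G f A = f a \<oplus> finsum G f (A - {a})"
proof -
  have "finsum G f (insert a (A - {a})) = f a \<oplus> finsum G f (A - {a})"
    using assms by (intro finsum_insert) auto
  then show ?thesis using assms by (simp add: insert_absorb)
qed

lemma (in abelian_monoid) finsum_eq_single:
  assumes "finite A" "a \<in> A" "f \<in> A \<rightarrow> carrier G" "\<And>i. i \<in> A \<Longrightarrow> i \<noteq> a \<Longrightarrow> f i = \<zero>"
  shows "finsum G f A = f a"
proof -
  have "finsum G f (A - {a}) = \<zero>"
    by (rule finsum_eq_zero) (use assms in auto)
  moreover have "f a \<in> carrier G" using assms by auto
  ultimately show ?thesis using finsum_split_off[OF assms(1-3)] by simp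
qed

lemma (in abelian_monoid) finsum_swap:
  assumes "finite A" "finite B" "\<And>i j. i \<in> A \<Longrightarrow> j \<in> B \<Longrightarrow> f i j \<in> carrier G"
  shows "(\<Oplus>i\<in>A. \<Oplus>j\<in>B. f i j) = (\<Oplus>j\<in>B. \<Oplus>i\<in>A. f i j)"
  using assms(1,3)
proof (induction A)
  case empty
  then show ?case by (simp add: finsum_zero)
next
  case (insert a A)
  have "(\<Oplus>i\<in>insert a A. \<Oplus>j\<in>B. f i j) = (\<Oplus>j\<in>B. f a j) \<oplus> (\<Oplus>i\<in>A. \<Oplus>j\<in>B. f i j)"
    using insert by (intro finsum_insert) (auto intro!: finsum_closed)
  also have "\<dots> = (\<Oplus>j\<in>B. f a j) \<oplus> (\<Oplus>j\<in>B. \<Oplus>i\<in>A. f i j)"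
    using insert by simp
  also have "\<dots> = (\<Oplus>j\<in>B. f a j \<oplus> (\<Oplus>i\<in>A. f i j))"
    using insert by (intro finsum_addf[symmetric]) (auto intro!: finsum_closed)
  also have "\<dots> = (\<Oplus>j\<in>B. \<Oplus>i\<in>insert a A. f i j)"
    using insert by (intro finsum_cong' refl finsum_insert[symmetric]) (auto intro!: finsum_closed)
  finally show ?case .
qed

subsection \<open>Multilinear functions\<close>

definition ring_center :: "('a, 'm) ring_scheme \<Rightarrow> 'a set" where
  "ring_center R = {z \<in> carrier R. \<forall>a\<in>carrier R. z \<otimes>\<^bsub>R\<^esub> a = a \<otimes>\<^bsub>R\<^esub> z}"

text \<open>An assignment gives a value to every index, while \<open>F\<close> depends only on those
  in \<open>S\<close>. Scalars are taken from the center because only central factors can be pulled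
  out of an arbitrary position of a product.\<close>

locale multilinear =
  fixes R (structure) and S :: "nat set" and F :: "(nat \<Rightarrow> 'a) \<Rightarrow> 'a"
  assumes closed: "x \<in> UNIV \<rightarrow> carrier R \<Longrightarrow> F x \<in> carrier R"
    and cong: "x \<in> UNIV \<rightarrow> carrier R \<Longrightarrow> y \<in> UNIV \<rightarrow> carrier R \<Longrightarrow> (\<And>i. i \<in> S \<Longrightarrow> x i = y i) \<Longrightarrow> F x = F y"
    and add: "x \<in> UNIV \<rightarrow> carrier R \<Longrightarrow> i \<in> S \<Longrightarrow> u \<in> carrier R \<Longrightarrow> v \<in> carrier R \<Longrightarrow>
      F (x(i := u \<oplus> v)) = F (x(i := u)) \<oplus> F (x(i := v))"
    and scale: "x \<in> UNIV \<rightarrow> carrier R \<Longrightarrow> i \<in> S \<Longrightarrow> u \<in> carrier R \<Longrightarrow> z \<in> ring_center R \<Longrightarrow>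
      F (x(i := z \<otimes> u)) = z \<otimes> F (x(i := u))"

lemma upd_closed: "x \<in> UNIV \<rightarrow> C \<Longrightarrow> u \<in> C \<Longrightarrow> x(i := u) \<in> UNIV \<rightarrow> C"
  by auto

lemma (in ring) ring_centerD: "z \<in> ring_center R \<Longrightarrow> z \<in> carrier R"
  "z \<in> ring_center R \<Longrightarrow> a \<in> carrier R \<Longrightarrow> z \<otimes> a = a \<otimes> z"
  by (simp_all add: ring_center_def)

lemma (in ring) multilinear_one: "multilinear R {} (\<lambda>x. \<one>)"
  by unfold_locales auto

lemma (in ring) multilinear_var: "multilinear R {i} (\<lambda>x. x i)"
  by unfold_locales (auto simp: Pi_iff)

text \<open>As the index sets are disjoint, changing one variable affects only one factor. A central
  scalar coming out of the right factor commutes past the left one.\<close>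

lemma (in ring) multilinear_mult:
  assumes F: "multilinear R S F" and G: "multilinear R T G" and ST: "S \<inter> T = {}"
  shows "multilinear R (S \<union> T) (\<lambda>x. F x \<otimes> G x)"
proof unfold_locales
  fix x :: "nat \<Rightarrow> 'a" assume "x \<in> UNIV \<rightarrow> carrier R"
  then show "F x \<otimes> G x \<in> carrier R" using F G by (simp add: multilinear.closed)
next
  fix x y assume "x \<in> UNIV \<rightarrow> carrier R" "y \<in> UNIV \<rightarrow> carrier R" "\<And>i. i \<in> S \<union> T \<Longrightarrow> x i = y i"
  then show "F x \<otimes> G x = F y \<otimes> G y"
    using multilinear.cong[OF F, of x y] multilinear.cong[OF G, of x y] by auto
next
  fix x :: "nat \<Rightarrow> 'a" and i u v
  assume x: "x \<in> UNIV \<rightarrow> carrier R" and i: "i \<in> S \<union> T" and u: "u \<in> carrier R" and v: "v \<in> carrier R"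
  note cl = multilinear.closed[OF F upd_closed[OF x]] multilinear.closed[OF G upd_closed[OF x]] u v
  show "F (x(i := u \<oplus> v)) \<otimes> G (x(i := u \<oplus> v)) =
        F (x(i := u)) \<otimes> G (x(i := u)) \<oplus> F (x(i := v)) \<otimes> G (x(i := v))"
  proof (cases "i \<in> S")
    case True
    then have e: "G (x(i := w)) = G (x(i := u))" if "w \<in> carrier R" for w
      using ST by (intro multilinear.cong[OF G]) (use x u that in auto)
    show ?thesis
      unfolding e[OF a_closed[OF u v]] e[OF v] multilinear.add[OF F x True u v] using cl by (simp add: l_distr)
  next
    case False
    then have iT: "i \<in> T" using i by blast
    then have e: "F (x(i := w)) = F (x(i := u))" if "w \<in> carrier R" for w
      using False by (intro multilinear.cong[OF F]) (use x u that in auto)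
    show ?thesis
      unfolding e[OF a_closed[OF u v]] e[OF v] multilinear.add[OF G x iT u v] using cl by (simp add: r_distr)
  qed
next
  fix x :: "nat \<Rightarrow> 'a" and i u z
  assume x: "x \<in> UNIV \<rightarrow> carrier R" and i: "i \<in> S \<union> T" and u: "u \<in> carrier R" and z: "z \<in> ring_center R"
  note cl = multilinear.closed[OF F upd_closed[OF x]] multilinear.closed[OF G upd_closed[OF x]]
    u ring_centerD(1)[OF z]
  show "F (x(i := z \<otimes> u)) \<otimes> G (x(i := z \<otimes> u)) = z \<otimes> (F (x(i := u)) \<otimes> G (x(i := u)))"
  proof (cases "i \<in> S")
    case True
    then have e: "G (x(i := w)) = G (x(i := u))" if "w \<in> carrier R" for w
      using ST by (intro multilinear.cong[OF G]) (use x u that in auto)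
    show ?thesis
      unfolding e[OF m_closed[OF ring_centerD(1)[OF z] u]] multilinear.scale[OF F x True u z] using cl by (simp add: m_assoc)
  next
    case False
    then have iT: "i \<in> T" using i by blast
    then have e: "F (x(i := w)) = F (x(i := u))" if "w \<in> carrier R" for w
      using False by (intro multilinear.cong[OF F]) (use x u that in auto)
    have "F (x(i := u)) \<otimes> (z \<otimes> G (x(i := u))) = z \<otimes> (F (x(i := u)) \<otimes> G (x(i := u)))"
      using cl ring_centerD(2)[OF z, of "F (x(i := u))"] by (simp add: m_assoc[symmetric])
    then show ?thesis
      unfolding e[OF m_closed[OF ring_centerD(1)[OF z] u]] multilinear.scale[OF G x iT u z] .
  qed
qed

lemma (in ring) int_multiple_closed [simp]: "a \<in> carrier R \<Longrightarrow> add_pow R (k::int) a \<in> carrier R"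
  by (rule add.int_pow_closed)

lemma (in ring) multilinear_int_multiple:
  assumes F: "multilinear R S F"
  shows "multilinear R S (\<lambda>x. add_pow R (k::int) (F x))"
proof unfold_locales
  fix x :: "nat \<Rightarrow> 'a" assume "x \<in> UNIV \<rightarrow> carrier R"
  then show "add_pow R k (F x) \<in> carrier R" using F by (simp add: multilinear.closed)
next
  fix x y assume "x \<in> UNIV \<rightarrow> carrier R" "y \<in> UNIV \<rightarrow> carrier R" "\<And>i. i \<in> S \<Longrightarrow> x i = y i"
  then show "add_pow R k (F x) = add_pow R k (F y)" using multilinear.cong[OF F, of x y] by auto
next
  fix x :: "nat \<Rightarrow> 'a" and i u v
  assume x: "x \<in> UNIV \<rightarrow> carrier R" and i: "i \<in> S" and u: "u \<in> carrier R" and v: "v \<in> carrier R"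
  show "add_pow R k (F (x(i := u \<oplus> v))) = add_pow R k (F (x(i := u))) \<oplus> add_pow R k (F (x(i := v)))"
    unfolding multilinear.add[OF F x i u v]
    using u v by (intro add.int_pow_distrib multilinear.closed[OF F upd_closed[OF x]])
next
  fix x :: "nat \<Rightarrow> 'a" and i u z
  assume x: "x \<in> UNIV \<rightarrow> carrier R" and i: "i \<in> S" and u: "u \<in> carrier R" and z: "z \<in> ring_center R"
  show "add_pow R k (F (x(i := z \<otimes> u))) = z \<otimes> (add_pow R k (F (x(i := u))))"
    unfolding multilinear.scale[OF F x i u z]
    using u ring_centerD(1)[OF z]
    by (intro add_pow_rdistr_int[symmetric] multilinear.closed[OF F upd_closed[OF x]])
qed

lemma (in ring) multilinear_finsum:
  assumes F: "\<And>j. j \<in> J \<Longrightarrow> multilinear R S (F j)" and "finite J"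
  shows "multilinear R S (\<lambda>x. \<Oplus>j\<in>J. F j x)"
proof unfold_locales
  fix x :: "nat \<Rightarrow> 'a" assume "x \<in> UNIV \<rightarrow> carrier R"
  then show "(\<Oplus>j\<in>J. F j x) \<in> carrier R" using multilinear.closed[OF F] by (intro finsum_closed) auto
next
  fix x y assume xy: "x \<in> UNIV \<rightarrow> carrier R" "y \<in> UNIV \<rightarrow> carrier R" "\<And>i. i \<in> S \<Longrightarrow> x i = y i"
  have "F j x = F j y" if "j \<in> J" for j using multilinear.cong[OF F[OF that], of x y] xy by auto
  then show "(\<Oplus>j\<in>J. F j x) = (\<Oplus>j\<in>J. F j y)"
    using xy multilinear.closed[OF F] by (intro finsum_cong') auto
next
  fix x :: "nat \<Rightarrow> 'a" and i u v
  assume x: "x \<in> UNIV \<rightarrow> carrier R" and i: "i \<in> S" and u: "u \<in> carrier R" and v: "v \<in> carrier R"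
  note cl = multilinear.closed[OF F upd_closed[OF x]]
  have "(\<Oplus>j\<in>J. F j (x(i := u \<oplus> v))) = (\<Oplus>j\<in>J. F j (x(i := u)) \<oplus> F j (x(i := v)))"
    using cl u v by (intro finsum_cong') (auto simp: multilinear.add[OF F x i u v])
  also have "\<dots> = (\<Oplus>j\<in>J. F j (x(i := u))) \<oplus> (\<Oplus>j\<in>J. F j (x(i := v)))"
    using cl u v by (intro finsum_addf) auto
  finally show "(\<Oplus>j\<in>J. F j (x(i := u \<oplus> v))) = \<dots>" .
next
  fix x :: "nat \<Rightarrow> 'a" and i u z
  assume x: "x \<in> UNIV \<rightarrow> carrier R" and i: "i \<in> S" and u: "u \<in> carrier R" and z: "z \<in> ring_center R"
  note cl = multilinear.closed[OF F upd_closed[OF x]]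
  have "(\<Oplus>j\<in>J. F j (x(i := z \<otimes> u))) = (\<Oplus>j\<in>J. z \<otimes> F j (x(i := u)))"
    using cl u ring_centerD(1)[OF z] by (intro finsum_cong') (auto simp: multilinear.scale[OF F x i u z])
  also have "\<dots> = z \<otimes> (\<Oplus>j\<in>J. F j (x(i := u)))"
    using cl u ring_centerD(1)[OF z] \<open>finite J\<close> by (intro finsum_rdistr[symmetric]) auto
  finally show "(\<Oplus>j\<in>J. F j (x(i := z \<otimes> u))) = \<dots>" .
qed

section \<open>Spans over the center, and multilinear functions on them\<close>

inductive_set central_span :: "('a, 'm) ring_scheme \<Rightarrow> 'a set \<Rightarrow> 'a set"
  for R :: "('a, 'm) ring_scheme" and G :: "'a set" where
  zero: "\<zero>\<^bsub>R\<^esub> \<in> central_span R G"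
| scale: "z \<in> ring_center R \<Longrightarrow> g \<in> G \<Longrightarrow> z \<otimes>\<^bsub>R\<^esub> g \<in> central_span R G"
| add: "u \<in> central_span R G \<Longrightarrow> v \<in> central_span R G \<Longrightarrow> u \<oplus>\<^bsub>R\<^esub> v \<in> central_span R G"

lemma (in ring) central_span_closed:
  assumes "G \<subseteq> carrier R" "u \<in> central_span R G" shows "u \<in> carrier R"
  using assms(2,1) by induction (auto simp: ring_center_def)

lemma (in ring) central_span_finsum:
  assumes "\<And>i. i \<in> A \<Longrightarrow> f i \<in> central_span R G" "G \<subseteq> carrier R"
  shows "finsum R f A \<in> central_span R G"
  using assms(1)
proof (induction A rule: infinite_finite_induct)
  case (insert a A)
  then have "finsum R f (insert a A) = f a \<oplus> finsum R f A"
    using central_span_closed[OF assms(2)] by (intro finsum_insert) auto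
  then show ?case using insert by (auto intro: central_span.add)
qed (auto intro: central_span.zero)

lemma (in ring) ring_center_zero: "\<zero> \<in> ring_center R"
  by (simp add: ring_center_def)

lemma (in ring) multilinear_vanishing_step:
  assumes F: "multilinear R S F" and i: "i \<in> S" and x: "x \<in> UNIV \<rightarrow> carrier R"
    and G: "G \<subseteq> carrier R" and van: "\<And>g. g \<in> G \<Longrightarrow> F (x(i := g)) = \<zero>"
    and u: "u \<in> central_span R G"
  shows "F (x(i := u)) = \<zero>"
  using u
proof induction
  case zero
  have "F (x(i := \<zero>)) = F (x(i := \<zero> \<otimes> \<zero>))" by simp
  also have "\<dots> = \<zero> \<otimes> F (x(i := \<zero>))"
    using multilinear.scale[OF F x i _ ring_center_zero, of \<zero>] by simp
  also have "\<dots> = \<zero>" using multilinear.closed[OF F upd_closed[OF x]] by simp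
  finally show ?case .
next
  case (scale z g)
  then have "F (x(i := z \<otimes> g)) = z \<otimes> F (x(i := g))"
    using G by (intro multilinear.scale[OF F x i]) auto
  also have "\<dots> = \<zero>" unfolding van[OF scale(2)] using scale by (simp add: ring_centerD)
  finally show ?case .
next
  case (add u v)
  then have "F (x(i := u \<oplus> v)) = F (x(i := u)) \<oplus> F (x(i := v))"
    using G central_span_closed by (intro multilinear.add[OF F x i]) auto
  also have "\<dots> = \<zero>" unfolding add.IH by simp
  finally show ?case .
qed

text \<open>Polynomial rings, the enlarged algebra \<open>Alg\<close> and matrix rings are all
  central spans of smaller sets, so this lets identities be tested on generators. The induction
  enlarges the set \<open>T\<close> of indices whose values range over the span, the others still
  lying in \<open>G\<close>.\<close>

lemma (in ring) multilinear_vanishes_on_span: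
  assumes F: "multilinear R S F" and S: "finite S" and G: "G \<subseteq> carrier R"
    and van: "\<And>x. x \<in> UNIV \<rightarrow> carrier R \<Longrightarrow> (\<And>i. i \<in> S \<Longrightarrow> x i \<in> G) \<Longrightarrow> F x = \<zero>"
    and x: "x \<in> UNIV \<rightarrow> carrier R" "\<And>i. i \<in> S \<Longrightarrow> x i \<in> central_span R G"
  shows "F x = \<zero>"
proof -
  have "F x = \<zero>"
    if "finite T" "T \<subseteq> S" "x \<in> UNIV \<rightarrow> carrier R" "\<And>i. i \<in> T \<Longrightarrow> x i \<in> central_span R G"
      "\<And>i. i \<in> S - T \<Longrightarrow> x i \<in> G" for T x
    using that
  proof (induction T arbitrary: x)
    case empty
    then show ?case by (intro van) auto
  next
    case (insert t T)
    have "F (x(t := x t)) = \<zero>"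
    proof (rule multilinear_vanishing_step[OF F _ insert.prems(2) G])
      show "F (x(t := g)) = \<zero>" if "g \<in> G" for g
      proof (rule insert.IH)
        show "x(t := g) \<in> UNIV \<rightarrow> carrier R" using upd_closed[OF insert.prems(2)] G that by blast
      qed (use insert.prems insert.hyps that in auto)
    qed (use insert in auto)
    then show ?case by simp
  qed
  from this[OF S _ x] show ?thesis by simp
qed


subsection \<open>Capelli polynomials\<close>

definition remove_nth :: "nat \<Rightarrow> 'a list \<Rightarrow> 'a list" where
  "remove_nth j xs = take j xs @ drop (Suc j) xs"

lemma length_remove_nth [simp]: "j < length xs \<Longrightarrow> length (remove_nth j xs) = length xs - 1"
  by (auto simp: remove_nth_def)

lemma set_remove_nth: "set (remove_nth j xs) \<subseteq> set xs"
  by (auto simp: remove_nth_def dest: in_set_takeD in_set_dropD)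

lemma map_remove_nth: "map f (remove_nth j xs) = remove_nth j (map f xs)"
  by (simp add: remove_nth_def take_map drop_map)

lemma remove_nth_0 [simp]: "remove_nth 0 (x # xs) = xs"
  by (simp add: remove_nth_def)

lemma remove_nth_Suc [simp]: "remove_nth (Suc j) (x # xs) = x # remove_nth j xs"
  by (simp add: remove_nth_def)

lemma set_insert_remove_nth: "j < length xs \<Longrightarrow> insert (xs ! j) (set (remove_nth j xs)) = set xs"
  by (metis (no_types, lifting) Un_insert_right id_take_nth_drop list.simps(15) remove_nth_def set_append)

lemma distinct_remove_nth: "distinct xs \<Longrightarrow> distinct (remove_nth j xs)"
  by (auto simp: remove_nth_def set_take_disj_set_drop_if_distinct)

lemma nth_remove_nth:
  "j < length xs \<Longrightarrow> i < length xs - 1 \<Longrightarrow> remove_nth j xs ! i = (if i < j then xs ! i else xs ! Suc i)"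
  by (auto simp: remove_nth_def nth_append min_def)

lemma nth_notin_remove_nth: "distinct xs \<Longrightarrow> j < length xs \<Longrightarrow> xs ! j \<notin> set (remove_nth j xs)"
  by (auto simp: in_set_conv_nth nth_remove_nth nth_eq_iff_index_eq)

text \<open>For lists of equal length this is the signed sum over all orders of \<open>as\<close>,
  the last pair standing leftmost. It is defined by its expansion along the first pair, the form in
  which it is used. Each alternating argument has its own two free neighbours, so
  \<open>x a y\<close> with prescribed \<open>x\<close> and \<open>y\<close> can be substituted
  directly.\<close>

fun capelli :: "('a, 'm) ring_scheme \<Rightarrow> 'a list \<Rightarrow> ('a \<times> 'a) list \<Rightarrow> 'a" where
  "capelli R as [] = \<one>\<^bsub>R\<^esub>"
| "capelli R as ((x, y) # xys) =
     (\<Oplus>\<^bsub>R\<^esub>j\<in>{..<length as}. add_pow R ((-1) ^ j :: int)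
        (capelli R (remove_nth j as) xys \<otimes>\<^bsub>R\<^esub> (x \<otimes>\<^bsub>R\<^esub> as ! j \<otimes>\<^bsub>R\<^esub> y)))"

lemma set_remove_nth_subset: "set as \<subseteq> A \<Longrightarrow> set (remove_nth j as) \<subseteq> A"
  by (rule subset_trans[OF set_remove_nth])

context ring
begin

lemma capelli_closed:
  "set as \<subseteq> carrier R \<Longrightarrow> set xys \<subseteq> carrier R \<times> carrier R \<Longrightarrow> capelli R as xys \<in> carrier R"
proof (induction xys arbitrary: as)
  case (Cons p xys)
  obtain x y where p: "p = (x, y)" by (cases p)
  have "capelli R (remove_nth j as) xys \<in> carrier R" for j
    using Cons.prems set_remove_nth[of j as] by (intro Cons.IH) auto
  moreover have "as ! j \<in> carrier R" if "j < length as" for j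
    using Cons.prems that by auto
  ultimately show ?case using Cons.prems by (auto simp: p intro!: finsum_closed)
qed simp

lemma capelli_term_closed:
  assumes "set as \<subseteq> carrier R" "set xys \<subseteq> carrier R \<times> carrier R" "x \<in> carrier R" "y \<in> carrier R"
    "j < length as"
  shows "capelli R (remove_nth j as) xys \<otimes> (x \<otimes> as ! j \<otimes> y) \<in> carrier R"
  using assms capelli_closed set_remove_nth_subset nth_mem by (meson m_closed subsetD)

text \<open>Arguments are named by distinct indices so that the product rule for disjoint index sets
  applies. In every term of the expansion the index deleted from \<open>is\<close> reappears in the
  last factor, hence all terms have the same index set.\<close>

lemma multilinear_capelli:
  assumes "length is = length jks" "distinct (is @ map fst jks @ map snd jks)"
  shows "multilinear R (set is \<union> fst ` set jks \<union> snd ` set jks)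
    (\<lambda>x. capelli R (map x is) (map (\<lambda>(j, k). (x j, x k)) jks))"
  using assms
proof (induction jks arbitrary: "is")
  case Nil
  then show ?case using multilinear_one by simp
next
  case (Cons p jks)
  obtain j k where p: "p = (j, k)" by (cases p)
  have "multilinear R (set is \<union> fst ` set (p # jks) \<union> snd ` set (p # jks))
      (\<lambda>x. add_pow R ((-1) ^ l :: int)
        (capelli R (map x (remove_nth l is)) (map (\<lambda>(j, k). (x j, x k)) jks) \<otimes> (x j \<otimes> map x is ! l \<otimes> x k)))"
    if l: "l < length is" for l
  proof -
    have il: "is ! l \<in> set is" using l by simp
    have notin: "is ! l \<notin> fst ` set jks" "is ! l \<notin> snd ` set jks" using il Cons.prems by auto
    have IH: "multilinear R (set (remove_nth l is) \<union> fst ` set jks \<union> snd ` set jks)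
        (\<lambda>x. capelli R (map x (remove_nth l is)) (map (\<lambda>(j, k). (x j, x k)) jks))"
      using Cons.prems l set_remove_nth[of l "is"] by (intro Cons.IH) (auto simp: distinct_remove_nth)
    have jlk: "multilinear R ({j} \<union> {is ! l} \<union> {k}) (\<lambda>x. x j \<otimes> x (is ! l) \<otimes> x k)"
      by (intro multilinear_mult multilinear_var) (use Cons.prems il p in auto)
    have "(set (remove_nth l is) \<union> fst ` set jks \<union> snd ` set jks) \<inter> ({j} \<union> {is ! l} \<union> {k}) = {}"
      using Cons.prems p l nth_notin_remove_nth[of "is" l] set_remove_nth[of l "is"] il notin by auto
    then have "multilinear R (set (remove_nth l is) \<union> fst ` set jks \<union> snd ` set jks \<union> ({j} \<union> {is ! l} \<union> {k}))
      (\<lambda>x. add_pow R ((-1) ^ l :: int)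
        (capelli R (map x (remove_nth l is)) (map (\<lambda>(j, k). (x j, x k)) jks) \<otimes> (x j \<otimes> x (is ! l) \<otimes> x k)))"
      by (intro multilinear_int_multiple multilinear_mult[OF IH jlk])
    moreover have "set (remove_nth l is) \<union> fst ` set jks \<union> snd ` set jks \<union> ({j} \<union> {is ! l} \<union> {k}) =
        set is \<union> fst ` set (p # jks) \<union> snd ` set (p # jks)"
      using set_insert_remove_nth[OF l] p by auto
    ultimately show ?thesis using l by simp
  qed
  then have "multilinear R (set is \<union> fst ` set (p # jks) \<union> snd ` set (p # jks))
      (\<lambda>x. \<Oplus>l\<in>{..<length is}. add_pow R ((-1) ^ l :: int)
        (capelli R (map x (remove_nth l is)) (map (\<lambda>(j, k). (x j, x k)) jks) \<otimes> (x j \<otimes> map x is ! l \<otimes> x k)))"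
    by (intro multilinear_finsum) auto
  then show ?case by (simp add: p map_remove_nth)
qed

text \<open>One assignment in three blocks of length \<open>m\<close>: the alternating arguments,
  the first components of the pairs, the second components. Zero elsewhere keeps the assignment
  inside the carrier.\<close>

definition capelli_vals :: "'a list \<Rightarrow> ('a \<times> 'a) list \<Rightarrow> nat \<Rightarrow> 'a" where
  "capelli_vals as xys i = (let m = length as in
     if i < m then as ! i else if i < 2 * m then fst (xys ! (i - m))
     else if i < 3 * m then snd (xys ! (i - 2 * m)) else \<zero>)"

definition capelli_fun :: "nat \<Rightarrow> (nat \<Rightarrow> 'a) \<Rightarrow> 'a" where
  "capelli_fun m x =
     capelli R (map x [0..<m]) (map (\<lambda>(j, k). (x j, x k)) (map (\<lambda>i. (m + i, 2 * m + i)) [0..<m]))"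

lemma multilinear_capelli_fun: "multilinear R {..<3 * m} (capelli_fun m)"
proof -
  have "set [0..<m] \<union> fst ` set (map (\<lambda>i. (m + i, 2 * m + i)) [0..<m]) \<union>
      snd ` set (map (\<lambda>i. (m + i, 2 * m + i)) [0..<m]) = {..<3 * m}" (is "?L = _")
  proof
    show "{..<3 * m} \<subseteq> ?L"
    proof
      fix i assume "i \<in> {..<3 * m}"
      then consider "i < m" | "i = m + (i - m)" "i - m < m" | "i = 2 * m + (i - 2 * m)" "i - 2 * m < m"
        by force
      then show "i \<in> ?L" by cases (force simp: image_image)+
    qed
  qed auto
  moreover have "distinct ([0..<m] @ map fst (map (\<lambda>i. (m + i, 2 * m + i)) [0..<m])
      @ map snd (map (\<lambda>i. (m + i, 2 * m + i)) [0..<m]))"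
    by (auto simp: comp_def distinct_map inj_on_def)
  ultimately show ?thesis
    using multilinear_capelli[of "[0..<m]" "map (\<lambda>i. (m + i, 2 * m + i)) [0..<m]"]
    unfolding capelli_fun_def by simp
qed

lemma capelli_fun_vals:
  assumes "length as = m" "length xys = m"
  shows "capelli_fun m (capelli_vals as xys) = capelli R as xys"
proof -
  have "map (capelli_vals as xys) [0..<m] = as"
    using assms by (intro nth_equalityI) (auto simp: capelli_vals_def)
  moreover have "map (\<lambda>(j, k). (capelli_vals as xys j, capelli_vals as xys k))
      (map (\<lambda>i. (m + i, 2 * m + i)) [0..<m]) = xys"
    using assms by (intro nth_equalityI) (auto simp: capelli_vals_def Let_def)
  ultimately show ?thesis unfolding capelli_fun_def by simp
qed

lemma capelli_vals_mem:
  assumes "set as \<subseteq> G" "set xys \<subseteq> G \<times> G" "length xys = length as" "i < 3 * length as"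
  shows "capelli_vals as xys i \<in> G"
proof -
  have *: "fst (xys ! l) \<in> G \<and> snd (xys ! l) \<in> G" if "l < length as" for l
    using assms that nth_mem[of l xys] by (metis mem_Times_iff subsetD)
  show ?thesis
    using assms(1,3,4) *[of "i - length as"] *[of "i - 2 * length as"]
    by (auto simp: capelli_vals_def Let_def)
qed

lemma capelli_vals_closed:
  assumes "set as \<subseteq> carrier R" "set xys \<subseteq> carrier R \<times> carrier R" "length xys = length as"
  shows "capelli_vals as xys \<in> UNIV \<rightarrow> carrier R"
proof
  fix i show "capelli_vals as xys i \<in> carrier R"
    using capelli_vals_mem[OF assms, of i]
    by (cases "i < 3 * length as") (auto simp: capelli_vals_def Let_def)
qed

lemma capelli_vanishes_on_span:
  assumes G: "G \<subseteq> carrier R"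
    and van: "\<And>as xys. set as \<subseteq> G \<Longrightarrow> set xys \<subseteq> G \<times> G \<Longrightarrow> length as = m \<Longrightarrow> length xys = m \<Longrightarrow>
      capelli R as xys = \<zero>"
    and as: "set as \<subseteq> central_span R G" "set xys \<subseteq> central_span R G \<times> central_span R G"
      "length as = m" "length xys = m"
  shows "capelli R as xys = \<zero>"
proof -
  have sub: "central_span R G \<subseteq> carrier R" using central_span_closed[OF G] by blast
  have "capelli_fun m (capelli_vals as xys) = \<zero>"
  proof (rule multilinear_vanishes_on_span[OF multilinear_capelli_fun _ G])
    show "capelli_vals as xys \<in> UNIV \<rightarrow> carrier R"
      using as sub by (intro capelli_vals_closed) auto
    show "capelli_vals as xys i \<in> central_span R G" if "i \<in> {..<3 * m}" for i
      using capelli_vals_mem[OF as(1,2), of i] as that by auto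
    show "capelli_fun m x = \<zero>" if "\<And>i. i \<in> {..<3 * m} \<Longrightarrow> x i \<in> G" for x
      unfolding capelli_fun_def using that by (intro van) auto
  qed simp
  then show ?thesis using as capelli_fun_vals by simp
qed

section \<open>Alternation in the first list of arguments\<close>

lemma capelli_add_slot:
  assumes "set p \<subseteq> carrier R" "set q \<subseteq> carrier R" "u \<in> carrier R" "v \<in> carrier R"
    "set xys \<subseteq> carrier R \<times> carrier R" "length xys = Suc (length p + length q)"
  shows "capelli R (p @ (u \<oplus> v) # q) xys = capelli R (p @ u # q) xys \<oplus> capelli R (p @ v # q) xys"
proof -
  let ?x = "capelli_vals (p @ \<zero> # q) xys" and ?m = "Suc (length p + length q)"
  have e: "capelli R (p @ w # q) xys = capelli_fun ?m (?x(length p := w))" for w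
  proof -
    have "?x(length p := w) = capelli_vals (p @ w # q) xys"
      by (rule ext) (auto simp: capelli_vals_def Let_def nth_append nth_Cons')
    then show ?thesis using capelli_fun_vals[of "p @ w # q" ?m xys] assms(6) by simp
  qed
  show ?thesis
    unfolding e using assms by (intro multilinear.add[OF multilinear_capelli_fun] capelli_vals_closed) auto
qed

text \<open>Deleting either copy of \<open>u\<close> leaves the same list, and the two positions
  have opposite parity, so these terms cancel. Every other term keeps an adjacent pair and vanishes
  by induction. Arguing without antisymmetry covers characteristic 2.\<close>

lemma capelli_adjacent_equal:
  assumes "set p \<subseteq> carrier R" "set q \<subseteq> carrier R" "u \<in> carrier R"
    "set xys \<subseteq> carrier R \<times> carrier R" "length xys = Suc (Suc (length p + length q))"
  shows "capelli R (p @ u # u # q) xys = \<zero>"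
  using assms
proof (induction xys arbitrary: p q)
  case (Cons z xys)
  obtain x y where z: "z = (x, y)" by (cases z)
  define as where "as = p @ u # u # q"
  define f where "f j = add_pow R ((-1) ^ j :: int) (capelli R (remove_nth j as) xys \<otimes> (x \<otimes> as ! j \<otimes> y))" for j
  let ?n = "length p"
  have as: "set as \<subseteq> carrier R" using Cons.prems by (auto simp: as_def)
  have f: "f j \<in> carrier R" if "j < length as" for j
    unfolding f_def using Cons.prems as that z by (intro int_multiple_closed capelli_term_closed) auto
  have zero: "f j = \<zero>" if "j < length as" "j \<noteq> ?n" "j \<noteq> Suc ?n" for j
  proof -
    have "capelli R (remove_nth j as) xys = \<zero>"
    proof (cases "j < ?n")
      case True
      then have "remove_nth j as = remove_nth j p @ u # u # q" by (simp add: as_def remove_nth_def)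
      moreover have "capelli R (remove_nth j p @ u # u # q) xys = \<zero>"
        using Cons.prems True set_remove_nth[of j p] by (intro Cons.IH) auto
      ultimately show ?thesis by simp
    next
      case False
      define i where "i = j - ?n - 2"
      have j: "j = ?n + (2 + i)" "i < length q" using False that by (auto simp: i_def as_def)
      have "remove_nth j as = p @ u # u # remove_nth i q" by (simp add: as_def remove_nth_def j numeral_3_eq_3)
      moreover have "capelli R (p @ u # u # remove_nth i q) xys = \<zero>"
        using Cons.prems j set_remove_nth[of i q] by (intro Cons.IH) auto
      ultimately show ?thesis by simp
    qed
    moreover have "as ! j \<in> carrier R" using as that by auto
    ultimately show ?thesis using Cons.prems z by (simp add: f_def)
  qed
  have "remove_nth ?n as = remove_nth (Suc ?n) as" "as ! ?n = as ! Suc ?n"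
    by (simp_all add: as_def remove_nth_def nth_append)
  then have "f (Suc ?n) = \<ominus> f ?n"
    using Cons.prems as z capelli_term_closed[of as xys x y "Suc ?n"]
    by (simp add: f_def add.int_pow_neg as_def)
  moreover have "finsum R f {..<length as} = f ?n \<oplus> (f (Suc ?n) \<oplus> finsum R f ({..<length as} - {?n} - {Suc ?n}))"
    using finsum_split_off[of "{..<length as}" ?n f] finsum_split_off[of "{..<length as} - {?n}" "Suc ?n" f] f
    by (auto simp: as_def)
  moreover have "finsum R f ({..<length as} - {?n} - {Suc ?n}) = \<zero>"
    by (rule finsum_eq_zero) (use zero in auto)
  moreover have "f ?n \<in> carrier R" by (rule f) (simp add: as_def)
  ultimately have "finsum R f {..<length as} = \<zero>" by (simp add: r_neg)
  then show ?case unfolding f_def as_def z by simp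
qed simp

text \<open>Polarization: insert \<open>u \<oplus> v\<close> in both slots and expand. Transporting
  only the vanishing avoids all signs.\<close>

lemma capelli_swap_zero:
  assumes "set p \<subseteq> carrier R" "set q \<subseteq> carrier R" "u \<in> carrier R" "v \<in> carrier R"
    "set xys \<subseteq> carrier R \<times> carrier R" "length xys = Suc (Suc (length p + length q))"
    and z: "capelli R (p @ u # v # q) xys = \<zero>"
  shows "capelli R (p @ v # u # q) xys = \<zero>"
proof -
  let ?c = "\<lambda>a b. capelli R (p @ a # b # q) xys"
  have cl: "?c a b \<in> carrier R" if "a \<in> carrier R" "b \<in> carrier R" for a b
    using assms that by (intro capelli_closed) auto
  have l: "?c (a \<oplus> b) w = ?c a w \<oplus> ?c b w" if "a \<in> carrier R" "b \<in> carrier R" "w \<in> carrier R" for a b w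
    using assms that by (intro capelli_add_slot) auto
  have r: "?c w (a \<oplus> b) = ?c w a \<oplus> ?c w b" if "a \<in> carrier R" "b \<in> carrier R" "w \<in> carrier R" for a b w
    using capelli_add_slot[of "p @ [w]" q a b xys] assms that by auto
  have eq: "?c a a = \<zero>" if "a \<in> carrier R" for a
    using assms that by (intro capelli_adjacent_equal) auto
  have "\<zero> = ?c (u \<oplus> v) (u \<oplus> v)" using assms by (simp add: eq)
  also have "\<dots> = ?c u (u \<oplus> v) \<oplus> ?c v (u \<oplus> v)" using assms by (intro l) auto
  also have "\<dots> = ?c v u"
    using assms cl by (simp add: r eq z)
  finally show ?thesis by simp
qed

lemma capelli_move_zero:
  assumes "set s \<subseteq> carrier R" "set p \<subseteq> carrier R" "set q \<subseteq> carrier R" "u \<in> carrier R"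
    "set xys \<subseteq> carrier R \<times> carrier R" "length xys = Suc (length s + length p + length q)"
    and z: "capelli R (s @ u # p @ q) xys = \<zero>"
  shows "capelli R (s @ p @ u # q) xys = \<zero>"
  using assms
proof (induction p arbitrary: q rule: rev_induct)
  case (snoc w p)
  have "capelli R (s @ p @ u # w # q) xys = \<zero>"
    using snoc.prems by (intro snoc.IH) auto
  then have "capelli R ((s @ p) @ w # u # q) xys = \<zero>"
    using snoc.prems by (intro capelli_swap_zero[of "s @ p" q u w]) auto
  then show ?case by simp
qed simp

text \<open>Start from the vanishing value with both copies of \<open>u\<close> in front. Move the
  second copy across \<open>p @ q\<close>, then the first across \<open>p\<close>, into their
  original places.\<close>

lemma capelli_not_distinct:
  assumes "set as \<subseteq> carrier R" "set xys \<subseteq> carrier R \<times> carrier R" "length xys = length as" "\<not> distinct as"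
  shows "capelli R as xys = \<zero>"
proof -
  obtain p q r u where as: "as = p @ [u] @ q @ [u] @ r"
    using not_distinct_decomp[OF assms(4)] by blast
  have "capelli R ([] @ u # u # (p @ q @ r)) xys = \<zero>"
    using assms as by (intro capelli_adjacent_equal) auto
  then have "capelli R ([u] @ (p @ q) @ u # r) xys = \<zero>"
    using assms as by (intro capelli_move_zero) auto
  then have "capelli R ([] @ p @ u # (q @ u # r)) xys = \<zero>"
    using assms as by (intro capelli_move_zero) auto
  then show ?thesis using as by simp
qed

end

section \<open>Capelli polynomials under ring homomorphisms\<close>

lemma ring_hom_int_multiple:
  assumes R: "ring R" and S: "ring S" and h: "h \<in> ring_hom R S" and a: "a \<in> carrier R"
  shows "h (add_pow R (k::int) a) = add_pow S k (h a)"
proof -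
  interpret h: ring_hom_ring R S h using R S h by (simp add: ring_hom_ringI2)
  show ?thesis unfolding add_pow_def
    using group_hom.hom_int_pow[OF h.a_group_hom] a by simp
qed

lemma capelli_hom:
  assumes R: "ring R" and S: "ring S" and h: "h \<in> ring_hom R S"
    and "set as \<subseteq> carrier R" "set xys \<subseteq> carrier R \<times> carrier R"
  shows "h (capelli R as xys) = capelli S (map h as) (map (\<lambda>(x, y). (h x, h y)) xys)"
  using assms(4,5)
proof (induction xys arbitrary: as)
  case Nil
  then show ?case using ring_hom_one[OF h] by simp
next
  case (Cons z xys)
  interpret R: ring R by fact
  interpret S: ring S by fact
  interpret h: ring_hom_ring R S h using R S h by (simp add: ring_hom_ringI2)
  obtain x y where z: "z = (x, y)" by (cases z)
  let ?t = "\<lambda>j. capelli R (remove_nth j as) xys \<otimes>\<^bsub>R\<^esub> (x \<otimes>\<^bsub>R\<^esub> as ! j \<otimes>\<^bsub>R\<^esub> y)"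
  have t: "?t j \<in> carrier R" if "j < length as" for j
    using R.capelli_term_closed[of as xys x y j] Cons.prems z that by auto
  have "h (capelli R as (z # xys)) = (\<Oplus>\<^bsub>S\<^esub>j\<in>{..<length as}. h (add_pow R ((-1) ^ j :: int) (?t j)))"
    using t by (simp add: z comp_def)
  also have "\<dots> = (\<Oplus>\<^bsub>S\<^esub>j\<in>{..<length as}. add_pow S ((-1) ^ j :: int)
      (capelli S (remove_nth j (map h as)) (map (\<lambda>(x, y). (h x, h y)) xys) \<otimes>\<^bsub>S\<^esub> (h x \<otimes>\<^bsub>S\<^esub> map h as ! j \<otimes>\<^bsub>S\<^esub> h y)))"
  proof (rule S.finsum_cong')
    fix j assume j: "j \<in> {..<length as}"
    have c: "capelli R (remove_nth j as) xys \<in> carrier R"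
      using Cons.prems set_remove_nth[of j as] by (intro R.capelli_closed) auto
    have a: "as ! j \<in> carrier R" using j Cons.prems by auto
    have IH: "h (capelli R (remove_nth j as) xys) = capelli S (map h (remove_nth j as)) (map (\<lambda>(x, y). (h x, h y)) xys)"
      using Cons.prems set_remove_nth[of j as] by (intro Cons.IH) auto
    show "h (add_pow R ((-1) ^ j :: int) (?t j)) = add_pow S ((-1) ^ j :: int)
      (capelli S (remove_nth j (map h as)) (map (\<lambda>(x, y). (h x, h y)) xys) \<otimes>\<^bsub>S\<^esub> (h x \<otimes>\<^bsub>S\<^esub> map h as ! j \<otimes>\<^bsub>S\<^esub> h y))"
      using c a t[of j] j Cons.prems z h.hom_mult by (simp add: ring_hom_int_multiple[OF R S h] IH map_remove_nth)
  next
    show "(\<lambda>j. add_pow S ((-1) ^ j :: int)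
      (capelli S (remove_nth j (map h as)) (map (\<lambda>(x, y). (h x, h y)) xys) \<otimes>\<^bsub>S\<^esub> (h x \<otimes>\<^bsub>S\<^esub> map h as ! j \<otimes>\<^bsub>S\<^esub> h y)))
      \<in> {..<length as} \<rightarrow> carrier S"
      using Cons.prems z
      by (intro Pi_I S.int_multiple_closed S.capelli_term_closed) auto
  qed simp
  finally show ?case by (simp add: z)
qed


subsection \<open>Multilinear polynomials\<close>

definition word_prod :: "('a, 'm) ring_scheme \<Rightarrow> (nat \<Rightarrow> 'a) \<Rightarrow> nat list \<Rightarrow> 'a" where
  "word_prod R x w = foldr (\<otimes>\<^bsub>R\<^esub>) (map x w) \<one>\<^bsub>R\<^esub>"

definition mlpoly :: "('a, 'm) ring_scheme \<Rightarrow> nat \<Rightarrow> (nat list \<Rightarrow> int) \<Rightarrow> (nat \<Rightarrow> 'a) \<Rightarrow> 'a" where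
  "mlpoly R N c x = (\<Oplus>\<^bsub>R\<^esub>w\<in>permutations_of_set {..<N}. add_pow R (c w) (word_prod R x w))"

text \<open>The normalization concerns \<open>c\<close> alone, so it passes to quotients and
  extensions for free. The two applications, to nil left ideals and to dimensions, choose arguments
  for which only the monomial with this coefficient 1 can survive.\<close>

definition ml_identity :: "('a, 'm) ring_scheme \<Rightarrow> nat \<Rightarrow> (nat list \<Rightarrow> int) \<Rightarrow> bool" where
  "ml_identity R N c \<longleftrightarrow> c [0..<N] = 1 \<and> (\<forall>x\<in>UNIV \<rightarrow> carrier R. mlpoly R N c x = \<zero>\<^bsub>R\<^esub>)"

lemma word_prod_simps [simp]: "word_prod R x [] = \<one>\<^bsub>R\<^esub>" "word_prod R x (i # w) = x i \<otimes>\<^bsub>R\<^esub> word_prod R x w"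
  by (simp_all add: word_prod_def)

context ring
begin

lemma word_prod_closed [simp]: "(\<And>i. i \<in> set w \<Longrightarrow> x i \<in> carrier R) \<Longrightarrow> word_prod R x w \<in> carrier R"
  by (induction w) auto

lemma word_prod_append:
  "x \<in> UNIV \<rightarrow> carrier R \<Longrightarrow> word_prod R x (v @ w) = word_prod R x v \<otimes> word_prod R x w"
  by (induction v) (auto simp: m_assoc Pi_iff)

lemma multilinear_word_prod: "distinct w \<Longrightarrow> multilinear R (set w) (\<lambda>x. word_prod R x w)"
proof (induction w)
  case (Cons i w)
  then have "multilinear R ({i} \<union> set w) (\<lambda>x. x i \<otimes> word_prod R x w)"
    by (intro multilinear_mult multilinear_var) auto
  then show ?case by simp
qed (use multilinear_one in simp)

lemma multilinear_mlpoly: "multilinear R {..<N} (mlpoly R N c)"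
proof -
  have "multilinear R {..<N} (\<lambda>x. add_pow R (c w) (word_prod R x w))" if "w \<in> permutations_of_set {..<N}" for w
    using multilinear_word_prod[of w] permutations_of_setD[OF that] by (intro multilinear_int_multiple) simp
  then show ?thesis unfolding mlpoly_def by (intro multilinear_finsum) auto
qed

lemma ml_identity_on_span:
  assumes "G \<subseteq> carrier R" "c [0..<N] = 1" "carrier R \<subseteq> central_span R G"
    and van: "\<And>x. x \<in> UNIV \<rightarrow> carrier R \<Longrightarrow> (\<And>i. i < N \<Longrightarrow> x i \<in> G) \<Longrightarrow> mlpoly R N c x = \<zero>"
  shows "ml_identity R N c"
  unfolding ml_identity_def
proof (intro conjI ballI)
  fix x :: "nat \<Rightarrow> 'a" assume x: "x \<in> UNIV \<rightarrow> carrier R"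
  show "mlpoly R N c x = \<zero>"
    by (rule multilinear_vanishes_on_span[OF multilinear_mlpoly _ assms(1) _ x]) (use van x assms(3) in auto)
qed fact

end

lemma word_prod_hom:
  assumes h: "h \<in> ring_hom R S" and R: "ring R"
    and x: "x \<in> UNIV \<rightarrow> carrier R" and y: "\<And>i. i \<in> set w \<Longrightarrow> y i = h (x i)"
  shows "h (word_prod R x w) = word_prod S y w"
  using y
proof (induction w)
  case (Cons i w)
  interpret R: ring R by fact
  have "x i \<in> carrier R" "word_prod R x w \<in> carrier R" using x R.word_prod_closed[of w x] by (auto simp: Pi_iff)
  then show ?case using Cons by (simp add: ring_hom_mult[OF h])
qed (simp add: ring_hom_one[OF h])

lemma mlpoly_hom:
  assumes R: "ring R" and S: "ring S" and h: "h \<in> ring_hom R S"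
    and x: "x \<in> UNIV \<rightarrow> carrier R" and y: "y \<in> UNIV \<rightarrow> carrier S" "\<And>i. i < N \<Longrightarrow> y i = h (x i)"
  shows "h (mlpoly R N c x) = mlpoly S N c y"
proof -
  interpret R: ring R by fact
  interpret S: ring S by fact
  interpret h: ring_hom_ring R S h using R S h by (simp add: ring_hom_ringI2)
  have wx: "word_prod R x w \<in> carrier R" for w using x R.word_prod_closed[of w x] by (auto simp: Pi_iff)
  have wy: "word_prod S y w \<in> carrier S" for w using y S.word_prod_closed[of w y] by (auto simp: Pi_iff)
  have "h (mlpoly R N c x) = (\<Oplus>\<^bsub>S\<^esub>w\<in>permutations_of_set {..<N}. h (add_pow R (c w) (word_prod R x w)))"
    unfolding mlpoly_def using wx by (simp add: comp_def)
  also have "\<dots> = mlpoly S N c y"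
    unfolding mlpoly_def
  proof (rule S.finsum_cong')
    fix w assume "w \<in> permutations_of_set {..<N}"
    then have "h (word_prod R x w) = word_prod S y w"
      by (intro word_prod_hom[OF h R x]) (auto dest: permutations_of_setD intro!: y)
    then show "h (add_pow R (c w) (word_prod R x w)) = add_pow S (c w) (word_prod S y w)"
      by (simp add: ring_hom_int_multiple[OF R S h wx])
  qed (use wy in auto)
  finally show ?thesis .
qed

lemma ml_identity_surj_hom:
  assumes R: "ring R" and S: "ring S" and h: "h \<in> ring_hom R S" and surj: "h ` carrier R = carrier S"
    and id: "ml_identity R N c"
  shows "ml_identity S N c"
  unfolding ml_identity_def
proof (intro conjI ballI)
  fix y :: "nat \<Rightarrow> _" assume y: "y \<in> UNIV \<rightarrow> carrier S"
  define x where "x i = (SOME a. a \<in> carrier R \<and> h a = y i)" for i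
  have x: "x i \<in> carrier R \<and> h (x i) = y i" for i
    unfolding x_def by (rule someI_ex) (use y surj in \<open>auto simp: Pi_iff image_iff\<close>, metis imageE)
  have "mlpoly S N c y = h (mlpoly R N c x)"
    using x y by (intro mlpoly_hom[OF R S h, symmetric]) auto
  also have "\<dots> = h \<zero>\<^bsub>R\<^esub>" using id x by (simp add: ml_identity_def Pi_iff)
  finally show "mlpoly S N c y = \<zero>\<^bsub>S\<^esub>" by (simp add: ring_hom_zero[OF h R S])
qed (use id in \<open>simp add: ml_identity_def\<close>)

text \<open>Degree and coefficients are the same for both rings, which is why one \<open>N\<close>
  later bounds the sizes of all matrix representations at once.\<close>

lemma ml_identity_central_extension:
  assumes R: "ring R" and S: "ring S" and h: "h \<in> ring_hom R S"
    and span: "carrier S \<subseteq> central_span S (h ` carrier R)" and id: "ml_identity R N c"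
  shows "ml_identity S N c"
proof -
  interpret S: ring S by fact
  show ?thesis
  proof (rule S.ml_identity_on_span[of "h ` carrier R"])
    show "h ` carrier R \<subseteq> carrier S" using ring_hom_closed[OF h] by blast
    fix x assume x: "x \<in> UNIV \<rightarrow> carrier S" "\<And>i. i < N \<Longrightarrow> x i \<in> h ` carrier R"
    have "\<exists>b. b \<in> carrier R \<and> (i < N \<longrightarrow> h b = x i)" for i
      using x(2)[of i] ring.ring_simprules(2)[OF R] by (cases "i < N") auto
    then obtain y where y: "\<And>i. y i \<in> carrier R" "\<And>i. i < N \<Longrightarrow> h (y i) = x i" by metis
    have "h (mlpoly R N c y) = mlpoly S N c x"
      by (rule mlpoly_hom[OF R S h _ x(1)]) (use y in auto)
    then show "mlpoly S N c x = \<zero>\<^bsub>S\<^esub>"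
      using id y ring_hom_zero[OF h R S] by (simp add: ml_identity_def)
  qed (use id span in \<open>auto simp: ml_identity_def\<close>)
qed

section \<open>Capelli identities of images and central extensions\<close>

definition capelli_identity :: "('a, 'm) ring_scheme \<Rightarrow> nat \<Rightarrow> bool" where
  "capelli_identity R m \<longleftrightarrow> (\<forall>as xys. set as \<subseteq> carrier R \<longrightarrow> set xys \<subseteq> carrier R \<times> carrier R \<longrightarrow>
     length as = m \<longrightarrow> length xys = m \<longrightarrow> capelli R as xys = \<zero>\<^bsub>R\<^esub>)"

lemma capelli_identityD:
  "capelli_identity R m \<Longrightarrow> set as \<subseteq> carrier R \<Longrightarrow> set xys \<subseteq> carrier R \<times> carrier R \<Longrightarrow>
     length as = m \<Longrightarrow> length xys = m \<Longrightarrow> capelli R as xys = \<zero>\<^bsub>R\<^esub>"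
  unfolding capelli_identity_def by blast

text \<open>Chosen preimages exhibit a value at images as the image of a value. Only
  \<open>h\<close> of the values is assumed zero, so the lemma serves identities of \<open>R\<close>
  as well as values that merely lie in the kernel, as for quotients.\<close>

lemma capelli_hom_image_zero:
  assumes R: "ring R" and S: "ring S" and h: "h \<in> ring_hom R S"
    and z: "\<And>as xys. set as \<subseteq> carrier R \<Longrightarrow> set xys \<subseteq> carrier R \<times> carrier R \<Longrightarrow> length as = m \<Longrightarrow>
      length xys = m \<Longrightarrow> h (capelli R as xys) = \<zero>\<^bsub>S\<^esub>"
    and es: "set es \<subseteq> h ` carrier R" "set fgs \<subseteq> h ` carrier R \<times> h ` carrier R" "length es = m" "length fgs = m"
  shows "capelli S es fgs = \<zero>\<^bsub>S\<^esub>"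
proof -
  define g where "g e = (SOME b. b \<in> carrier R \<and> h b = e)" for e
  have g: "g e \<in> carrier R" "h (g e) = e" if "e \<in> h ` carrier R" for e
    using someI_ex[of "\<lambda>b. b \<in> carrier R \<and> h b = e"] that unfolding g_def by auto
  let ?as = "map g es" and ?xys = "map (\<lambda>(x, y). (g x, g y)) fgs"
  have as: "set ?as \<subseteq> carrier R" "set ?xys \<subseteq> carrier R \<times> carrier R" using es g by auto
  have "map h ?as = es" using es g by (auto intro!: map_idI)
  moreover have "map (\<lambda>(x, y). (h x, h y)) ?xys = fgs" using es g by (auto intro!: map_idI)
  moreover have "h (capelli R ?as ?xys) = capelli S (map h ?as) (map (\<lambda>(x, y). (h x, h y)) ?xys)"
    by (rule capelli_hom[OF R S h as])
  moreover have "h (capelli R ?as ?xys) = \<zero>\<^bsub>S\<^esub>" by (rule z[OF as]) (use es in auto)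
  ultimately show ?thesis by simp
qed

lemma capelli_identity_central_extension:
  assumes R: "ring R" and S: "ring S" and h: "h \<in> ring_hom R S"
    and span: "carrier S \<subseteq> central_span S (h ` carrier R)" and id: "capelli_identity R m"
  shows "capelli_identity S m"
  unfolding capelli_identity_def
proof (intro allI impI)
  interpret S: ring S by fact
  let ?G = "h ` carrier R"
  fix as xys assume asm: "set as \<subseteq> carrier S" "set xys \<subseteq> carrier S \<times> carrier S" "length as = m" "length xys = m"
  show "capelli S as xys = \<zero>\<^bsub>S\<^esub>"
  proof (rule S.capelli_vanishes_on_span)
    show "?G \<subseteq> carrier S" using ring_hom_closed[OF h] by blast
    show "set as \<subseteq> central_span S ?G" "set xys \<subseteq> central_span S ?G \<times> central_span S ?G"
      using asm(1,2) span by blast+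
    show "capelli S es fgs = \<zero>\<^bsub>S\<^esub>"
      if "set es \<subseteq> ?G" "set fgs \<subseteq> ?G \<times> ?G" "length es = m" "length fgs = m" for es fgs
      by (rule capelli_hom_image_zero[OF R S h _ that])
        (simp add: capelli_identityD[OF id] ring_hom_zero[OF h R S])
  qed (use asm in auto)
qed

subsection \<open>Linearization\<close>

context ring
begin

text \<open>These are the monomials contributed by the word \<open>v\<close> when each variable
  \<open>i\<close> is replaced by the sum of new variables \<open>y p\<close>, one for each position
  \<open>p\<close> at which \<open>i\<close> occurs in \<open>w\<close>.\<close>

definition lin_words :: "nat list \<Rightarrow> nat list \<Rightarrow> nat list set" where
  "lin_words w v = {\<tau>. set \<tau> \<subseteq> {..<length w} \<and> map ((!) w) \<tau> = v}"

lemma finite_lin_words [simp]: "finite (lin_words w v)"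
  by (rule finite_subset[OF _ finite_lists_length_eq[of "{..<length w}" "length v"]])
    (auto simp: lin_words_def)

lemma disjnt_lin_words: "v \<noteq> v' \<Longrightarrow> disjnt (lin_words w v) (lin_words w v')"
  by (auto simp: lin_words_def disjnt_def)

lemma word_prod_lin_words:
  assumes y: "y \<in> UNIV \<rightarrow> carrier R"
  shows "word_prod R (\<lambda>i. \<Oplus>p\<in>{p. p < length w \<and> w ! p = i}. y p) v = (\<Oplus>\<tau>\<in>lin_words w v. word_prod R y \<tau>)"
proof (induction v)
  case Nil
  have "lin_words w [] = {[]}" by (auto simp: lin_words_def)
  then show ?case by simp
next
  case (Cons i v)
  let ?P = "{p. p < length w \<and> w ! p = i}"
  have wy: "word_prod R y \<tau> \<in> carrier R" for \<tau> using y by (auto simp: Pi_iff)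
  have yp: "y p \<in> carrier R" for p using y by auto
  have un: "lin_words w (i # v) = (\<Union>p\<in>?P. (#) p ` lin_words w v)"
    by (auto simp: lin_words_def image_iff Cons_eq_map_conv map_eq_Cons_conv)
  have "(\<Oplus>\<tau>\<in>lin_words w (i # v). word_prod R y \<tau>) = (\<Oplus>p\<in>?P. \<Oplus>\<tau>\<in>(#) p ` lin_words w v. word_prod R y \<tau>)"
    unfolding un by (rule add.finprod_UN_disjoint) (use wy in \<open>auto simp: pairwise_def disjnt_def\<close>)
  also have "\<dots> = (\<Oplus>p\<in>?P. y p \<otimes> (\<Oplus>\<tau>\<in>lin_words w v. word_prod R y \<tau>))"
  proof (rule finsum_cong')
    fix p
    have "(\<Oplus>\<tau>\<in>(#) p ` lin_words w v. word_prod R y \<tau>) = (\<Oplus>\<tau>\<in>lin_words w v. word_prod R y (p # \<tau>))"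
      by (rule finsum_reindex) (use wy yp in auto)
    also have "\<dots> = y p \<otimes> (\<Oplus>\<tau>\<in>lin_words w v. word_prod R y \<tau>)"
      using wy yp by (simp add: finsum_rdistr)
    finally show "(\<Oplus>\<tau>\<in>(#) p ` lin_words w v. word_prod R y \<tau>) = y p \<otimes> (\<Oplus>\<tau>\<in>lin_words w v. word_prod R y \<tau>)" .
  qed (use wy yp in \<open>auto intro!: finsum_closed\<close>)
  also have "\<dots> = (\<Oplus>p\<in>?P. y p) \<otimes> (\<Oplus>\<tau>\<in>lin_words w v. word_prod R y \<tau>)"
    using wy yp by (intro finsum_ldistr[symmetric]) auto
  finally show ?case using Cons.IH by simp
qed

lemma word_prod_zero_var:
  "y \<in> UNIV \<rightarrow> carrier R \<Longrightarrow> p \<in> set \<tau> \<Longrightarrow> word_prod R (y(p := \<zero>)) \<tau> = \<zero>"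
proof (induction \<tau>)
  case (Cons i \<tau>)
  then have "word_prod R (y(p := \<zero>)) \<tau> \<in> carrier R" by (auto simp: Pi_iff)
  then show ?case using Cons by (cases "i = p") (auto simp: Pi_iff)
qed simp

lemma word_prod_cong:
  "(\<And>i. i \<in> set \<tau> \<Longrightarrow> x i = y i) \<Longrightarrow> word_prod R x \<tau> = word_prod R y \<tau>"
  by (induction \<tau>) auto

text \<open>Setting \<open>y p\<close> to zero removes exactly the words containing
  \<open>p\<close>. What remains is the sum over words avoiding \<open>p\<close>, so that sum
  vanishes, and with it the sum over words containing \<open>p\<close>.\<close>

lemma vanishing_words_containing:
  assumes W: "finite W" and P: "finite P"
    and van: "\<And>y. y \<in> UNIV \<rightarrow> carrier R \<Longrightarrow> (\<Oplus>\<tau>\<in>W. add_pow R (c \<tau> :: int) (word_prod R y \<tau>)) = \<zero>"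
    and y: "y \<in> UNIV \<rightarrow> carrier R"
  shows "(\<Oplus>\<tau>\<in>{\<tau>\<in>W. P \<subseteq> set \<tau>}. add_pow R (c \<tau>) (word_prod R y \<tau>)) = \<zero>"
  using P y
proof (induction P arbitrary: y)
  case empty
  then show ?case using van by simp
next
  case (insert p P)
  let ?t = "\<lambda>y \<tau>. add_pow R (c \<tau>) (word_prod R y \<tau>)" and ?y = "y(p := \<zero>)"
  let ?A = "{\<tau>\<in>W. insert p P \<subseteq> set \<tau>}" and ?B = "{\<tau>\<in>W. P \<subseteq> set \<tau> \<and> p \<notin> set \<tau>}"
  have cl: "?t y \<tau> \<in> carrier R" "?t ?y \<tau> \<in> carrier R" for \<tau>
    using insert.prems by (auto simp: Pi_iff)
  have split: "{\<tau>\<in>W. P \<subseteq> set \<tau>} = ?A \<union> ?B" by auto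
  have "\<zero> = finsum R (?t ?y) {\<tau>\<in>W. P \<subseteq> set \<tau>}"
    using insert.prems by (intro insert.IH[symmetric]) auto
  also have "\<dots> = finsum R (?t ?y) ?A \<oplus> finsum R (?t ?y) ?B"
    unfolding split using W cl by (intro finsum_Un_disjoint) auto
  also have "finsum R (?t ?y) ?A = \<zero>"
    by (rule finsum_eq_zero) (use insert.prems in \<open>auto simp: word_prod_zero_var\<close>)
  also have "finsum R (?t ?y) ?B = finsum R (?t y) ?B"
  proof (rule finsum_cong')
    show "?t ?y \<tau> = ?t y \<tau>" if "\<tau> \<in> ?B" for \<tau>
      using that word_prod_cong[of \<tau> ?y y] by (metis (mono_tags, lifting) fun_upd_other mem_Collect_eq)
  qed (use cl in auto)
  finally have B: "finsum R (?t y) ?B = \<zero>" using cl by (simp add: finsum_closed)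
  have "\<zero> = finsum R (?t y) {\<tau>\<in>W. P \<subseteq> set \<tau>}"
    using insert.prems by (intro insert.IH[symmetric]) auto
  also have "\<dots> = finsum R (?t y) ?A \<oplus> finsum R (?t y) ?B"
    unfolding split using W cl by (intro finsum_Un_disjoint) auto
  finally show ?case using cl B by (simp add: finsum_closed)
qed

end

text \<open>One new variable is introduced per position of the leading word \<open>w\<close>, so
  repeated letters are split in the same step. No word of \<open>f\<close> is longer than
  \<open>w\<close>; hence a word that uses every position is a permutation. The increasing one
  spells \<open>w\<close> and inherits its coefficient 1.\<close>

theorem (in ring) PI_ring_ml_identity:
  assumes "PI_ring R"
  shows "\<exists>N c. ml_identity R N c"
proof -
  obtain f w where w: "Poly_Mapping.lookup f w = 1" "\<forall>v\<in>Poly_Mapping.keys f. length v \<le> length w"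
    and f: "\<forall>x. range x \<subseteq> carrier R \<longrightarrow> nc_eval R f x = \<zero>"
    using assms unfolding PI_ring_def nc_monic_def by blast
  let ?N = "length w" and ?K = "Poly_Mapping.keys f"
  define c where "c \<tau> = Poly_Mapping.lookup f (map ((!) w) \<tau>)" for \<tau>
  define W where "W = (\<Union>v\<in>?K. lin_words w v)"
  have fin: "finite W" by (simp add: W_def)
  have van: "(\<Oplus>\<tau>\<in>W. add_pow R (c \<tau>) (word_prod R y \<tau>)) = \<zero>" if y: "y \<in> UNIV \<rightarrow> carrier R" for y
  proof -
    have wy: "word_prod R y \<tau> \<in> carrier R" for \<tau> using y by (auto simp: Pi_iff)
    \<comment> \<open>A variable of \<open>f\<close> that does not occur in \<open>w\<close>
      receives the empty sum, that is, zero.\<close>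
    let ?x = "\<lambda>i. \<Oplus>p\<in>{p. p < length w \<and> w ! p = i}. y p"
    have "(\<Oplus>\<tau>\<in>W. add_pow R (c \<tau>) (word_prod R y \<tau>)) =
        (\<Oplus>v\<in>?K. \<Oplus>\<tau>\<in>lin_words w v. add_pow R (c \<tau>) (word_prod R y \<tau>))"
      unfolding W_def
      by (rule add.finprod_UN_disjoint) (use wy in \<open>auto simp: pairwise_def disjnt_lin_words\<close>)
    also have "\<dots> = (\<Oplus>v\<in>?K. add_pow R (Poly_Mapping.lookup f v) (word_prod R ?x v))"
    proof (rule finsum_cong')
      fix v
      have "(\<Oplus>\<tau>\<in>lin_words w v. add_pow R (c \<tau>) (word_prod R y \<tau>)) =
          (\<Oplus>\<tau>\<in>lin_words w v. add_pow R (Poly_Mapping.lookup f v) (word_prod R y \<tau>))"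
        by (rule finsum_cong') (use wy in \<open>auto simp: c_def lin_words_def\<close>)
      also have "\<dots> = add_pow R (Poly_Mapping.lookup f v) (\<Oplus>\<tau>\<in>lin_words w v. word_prod R y \<tau>)"
        using wy
        by (intro finsum_additive[symmetric] abelian_monoid_axioms) (auto simp: add.int_pow_distrib)
      finally show "(\<Oplus>\<tau>\<in>lin_words w v. add_pow R (c \<tau>) (word_prod R y \<tau>)) =
          add_pow R (Poly_Mapping.lookup f v) (word_prod R ?x v)"
        by (simp add: word_prod_lin_words[OF y])
    qed (use wy in \<open>auto simp: word_prod_lin_words[OF y] intro!: finsum_closed\<close>)
    also have "\<dots> = nc_eval R f ?x" by (simp add: nc_eval_def word_prod_def)
    also have "\<dots> = \<zero>"
    proof -
      have "range ?x \<subseteq> carrier R" using y by (auto intro!: finsum_closed)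
      then show ?thesis using f by blast
    qed
    finally show ?thesis .
  qed
  have perm: "{\<tau>\<in>W. {..<?N} \<subseteq> set \<tau>} = {\<tau>\<in>permutations_of_set {..<?N}. c \<tau> \<noteq> 0}"
  proof (intro equalityI subsetI)
    fix \<tau> assume "\<tau> \<in> {\<tau>\<in>W. {..<?N} \<subseteq> set \<tau>}"
    then have t: "set \<tau> = {..<?N}" "map ((!) w) \<tau> \<in> ?K" by (auto simp: W_def lin_words_def)
    then have "length \<tau> \<le> ?N" using w(2) by (metis length_map)
    then have "distinct \<tau>" using t(1) card_length[of \<tau>] by (intro card_distinct) auto
    then show "\<tau> \<in> {\<tau>\<in>permutations_of_set {..<?N}. c \<tau> \<noteq> 0}"
      using t by (auto simp: c_def in_keys_iff)
  next
    fix \<tau> assume "\<tau> \<in> {\<tau>\<in>permutations_of_set {..<?N}. c \<tau> \<noteq> 0}"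
    then show "\<tau> \<in> {\<tau>\<in>W. {..<?N} \<subseteq> set \<tau>}"
      by (auto simp: W_def lin_words_def c_def in_keys_iff permutations_of_setD)
  qed
  have "mlpoly R ?N c y = \<zero>" if y: "y \<in> UNIV \<rightarrow> carrier R" for y
  proof -
    have wy: "word_prod R y \<tau> \<in> carrier R" for \<tau> using y by (auto simp: Pi_iff)
    \<comment> \<open>\<open>W\<close> is built from the support of \<open>f\<close>, so
      permutations with coefficient zero must be dropped before the two index sets agree.\<close>
    have "mlpoly R ?N c y = (\<Oplus>\<tau>\<in>{\<tau>\<in>permutations_of_set {..<?N}. c \<tau> \<noteq> 0}. add_pow R (c \<tau>) (word_prod R y \<tau>))"
      unfolding mlpoly_def by (rule add.finprod_mono_neutral_cong_right) (use wy in \<open>auto simp: add_pow_int_ge\<close>)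
    also have "\<dots> = \<zero>"
      unfolding perm[symmetric] by (rule vanishing_words_containing[OF fin _ van y]) simp
    finally show ?thesis .
  qed
  moreover have "c [0..<?N] = 1" by (simp add: c_def map_nth w(1))
  ultimately show ?thesis unfolding ml_identity_def by blast
qed

subsection \<open>Nil left ideals\<close>

context ring
begin

definition left_ideal :: "'a set \<Rightarrow> bool" where
  "left_ideal L \<longleftrightarrow> L \<subseteq> carrier R \<and> \<zero> \<in> L \<and> (\<forall>u\<in>L. \<forall>v\<in>L. u \<oplus> v \<in> L) \<and>
     (\<forall>r\<in>carrier R. \<forall>u\<in>L. r \<otimes> u \<in> L)"

lemma left_idealD:
  assumes "left_ideal L"
  shows "u \<in> L \<Longrightarrow> u \<in> carrier R" "\<zero> \<in> L" "u \<in> L \<Longrightarrow> v \<in> L \<Longrightarrow> u \<oplus> v \<in> L"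
    "r \<in> carrier R \<Longrightarrow> u \<in> L \<Longrightarrow> r \<otimes> u \<in> L"
  using assms by (auto simp: left_ideal_def)

lemma left_ideal_uminus:
  assumes "left_ideal L" "u \<in> L" shows "\<ominus> u \<in> L"
proof -
  have "\<ominus> u = (\<ominus> \<one>) \<otimes> u" using left_idealD(1)[OF assms] by (simp add: l_minus)
  then show ?thesis using left_idealD(4)[OF assms(1)] assms(2) by simp
qed

lemma left_ideal_rmult:
  assumes L: "left_ideal L" and a: "a \<in> carrier R" shows "left_ideal ((\<lambda>z. z \<otimes> a) ` L)"
  unfolding left_ideal_def
proof (intro conjI ballI)
  note D = left_idealD[OF L]
  show "(\<lambda>z. z \<otimes> a) ` L \<subseteq> carrier R" using D a by auto
  show "\<zero> \<in> (\<lambda>z. z \<otimes> a) ` L" using D(2) a by (auto intro!: image_eqI[of _ _ \<zero>])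
  show "u \<oplus> v \<in> (\<lambda>z. z \<otimes> a) ` L" if uv: "u \<in> (\<lambda>z. z \<otimes> a) ` L" "v \<in> (\<lambda>z. z \<otimes> a) ` L" for u v
  proof -
    obtain x y where "x \<in> L" "y \<in> L" "u = x \<otimes> a" "v = y \<otimes> a" using uv by blast
    then show ?thesis using D a by (auto intro!: image_eqI[of _ _ "x \<oplus> y"] simp: l_distr)
  qed
  show "r \<otimes> u \<in> (\<lambda>z. z \<otimes> a) ` L" if "r \<in> carrier R" "u \<in> (\<lambda>z. z \<otimes> a) ` L" for r u
  proof -
    obtain x where "x \<in> L" "u = x \<otimes> a" using \<open>u \<in> _\<close> by blast
    then show ?thesis using D a that by (auto intro!: image_eqI[of _ _ "r \<otimes> x"] simp: m_assoc)
  qed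
qed

definition nilp :: "'a \<Rightarrow> bool" where "nilp x \<longleftrightarrow> (\<exists>n::nat. x [^] n = \<zero>)"

text \<open>The right cofactor of the prefix \<open>x 0\<close>, ..., \<open>x (k - 1)\<close> in
  the multilinear polynomial; at \<open>k = N\<close> it is the normalized coefficient.\<close>

definition tail_poly :: "nat \<Rightarrow> (nat list \<Rightarrow> int) \<Rightarrow> nat \<Rightarrow> (nat \<Rightarrow> 'a) \<Rightarrow> 'a" where
  "tail_poly N c k x = (\<Oplus>w\<in>permutations_of_set {k..<N}. add_pow R (c ([0..<k] @ w)) (word_prod R x w))"

text \<open>Primeness gives \<open>b\<close> in \<open>L\<close> with \<open>L b\<close> nonzero.
  Let \<open>n\<close> be least with \<open>L b^n = 0\<close>; it exists because \<open>b\<close> is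
  nilpotent. Then \<open>n\<close> is at least 2, and \<open>a = b^(n-1)\<close> is a positive power
  of \<open>b\<close>, hence in \<open>L\<close>.\<close>

lemma square_zero_multiplier:
  assumes prime: "nc_prime_ideal {\<zero>} R" and L: "left_ideal L" "L \<noteq> {\<zero>}" and nil: "\<And>x. x \<in> L \<Longrightarrow> nilp x"
  obtains a where "a \<in> L" "\<exists>z\<in>L. z \<otimes> a \<noteq> \<zero>" "\<And>z. z \<in> L \<Longrightarrow> z \<otimes> a \<otimes> a = \<zero>"
proof -
  note D = left_idealD[OF L(1)]
  obtain x where x: "x \<in> L" "x \<noteq> \<zero>" using L D(2) by blast
  have "\<exists>r\<in>carrier R. x \<otimes> r \<otimes> x \<noteq> \<zero>"
    using prime x D(1)[OF x(1)] unfolding nc_prime_ideal_def by blast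
  then obtain r where r: "r \<in> carrier R" "x \<otimes> (r \<otimes> x) \<noteq> \<zero>" using D(1)[OF x(1)] by (auto simp: m_assoc)
  define b where "b = r \<otimes> x"
  have b: "b \<in> L" "x \<otimes> b \<noteq> \<zero>" using D(4)[OF r(1) x(1)] r(2) by (simp_all add: b_def)
  note bc = D(1)[OF b(1)]
  let ?Q = "\<lambda>n::nat. \<forall>z\<in>L. z \<otimes> b [^] n = \<zero>"
  obtain n0 :: nat where "b [^] n0 = \<zero>" using nil[OF b(1)] unfolding nilp_def by blast
  then have "?Q n0" using D(1) by simp
  define n where "n = (LEAST n. ?Q n)"
  have n: "?Q n" unfolding n_def using \<open>?Q n0\<close> by (rule LeastI)
  have "n \<noteq> 0" using n x D(1)[OF x(1)] by (metis nat_pow_0 r_one)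
  moreover have "n \<noteq> 1" using n b x(1) bc by auto
  ultimately obtain m where m: "n = Suc (Suc m)" by (metis One_nat_def not0_implies_Suc)
  have "\<not> ?Q (Suc m)" using not_less_Least[of "Suc m" ?Q] m unfolding n_def by simp
  moreover have "b [^] Suc m \<in> L" using D(4)[OF _ b(1), of "b [^] m"] bc by simp
  \<comment> \<open>With \<open>n = m + 2\<close>, the product of the two factors
    \<open>b [^] Suc m\<close> is \<open>b [^] n\<close> times \<open>b [^] m\<close>, and
    \<open>L\<close> is killed by the first.\<close>
  moreover have "z \<otimes> b [^] Suc m \<otimes> b [^] Suc m = \<zero>" if "z \<in> L" for z
  proof -
    have "z \<otimes> b [^] Suc m \<otimes> b [^] Suc m = z \<otimes> (b [^] n \<otimes> b [^] m)"
      using bc D(1)[OF that] by (simp only: m_assoc nat_pow_closed nat_pow_mult) (simp add: m)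
    also have "\<dots> = (z \<otimes> b [^] n) \<otimes> b [^] m"
      using bc D(1)[OF that] by (simp add: m_assoc)
    also have "\<dots> = \<zero>" using n that bc by simp
    finally show ?thesis .
  qed
  ultimately show thesis using that[of "b [^] Suc m"] by blast
qed

text \<open>Put \<open>a\<close> for the variable \<open>k\<close> and elements of
  \<open>L a\<close> for the others. If some variable immediately precedes \<open>k\<close> in a
  word, its value \<open>r a\<close> meets the substituted \<open>a\<close>; everything to the left
  of these two factors \<open>a\<close>, ending in \<open>r\<close>, lies in \<open>L\<close>, so
  the word is killed. Only words starting with \<open>k\<close> remain, and their \<open>a\<close>
  joins \<open>z\<close>.\<close>

lemma tail_poly_step:
  assumes L: "left_ideal L" and van: "\<And>z x. z \<in> L \<Longrightarrow> x \<in> UNIV \<rightarrow> L \<Longrightarrow> z \<otimes> tail_poly N c k x = \<zero>"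
    and k: "k < N" and a: "a \<in> L" "\<And>z. z \<in> L \<Longrightarrow> z \<otimes> a \<otimes> a = \<zero>"
    and z: "z \<in> L" and x: "x \<in> UNIV \<rightarrow> (\<lambda>z. z \<otimes> a) ` L"
  shows "z \<otimes> a \<otimes> tail_poly N c (Suc k) x = \<zero>"
proof -
  note D = left_idealD[OF L]
  note ac = D(1)[OF a(1)]
  define y where "y = x(k := a)"
  have xL: "x i \<in> L" for i using x D(4) a(1) D(1) by (auto simp: Pi_iff image_iff) (metis (no_types, lifting))
  have y: "y \<in> UNIV \<rightarrow> L" using xL a by (auto simp: y_def)
  have yc: "y \<in> UNIV \<rightarrow> carrier R" and xc: "x \<in> UNIV \<rightarrow> carrier R" using y xL D(1) by auto
  have wy: "word_prod R y w \<in> carrier R" and wx: "word_prod R x w \<in> carrier R" for w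
    using yc xc by (auto simp: Pi_iff)
  have zc: "z \<in> carrier R" using D(1) z by blast
  let ?t = "\<lambda>w. add_pow R (c ([0..<k] @ w)) (z \<otimes> word_prod R y w)"
  have tc: "?t w \<in> carrier R" for w using wy zc by simp
  let ?A = "(#) k ` permutations_of_set {Suc k..<N}"
  have sub: "?A \<subseteq> permutations_of_set {k..<N}" using k by (auto simp: permutations_of_set_def)
  have zero: "?t w = \<zero>" if w: "w \<in> permutations_of_set {k..<N} - ?A" for w
  proof -
    have wd: "set w = {k..<N}" "distinct w" using w by (auto dest: permutations_of_setD)
    then obtain u v where uv: "w = u @ k # v" using k by (metis atLeastLessThan_iff order_refl split_list)
    have "u \<noteq> []"
    proof
      assume "u = []"
      then have e: "w = k # v" using uv by simp
      have "distinct (k # v)" "insert k (set v) = {k..<N}" using wd unfolding e by simp_all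
      then have "set v = {k..<N} - {k}" "distinct v" by (simp_all add: insert_ident[symmetric] flip: \<open>insert k (set v) = {k..<N}\<close>)
      moreover have "{k..<N} - {k} = {Suc k..<N}" by auto
      ultimately have "v \<in> permutations_of_set {Suc k..<N}" "w = k # v"
        using e by (simp_all add: permutations_of_set_def)
      then show False using w by blast
    qed
    then obtain u' j where u: "u = u' @ [j]" by (metis rev_exhaust)
    have j: "j \<noteq> k" using wd uv u by auto
    obtain r where r: "r \<in> L" "x j = r \<otimes> a" using x by (auto simp: Pi_iff image_iff)
    have rc: "r \<in> carrier R" using r D(1) by blast
    have yj: "y j = r \<otimes> a" and yk: "y k = a" using j r by (simp_all add: y_def)
    have "z \<otimes> word_prod R y w = (z \<otimes> word_prod R y u' \<otimes> r) \<otimes> a \<otimes> a \<otimes> word_prod R y v"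
      using wy zc rc ac yj yk by (simp add: uv u word_prod_append[OF yc] m_assoc)
    also have "z \<otimes> word_prod R y u' \<otimes> r \<in> L" using D(4)[OF _ r(1)] wy zc by simp
    then have "(z \<otimes> word_prod R y u' \<otimes> r) \<otimes> a \<otimes> a \<otimes> word_prod R y v = \<zero>" using a wy by simp
    finally show ?thesis by simp
  qed
  have "\<zero> = z \<otimes> tail_poly N c k y" using van[OF z y] by simp
  also have "\<dots> = finsum R ?t (permutations_of_set {k..<N})"
    unfolding tail_poly_def using wy zc by (simp add: finsum_rdistr add_pow_rdistr_int)
  also have "\<dots> = finsum R ?t ?A"
    by (rule add.finprod_mono_neutral_cong_right) (use sub zero tc in auto)
  also have "\<dots> = (\<Oplus>w\<in>permutations_of_set {Suc k..<N}. ?t (k # w))"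
    by (rule finsum_reindex) (use tc in auto)
  also have "\<dots> = (\<Oplus>w\<in>permutations_of_set {Suc k..<N}. z \<otimes> a \<otimes> add_pow R (c ([0..<Suc k] @ w)) (word_prod R x w))"
  proof (rule finsum_cong')
    fix w assume w: "w \<in> permutations_of_set {Suc k..<N}"
    have "word_prod R y w = word_prod R x w"
      using permutations_of_setD(1)[OF w] by (intro word_prod_cong) (simp add: y_def)
    then show "?t (k # w) = z \<otimes> a \<otimes> add_pow R (c ([0..<Suc k] @ w)) (word_prod R x w)"
      using wx zc ac by (simp add: y_def add_pow_rdistr_int m_assoc)
  qed (use wx zc ac in auto)
  also have "\<dots> = z \<otimes> a \<otimes> tail_poly N c (Suc k) x"
    unfolding tail_poly_def using wx zc ac by (simp add: finsum_rdistr)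
  finally show ?thesis by simp
qed

text \<open>Replacing \<open>L\<close> by \<open>L a\<close> strips one leading variable from the
  identity while \<open>L\<close> stays nonzero and nil. After \<open>N\<close> steps the remaining
  polynomial is the coefficient 1, which would annihilate a nonzero left ideal.\<close>

theorem nil_left_ideal_trivial:
  assumes prime: "nc_prime_ideal {\<zero>} R" and id: "ml_identity R N c"
    and L: "left_ideal L" and nil: "\<And>x. x \<in> L \<Longrightarrow> nilp x"
  shows "L = {\<zero>}"
proof (rule ccontr)
  assume "L \<noteq> {\<zero>}"
  have "\<exists>L. left_ideal L \<and> L \<noteq> {\<zero>} \<and> (\<forall>x\<in>L. nilp x) \<and> (\<forall>z\<in>L. \<forall>x\<in>UNIV \<rightarrow> L. z \<otimes> tail_poly N c k x = \<zero>)"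
    if "k \<le> N" for k
    using that
  proof (induction k)
    case 0
    have "z \<otimes> tail_poly N c 0 x = \<zero>" if "z \<in> L" "x \<in> UNIV \<rightarrow> L" for z x
    proof -
      have "x \<in> UNIV \<rightarrow> carrier R" using that left_idealD(1)[OF L] by auto
      then have "tail_poly N c 0 x = \<zero>"
        using id by (simp add: tail_poly_def ml_identity_def mlpoly_def atLeast0LessThan)
      then show ?thesis using that left_idealD(1)[OF L] by simp
    qed
    then show ?case using L nil \<open>L \<noteq> {\<zero>}\<close> by blast
  next
    case (Suc k)
    then obtain L where L: "left_ideal L" "L \<noteq> {\<zero>}" and nil: "\<And>x. x \<in> L \<Longrightarrow> nilp x"
      and van: "\<And>z x. z \<in> L \<Longrightarrow> x \<in> UNIV \<rightarrow> L \<Longrightarrow> z \<otimes> tail_poly N c k x = \<zero>"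
      by (metis Suc_leD)
    obtain a where a: "a \<in> L" "\<exists>z\<in>L. z \<otimes> a \<noteq> \<zero>" "\<And>z. z \<in> L \<Longrightarrow> z \<otimes> a \<otimes> a = \<zero>"
      using square_zero_multiplier[OF prime L nil] by blast
    let ?L = "(\<lambda>z. z \<otimes> a) ` L"
    have "?L \<subseteq> L" using a(1) left_idealD(1,4)[OF L(1)] by blast
    moreover have "left_ideal ?L" using left_ideal_rmult L(1) left_idealD(1)[OF L(1) a(1)] by blast
    moreover have "?L \<noteq> {\<zero>}" using a(2) by blast
    moreover have "\<forall>z\<in>?L. \<forall>x\<in>UNIV \<rightarrow> ?L. z \<otimes> tail_poly N c (Suc k) x = \<zero>"
      using tail_poly_step[OF L(1) van _ a(1,3)] Suc.prems by auto
    ultimately show ?case using nil by blast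
  qed
  then obtain L where L: "left_ideal L" "L \<noteq> {\<zero>}" and van: "\<forall>z\<in>L. \<forall>x\<in>UNIV \<rightarrow> L. z \<otimes> tail_poly N c N x = \<zero>"
    by blast
  have "tail_poly N c N (\<lambda>_. \<zero>) = \<one>" using id by (simp add: tail_poly_def ml_identity_def)
  then have "z = \<zero>" if "z \<in> L" for z
    using van that left_idealD(1)[OF L(1)] left_idealD(2)[OF L(1)] by (metis (no_types, lifting) Pi_I r_one)
  then show False using L left_idealD(2) by blast
qed

end

subsection \<open>Matrix rings\<close>

context cring
begin

lemma mat_entry: "A \<in> carrier (matrix_ring R n) \<Longrightarrow> i < n \<Longrightarrow> j < n \<Longrightarrow> A (i, j) \<in> carrier R"
  by (auto simp: matrix_ring_def)

lemma mat_eqI: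
  assumes "A \<in> carrier (matrix_ring R n)" "B \<in> carrier (matrix_ring R n)"
    and "\<And>i j. i < n \<Longrightarrow> j < n \<Longrightarrow> A (i, j) = B (i, j)"
  shows "A = B"
  by (rule PiE_ext[of A "{..<n} \<times> {..<n}" "\<lambda>_. carrier R" B])
    (use assms in \<open>auto simp: matrix_ring_def\<close>)

lemma mat_ops:
  assumes "i < n" "j < n"
  shows "(A \<oplus>\<^bsub>matrix_ring R n\<^esub> B) (i, j) = A (i, j) \<oplus> B (i, j)"
    "(A \<otimes>\<^bsub>matrix_ring R n\<^esub> B) (i, j) = (\<Oplus>k\<in>{..<n}. A (i, k) \<otimes> B (k, j))"
    "\<zero>\<^bsub>matrix_ring R n\<^esub> (i, j) = \<zero>"
    "\<one>\<^bsub>matrix_ring R n\<^esub> (i, j) = (if i = j then \<one> else \<zero>)"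
  using assms by (simp_all add: matrix_ring_def)

lemma mat_closed:
  "A \<in> carrier (matrix_ring R n) \<Longrightarrow> B \<in> carrier (matrix_ring R n) \<Longrightarrow> A \<oplus>\<^bsub>matrix_ring R n\<^esub> B \<in> carrier (matrix_ring R n)"
  "A \<in> carrier (matrix_ring R n) \<Longrightarrow> B \<in> carrier (matrix_ring R n) \<Longrightarrow> A \<otimes>\<^bsub>matrix_ring R n\<^esub> B \<in> carrier (matrix_ring R n)"
  "\<zero>\<^bsub>matrix_ring R n\<^esub> \<in> carrier (matrix_ring R n)"
  "\<one>\<^bsub>matrix_ring R n\<^esub> \<in> carrier (matrix_ring R n)"
  by (auto simp: matrix_ring_def intro!: finsum_closed)

lemma matI: "(\<And>i j. i < n \<Longrightarrow> j < n \<Longrightarrow> f i j \<in> carrier R) \<Longrightarrow>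
    (\<lambda>(i, j)\<in>{..<n} \<times> {..<n}. f i j) \<in> carrier (matrix_ring R n)"
  by (auto simp: matrix_ring_def)

lemma matrix_ring_ring: "ring (matrix_ring R n)"
proof (rule ringI)
  let ?M = "matrix_ring R n"
  show "abelian_group ?M"
  proof (rule abelian_groupI)
    fix A assume A: "A \<in> carrier ?M"
    have "(\<lambda>(i, j)\<in>{..<n} \<times> {..<n}. \<ominus> A (i, j)) \<in> carrier ?M" (is "?B \<in> _")
      using mat_entry[OF A] by (intro matI) auto
    moreover have "?B \<oplus>\<^bsub>?M\<^esub> A = \<zero>\<^bsub>?M\<^esub>"
      by (rule mat_eqI[OF mat_closed(1)[OF calculation A] mat_closed(3)])
        (use mat_entry[OF A] in \<open>auto simp: mat_ops l_neg\<close>)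
    ultimately show "\<exists>B\<in>carrier ?M. B \<oplus>\<^bsub>?M\<^esub> A = \<zero>\<^bsub>?M\<^esub>" by blast
  qed (auto intro!: mat_eqI mat_closed simp: mat_ops mat_entry a_ac)
  show "monoid ?M"
  proof (rule monoidI)
    fix A B C assume ABC: "A \<in> carrier ?M" "B \<in> carrier ?M" "C \<in> carrier ?M"
    note e = mat_entry[OF ABC(1)] mat_entry[OF ABC(2)] mat_entry[OF ABC(3)]
    show "A \<otimes>\<^bsub>?M\<^esub> B \<otimes>\<^bsub>?M\<^esub> C = A \<otimes>\<^bsub>?M\<^esub> (B \<otimes>\<^bsub>?M\<^esub> C)"
    proof (rule mat_eqI)
      fix i j assume ij: "i < n" "j < n"
      have "(A \<otimes>\<^bsub>?M\<^esub> B \<otimes>\<^bsub>?M\<^esub> C) (i, j) = (\<Oplus>k\<in>{..<n}. (\<Oplus>l\<in>{..<n}. A (i, l) \<otimes> B (l, k)) \<otimes> C (k, j))"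
        using ij e by (simp add: mat_ops(2)) (rule finsum_cong', auto simp: mat_ops(2) intro!: finsum_closed)
      also have "\<dots> = (\<Oplus>k\<in>{..<n}. \<Oplus>l\<in>{..<n}. A (i, l) \<otimes> (B (l, k) \<otimes> C (k, j)))"
        by (rule finsum_cong') (use ij e in \<open>auto simp: finsum_ldistr m_assoc intro!: finsum_closed finsum_cong'\<close>)
      also have "\<dots> = (\<Oplus>l\<in>{..<n}. \<Oplus>k\<in>{..<n}. A (i, l) \<otimes> (B (l, k) \<otimes> C (k, j)))"
        by (rule finsum_swap) (use ij e in auto)
      also have "\<dots> = (\<Oplus>l\<in>{..<n}. A (i, l) \<otimes> (\<Oplus>k\<in>{..<n}. B (l, k) \<otimes> C (k, j)))"
        by (rule finsum_cong') (use ij e in \<open>auto simp: finsum_rdistr intro!: finsum_closed\<close>)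
      also have "\<dots> = (A \<otimes>\<^bsub>?M\<^esub> (B \<otimes>\<^bsub>?M\<^esub> C)) (i, j)"
        using ij e by (simp add: mat_ops(2)) (rule finsum_cong', auto simp: mat_ops(2) intro!: finsum_closed)
      finally show "(A \<otimes>\<^bsub>?M\<^esub> B \<otimes>\<^bsub>?M\<^esub> C) (i, j) = (A \<otimes>\<^bsub>?M\<^esub> (B \<otimes>\<^bsub>?M\<^esub> C)) (i, j)" .
    qed (use ABC in \<open>auto intro!: mat_closed\<close>)
  next
    fix A assume A: "A \<in> carrier ?M"
    note e = mat_entry[OF A]
    show "\<one>\<^bsub>?M\<^esub> \<otimes>\<^bsub>?M\<^esub> A = A"
    proof (rule mat_eqI)
      fix i j assume ij: "i < n" "j < n"
      have "(\<one>\<^bsub>?M\<^esub> \<otimes>\<^bsub>?M\<^esub> A) (i, j) = \<one>\<^bsub>?M\<^esub> (i, i) \<otimes> A (i, j)"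
        unfolding mat_ops(2)[OF ij]
        by (rule finsum_eq_single) (use ij e in \<open>auto simp: mat_ops(4)\<close>)
      then show "(\<one>\<^bsub>?M\<^esub> \<otimes>\<^bsub>?M\<^esub> A) (i, j) = A (i, j)" using ij e by (simp add: mat_ops(4))
    qed (use A in \<open>auto intro!: mat_closed\<close>)
    show "A \<otimes>\<^bsub>?M\<^esub> \<one>\<^bsub>?M\<^esub> = A"
    proof (rule mat_eqI)
      fix i j assume ij: "i < n" "j < n"
      have "(A \<otimes>\<^bsub>?M\<^esub> \<one>\<^bsub>?M\<^esub>) (i, j) = A (i, j) \<otimes> \<one>\<^bsub>?M\<^esub> (j, j)"
        unfolding mat_ops(2)[OF ij]
        by (rule finsum_eq_single) (use ij e in \<open>auto simp: mat_ops(4)\<close>)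
      then show "(A \<otimes>\<^bsub>?M\<^esub> \<one>\<^bsub>?M\<^esub>) (i, j) = A (i, j)" using ij e by (simp add: mat_ops(4))
    qed (use A in \<open>auto intro!: mat_closed\<close>)
  qed (auto intro: mat_closed)
  fix A B C assume ABC: "A \<in> carrier ?M" "B \<in> carrier ?M" "C \<in> carrier ?M"
  note e = mat_entry[OF ABC(1)] mat_entry[OF ABC(2)] mat_entry[OF ABC(3)]
  show "(A \<oplus>\<^bsub>?M\<^esub> B) \<otimes>\<^bsub>?M\<^esub> C = A \<otimes>\<^bsub>?M\<^esub> C \<oplus>\<^bsub>?M\<^esub> B \<otimes>\<^bsub>?M\<^esub> C"
  proof (rule mat_eqI)
    fix i j assume ij: "i < n" "j < n"
    have "((A \<oplus>\<^bsub>?M\<^esub> B) \<otimes>\<^bsub>?M\<^esub> C) (i, j) = (\<Oplus>k\<in>{..<n}. A (i, k) \<otimes> C (k, j) \<oplus> B (i, k) \<otimes> C (k, j))"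
      unfolding mat_ops(2)[OF ij] by (rule finsum_cong') (use ij e in \<open>auto simp: mat_ops(1) l_distr\<close>)
    also have "\<dots> = (A \<otimes>\<^bsub>?M\<^esub> C \<oplus>\<^bsub>?M\<^esub> B \<otimes>\<^bsub>?M\<^esub> C) (i, j)"
      using ij e by (simp add: mat_ops finsum_addf)
    finally show "((A \<oplus>\<^bsub>?M\<^esub> B) \<otimes>\<^bsub>?M\<^esub> C) (i, j) = (A \<otimes>\<^bsub>?M\<^esub> C \<oplus>\<^bsub>?M\<^esub> B \<otimes>\<^bsub>?M\<^esub> C) (i, j)" .
  qed (use ABC in \<open>auto intro!: mat_closed\<close>)
  show "C \<otimes>\<^bsub>?M\<^esub> (A \<oplus>\<^bsub>?M\<^esub> B) = C \<otimes>\<^bsub>?M\<^esub> A \<oplus>\<^bsub>?M\<^esub> C \<otimes>\<^bsub>?M\<^esub> B"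
  proof (rule mat_eqI)
    fix i j assume ij: "i < n" "j < n"
    have "(C \<otimes>\<^bsub>?M\<^esub> (A \<oplus>\<^bsub>?M\<^esub> B)) (i, j) = (\<Oplus>k\<in>{..<n}. C (i, k) \<otimes> A (k, j) \<oplus> C (i, k) \<otimes> B (k, j))"
      unfolding mat_ops(2)[OF ij] by (rule finsum_cong') (use ij e in \<open>auto simp: mat_ops(1) r_distr\<close>)
    also have "\<dots> = (C \<otimes>\<^bsub>?M\<^esub> A \<oplus>\<^bsub>?M\<^esub> C \<otimes>\<^bsub>?M\<^esub> B) (i, j)"
      using ij e by (simp add: mat_ops finsum_addf)
    finally show "(C \<otimes>\<^bsub>?M\<^esub> (A \<oplus>\<^bsub>?M\<^esub> B)) (i, j) = (C \<otimes>\<^bsub>?M\<^esub> A \<oplus>\<^bsub>?M\<^esub> C \<otimes>\<^bsub>?M\<^esub> B) (i, j)" .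
  qed (use ABC in \<open>auto intro!: mat_closed\<close>)
qed

section \<open>Matrix units and central scalar matrices\<close>

definition mat_unit :: "nat \<Rightarrow> nat \<times> nat \<Rightarrow> nat \<times> nat \<Rightarrow> 'a" where
  "mat_unit n p = (\<lambda>(i, j)\<in>{..<n} \<times> {..<n}. if (i, j) = p then \<one> else \<zero>)"

text \<open>\<open>central_span\<close> takes its coefficients inside the ring, so elements of the
  base ring have to appear as scalar matrices.\<close>

definition mat_scalar :: "nat \<Rightarrow> 'a \<Rightarrow> nat \<times> nat \<Rightarrow> 'a" where
  "mat_scalar n c = (\<lambda>(i, j)\<in>{..<n} \<times> {..<n}. if i = j then c else \<zero>)"

lemma mat_scalar_mult:
  assumes c: "c \<in> carrier R" and A: "A \<in> carrier (matrix_ring R n)" and ij: "i < n" "j < n"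
  shows "(mat_scalar n c \<otimes>\<^bsub>matrix_ring R n\<^esub> A) (i, j) = c \<otimes> A (i, j)"
    "(A \<otimes>\<^bsub>matrix_ring R n\<^esub> mat_scalar n c) (i, j) = c \<otimes> A (i, j)"
proof -
  note e = mat_entry[OF A]
  have "(mat_scalar n c \<otimes>\<^bsub>matrix_ring R n\<^esub> A) (i, j) = mat_scalar n c (i, i) \<otimes> A (i, j)"
    unfolding mat_ops(2)[OF ij]
    by (rule finsum_eq_single) (use ij e c in \<open>auto simp: mat_scalar_def\<close>)
  then show "(mat_scalar n c \<otimes>\<^bsub>matrix_ring R n\<^esub> A) (i, j) = c \<otimes> A (i, j)"
    using ij by (simp add: mat_scalar_def)
  have "(A \<otimes>\<^bsub>matrix_ring R n\<^esub> mat_scalar n c) (i, j) = A (i, j) \<otimes> mat_scalar n c (j, j)"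
    unfolding mat_ops(2)[OF ij]
    by (rule finsum_eq_single) (use ij e c in \<open>auto simp: mat_scalar_def\<close>)
  then show "(A \<otimes>\<^bsub>matrix_ring R n\<^esub> mat_scalar n c) (i, j) = c \<otimes> A (i, j)"
    using ij e c by (simp add: mat_scalar_def m_comm)
qed

lemma mat_scalar_center: "c \<in> carrier R \<Longrightarrow> mat_scalar n c \<in> ring_center (matrix_ring R n)"
proof -
  assume c: "c \<in> carrier R"
  have s: "mat_scalar n c \<in> carrier (matrix_ring R n)" unfolding mat_scalar_def using c by (intro matI) auto
  then show ?thesis
    using c by (auto simp: ring_center_def mat_scalar_mult intro!: mat_eqI mat_closed)
qed

lemma mat_unit_closed: "mat_unit n p \<in> carrier (matrix_ring R n)"
  unfolding mat_unit_def by (intro matI) auto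

lemma matrix_in_span_of_units:
  assumes A: "A \<in> carrier (matrix_ring R n)"
  shows "A \<in> central_span (matrix_ring R n) (mat_unit n ` ({..<n} \<times> {..<n}))"
proof -
  let ?M = "matrix_ring R n" and ?I = "{..<n} \<times> {..<n}"
  interpret M: ring ?M by (rule matrix_ring_ring)
  let ?f = "\<lambda>p. mat_scalar n (A p) \<otimes>\<^bsub>?M\<^esub> mat_unit n p"
  have Ap: "A p \<in> carrier R" if "p \<in> ?I" for p using that mat_entry[OF A] by auto
  have f: "?f p \<in> carrier ?M" if "p \<in> ?I" for p
    using mat_scalar_center[OF Ap[OF that]] mat_unit_closed by (auto simp: ring_center_def intro!: mat_closed)
  have "A = finsum ?M ?f ?I"
  proof (rule mat_eqI[OF A])
    show "finsum ?M ?f ?I \<in> carrier ?M" using f by (intro M.finsum_closed) auto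
    fix i j assume ij: "i < n" "j < n"
    have "finsum ?M ?f ?I (i, j) = (\<Oplus>p\<in>?I. ?f p (i, j))"
      by (rule finsum_additive[where h = "\<lambda>A. A (i, j)"])
        (use ij f M.abelian_monoid_axioms abelian_monoid_axioms in \<open>auto simp: mat_ops mat_entry\<close>)
    also have "\<dots> = ?f (i, j) (i, j)"
      by (rule finsum_eq_single)
        (use ij f Ap in \<open>auto simp: mat_entry mat_scalar_mult mat_unit_closed, auto simp: mat_unit_def split: if_splits\<close>)
    also have "\<dots> = A (i, j)"
      using ij Ap by (simp add: mat_scalar_mult mat_unit_closed) (simp add: mat_unit_def)
    finally show "A (i, j) = finsum ?M ?f ?I (i, j)" by simp
  qed
  also have "\<dots> \<in> central_span ?M (mat_unit n ` ?I)"
    using mat_scalar_center[OF Ap] mat_unit_closed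
    by (intro M.central_span_finsum central_span.scale) auto
  finally show ?thesis .
qed

text \<open>Among more than \<open>n\<^sup>2\<close> matrix units two coincide, and the Capelli polynomial is alternating.\<close>

lemma capelli_matrix_ring:
  assumes m: "n * n < m"
    and as: "set as \<subseteq> carrier (matrix_ring R n)" "set xys \<subseteq> carrier (matrix_ring R n) \<times> carrier (matrix_ring R n)"
      "length as = m" "length xys = m"
  shows "capelli (matrix_ring R n) as xys = \<zero>\<^bsub>matrix_ring R n\<^esub>"
proof -
  let ?M = "matrix_ring R n" and ?G = "mat_unit n ` ({..<n} \<times> {..<n})"
  interpret M: ring ?M by (rule matrix_ring_ring)
  have G: "?G \<subseteq> carrier ?M" using mat_unit_closed by auto
  show ?thesis
  proof (rule M.capelli_vanishes_on_span[OF G])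
    fix bs zs assume b: "set bs \<subseteq> ?G" "set zs \<subseteq> ?G \<times> ?G" "length bs = m" "length zs = m"
    have "card (set bs) \<le> card ?G" by (rule card_mono) (use b in auto)
    also have "\<dots> \<le> n * n" using card_image_le[of "{..<n} \<times> {..<n}" "mat_unit n"] by simp
    finally have "\<not> distinct bs" using m b(3) distinct_card by force
    then show "capelli ?M bs zs = \<zero>\<^bsub>?M\<^esub>"
      using b G by (intro M.capelli_not_distinct) auto
  qed (use as matrix_in_span_of_units in auto)
qed

end

subsection \<open>Density\<close>

text \<open>Endomorphisms are restricted to the carrier so that equality of functions is equality of
  endomorphisms.\<close>

definition end_ring :: "('v, 'k) ring_scheme \<Rightarrow> ('v \<Rightarrow> 'v) ring" where
  "end_ring V =
     \<lparr>carrier = {f \<in> carrier V \<rightarrow>\<^sub>E carrier V. \<forall>u\<in>carrier V. \<forall>v\<in>carrier V. f (u \<oplus>\<^bsub>V\<^esub> v) = f u \<oplus>\<^bsub>V\<^esub> f v},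
      monoid.mult = (\<lambda>f g. \<lambda>v\<in>carrier V. f (g v)),
      monoid.one = (\<lambda>v\<in>carrier V. v),
      ring.zero = (\<lambda>v\<in>carrier V. \<zero>\<^bsub>V\<^esub>),
      ring.add = (\<lambda>f g. \<lambda>v\<in>carrier V. f v \<oplus>\<^bsub>V\<^esub> g v)\<rparr>"

context abelian_group
begin

lemma end_closed: "f \<in> carrier (end_ring G) \<Longrightarrow> v \<in> carrier G \<Longrightarrow> f v \<in> carrier G"
  by (auto simp: end_ring_def)

lemma end_add: "f \<in> carrier (end_ring G) \<Longrightarrow> u \<in> carrier G \<Longrightarrow> v \<in> carrier G \<Longrightarrow> f (u \<oplus> v) = f u \<oplus> f v"
  by (auto simp: end_ring_def)

lemma end_zero: "f \<in> carrier (end_ring G) \<Longrightarrow> f \<zero> = \<zero>"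
  using end_add[of f \<zero> \<zero>] end_closed[of f \<zero>] by (simp add: add.r_cancel_one')

lemma end_uminus: "f \<in> carrier (end_ring G) \<Longrightarrow> v \<in> carrier G \<Longrightarrow> f (\<ominus> v) = \<ominus> f v"
  using end_add[of f "\<ominus> v" v] end_zero[of f] end_closed[of f] by (intro minus_equality[symmetric]) (auto simp: l_neg)

lemma end_eqI:
  "f \<in> carrier (end_ring G) \<Longrightarrow> g \<in> carrier (end_ring G) \<Longrightarrow> (\<And>v. v \<in> carrier G \<Longrightarrow> f v = g v) \<Longrightarrow> f = g"
  by (rule PiE_ext[of f "carrier G" "\<lambda>_. carrier G" g]) (auto simp: end_ring_def)

lemma end_ops:
  assumes "v \<in> carrier G"
  shows "(f \<otimes>\<^bsub>end_ring G\<^esub> g) v = f (g v)" "(f \<oplus>\<^bsub>end_ring G\<^esub> g) v = f v \<oplus> g v"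
    "\<one>\<^bsub>end_ring G\<^esub> v = v" "\<zero>\<^bsub>end_ring G\<^esub> v = \<zero>"
  using assms by (simp_all add: end_ring_def)

lemma endI:
  "(\<And>v. v \<in> carrier G \<Longrightarrow> f v \<in> carrier G) \<Longrightarrow>
   (\<And>u v. u \<in> carrier G \<Longrightarrow> v \<in> carrier G \<Longrightarrow> f (u \<oplus> v) = f u \<oplus> f v) \<Longrightarrow>
   (\<lambda>v\<in>carrier G. f v) \<in> carrier (end_ring G)"
  by (auto simp: end_ring_def)

lemma end_ops_closed:
  "f \<in> carrier (end_ring G) \<Longrightarrow> g \<in> carrier (end_ring G) \<Longrightarrow> f \<otimes>\<^bsub>end_ring G\<^esub> g \<in> carrier (end_ring G)"
  "f \<in> carrier (end_ring G) \<Longrightarrow> g \<in> carrier (end_ring G) \<Longrightarrow> f \<oplus>\<^bsub>end_ring G\<^esub> g \<in> carrier (end_ring G)"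
  "\<one>\<^bsub>end_ring G\<^esub> \<in> carrier (end_ring G)" "\<zero>\<^bsub>end_ring G\<^esub> \<in> carrier (end_ring G)"
  by (auto simp: end_ring_def a_ac PiE_iff extensional_def)

lemma end_ring_ring: "ring (end_ring G)"
proof (rule ringI)
  let ?E = "end_ring G"
  show "abelian_group ?E"
  proof (rule abelian_groupI)
    fix f assume f: "f \<in> carrier ?E"
    let ?g = "\<lambda>v\<in>carrier G. \<ominus> f v"
    have "?g \<in> carrier ?E" by (rule endI) (use f in \<open>auto simp: end_closed end_add minus_add\<close>)
    moreover have "?g \<oplus>\<^bsub>?E\<^esub> f = \<zero>\<^bsub>?E\<^esub>"
      by (rule end_eqI[OF end_ops_closed(2)[OF calculation f] end_ops_closed(4)])
        (use f in \<open>auto simp: end_ops end_closed l_neg\<close>)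
    ultimately show "\<exists>g\<in>carrier ?E. g \<oplus>\<^bsub>?E\<^esub> f = \<zero>\<^bsub>?E\<^esub>" by blast
  qed (auto intro!: end_eqI end_ops_closed simp: end_ops end_closed a_ac)
  show "monoid ?E"
    by (rule monoidI) (auto intro!: end_eqI end_ops_closed simp: end_ops end_closed)
qed (auto intro!: end_eqI end_ops_closed simp: end_ops end_closed end_add)

end

locale irreducible_action = B: ring B + V: abelian_group V
  for B :: "('b, 'm) ring_scheme" and V :: "('v, 'k) ring_scheme" +
  fixes act :: "'b \<Rightarrow> 'v \<Rightarrow> 'v"
  assumes act_closed: "b \<in> carrier B \<Longrightarrow> v \<in> carrier V \<Longrightarrow> act b v \<in> carrier V"
    and act_add: "b \<in> carrier B \<Longrightarrow> u \<in> carrier V \<Longrightarrow> v \<in> carrier V \<Longrightarrow> act b (u \<oplus>\<^bsub>V\<^esub> v) = act b u \<oplus>\<^bsub>V\<^esub> act b v"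
    and add_act: "a \<in> carrier B \<Longrightarrow> b \<in> carrier B \<Longrightarrow> v \<in> carrier V \<Longrightarrow> act (a \<oplus>\<^bsub>B\<^esub> b) v = act a v \<oplus>\<^bsub>V\<^esub> act b v"
    and mult_act: "a \<in> carrier B \<Longrightarrow> b \<in> carrier B \<Longrightarrow> v \<in> carrier V \<Longrightarrow> act (a \<otimes>\<^bsub>B\<^esub> b) v = act a (act b v)"
    and one_act: "v \<in> carrier V \<Longrightarrow> act \<one>\<^bsub>B\<^esub> v = v"
    and irreducible: "u \<in> carrier V \<Longrightarrow> v \<in> carrier V \<Longrightarrow> v \<noteq> \<zero>\<^bsub>V\<^esub> \<Longrightarrow> \<exists>b\<in>carrier B. act b v = u"
    and nontrivial: "carrier V \<noteq> {\<zero>\<^bsub>V\<^esub>}"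
begin

abbreviation "End \<equiv> end_ring V"

sublocale E: ring End by (rule V.end_ring_ring)

definition rep :: "'b \<Rightarrow> 'v \<Rightarrow> 'v" where "rep b = (\<lambda>v\<in>carrier V. act b v)"

lemma rep_apply [simp]: "v \<in> carrier V \<Longrightarrow> rep b v = act b v"
  by (simp add: rep_def)

lemma rep_hom: "rep \<in> ring_hom B End"
proof (rule ring_hom_memI)
  show c: "rep b \<in> carrier End" if "b \<in> carrier B" for b
    unfolding rep_def by (rule V.endI) (use that in \<open>auto simp: act_closed act_add\<close>)
  show "rep (a \<otimes>\<^bsub>B\<^esub> b) = rep a \<otimes>\<^bsub>End\<^esub> rep b" if "a \<in> carrier B" "b \<in> carrier B" for a b
    by (rule V.end_eqI) (use that c in \<open>auto simp: V.end_ops mult_act act_closed\<close>)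
  show "rep (a \<oplus>\<^bsub>B\<^esub> b) = rep a \<oplus>\<^bsub>End\<^esub> rep b" if "a \<in> carrier B" "b \<in> carrier B" for a b
    by (rule V.end_eqI) (use that c in \<open>auto simp: V.end_ops add_act act_closed\<close>)
  show "rep \<one>\<^bsub>B\<^esub> = \<one>\<^bsub>End\<^esub>"
    by (rule V.end_eqI) (use c in \<open>auto simp: V.end_ops one_act\<close>)
qed

lemma rep_closed: "b \<in> carrier B \<Longrightarrow> rep b \<in> carrier End"
  using ring_hom_closed[OF rep_hom] .

section \<open>The centralizer of a simple module and its maximal commutative subsets\<close>

definition Comm :: "('v \<Rightarrow> 'v) set" where
  "Comm = {\<theta> \<in> carrier End. \<forall>b\<in>carrier B. \<forall>v\<in>carrier V. \<theta> (act b v) = act b (\<theta> v)}"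

text \<open>By Schur's lemma the centralizer is a division ring, and \<open>K\<close> is a maximal
  subfield of it. The proof works directly with commutativity and with maximality in the form that
  \<open>K\<close> contains every endomorphism commuting with the action and with
  \<open>K\<close>.\<close>

definition max_commuting :: "('v \<Rightarrow> 'v) set \<Rightarrow> bool" where
  "max_commuting K \<longleftrightarrow> K \<subseteq> Comm \<and> (\<forall>\<kappa>\<in>K. \<forall>\<mu>\<in>K. \<forall>v\<in>carrier V. \<kappa> (\<mu> v) = \<mu> (\<kappa> v)) \<and>
     (\<forall>\<theta>\<in>Comm. (\<forall>\<kappa>\<in>K. \<forall>v\<in>carrier V. \<theta> (\<kappa> v) = \<kappa> (\<theta> v)) \<longrightarrow> \<theta> \<in> K)"

lemma ex_max_commuting: "\<exists>K. max_commuting K"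
proof -
  define A where "A = {K. K \<subseteq> Comm \<and> (\<forall>\<kappa>\<in>K. \<forall>\<mu>\<in>K. \<forall>v\<in>carrier V. \<kappa> (\<mu> v) = \<mu> (\<kappa> v))}"
  have "\<exists>M\<in>A. \<forall>N\<in>A. M \<subseteq> N \<longrightarrow> N = M"
  proof (rule subset_Zorn_nonempty)
    show "A \<noteq> {}" by (auto simp: A_def intro: exI[of _ "{}"])
    fix \<C> assume C: "\<C> \<noteq> {}" "subset.chain A \<C>"
    have cm: "\<kappa> (\<mu> v) = \<mu> (\<kappa> v)" if km: "\<kappa> \<in> M" "M \<in> \<C>" "\<mu> \<in> N" "N \<in> \<C>" "v \<in> carrier V" for \<kappa> \<mu> M N v
    proof -
      have "M \<subseteq> N \<or> N \<subseteq> M" using C that unfolding subset_chain_def by blast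
      then obtain Z where "Z \<in> \<C>" "\<kappa> \<in> Z" "\<mu> \<in> Z" using km by blast
      then show ?thesis using C km unfolding subset_chain_def A_def by blast
    qed
    have "\<forall>\<kappa>\<in>\<Union>\<C>. \<forall>\<mu>\<in>\<Union>\<C>. \<forall>v\<in>carrier V. \<kappa> (\<mu> v) = \<mu> (\<kappa> v)"
      by (intro ballI) (elim UnionE, rule cm)
    moreover have "\<Union>\<C> \<subseteq> Comm"
    proof (rule Union_least)
      fix M assume "M \<in> \<C>"
      then have "M \<in> A" using C(2) unfolding subset_chain_def by (meson subsetD)
      then show "M \<subseteq> Comm" by (simp add: A_def)
    qed
    ultimately show "\<Union>\<C> \<in> A" unfolding A_def by simp
  qed
  then obtain K where K: "K \<in> A" "\<And>N. N \<in> A \<Longrightarrow> K \<subseteq> N \<Longrightarrow> N = K" by blast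
  have "\<theta> \<in> K" if "\<theta> \<in> Comm" "\<forall>\<kappa>\<in>K. \<forall>v\<in>carrier V. \<theta> (\<kappa> v) = \<kappa> (\<theta> v)" for \<theta>
    using K(2)[of "insert \<theta> K"] K(1) that unfolding A_def by auto
  then show ?thesis using K(1) unfolding max_commuting_def A_def by blast
qed

end

locale irreducible_action_field = irreducible_action +
  fixes K assumes K: "max_commuting K"
begin

lemma K_Comm: "\<kappa> \<in> K \<Longrightarrow> \<kappa> \<in> Comm"
  using K by (auto simp: max_commuting_def)

lemma K_End: "\<kappa> \<in> K \<Longrightarrow> \<kappa> \<in> carrier End"
  using K_Comm by (auto simp: Comm_def)

lemma K_act: "\<kappa> \<in> K \<Longrightarrow> b \<in> carrier B \<Longrightarrow> v \<in> carrier V \<Longrightarrow> \<kappa> (act b v) = act b (\<kappa> v)"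
  using K_Comm by (auto simp: Comm_def)

lemma K_comm: "\<kappa> \<in> K \<Longrightarrow> \<mu> \<in> K \<Longrightarrow> v \<in> carrier V \<Longrightarrow> \<kappa> (\<mu> v) = \<mu> (\<kappa> v)"
  using K by (auto simp: max_commuting_def)

lemma K_closed [simp]: "\<kappa> \<in> K \<Longrightarrow> v \<in> carrier V \<Longrightarrow> \<kappa> v \<in> carrier V"
  using K_End V.end_closed by blast

lemma K_add: "\<kappa> \<in> K \<Longrightarrow> u \<in> carrier V \<Longrightarrow> v \<in> carrier V \<Longrightarrow> \<kappa> (u \<oplus>\<^bsub>V\<^esub> v) = \<kappa> u \<oplus>\<^bsub>V\<^esub> \<kappa> v"
  using K_End V.end_add by blast

text \<open>Zero, one, sums, products and negatives lie in \<open>K\<close> by this single test, and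
  so does the map built in the density argument.\<close>

lemma K_maximal:
  assumes "\<theta> \<in> carrier End" "\<And>b v. b \<in> carrier B \<Longrightarrow> v \<in> carrier V \<Longrightarrow> \<theta> (act b v) = act b (\<theta> v)"
    "\<And>\<kappa> v. \<kappa> \<in> K \<Longrightarrow> v \<in> carrier V \<Longrightarrow> \<theta> (\<kappa> v) = \<kappa> (\<theta> v)"
  shows "\<theta> \<in> K"
proof -
  have "\<theta> \<in> Comm" using assms(1,2) by (simp add: Comm_def)
  then show ?thesis using K assms(3) unfolding max_commuting_def by blast
qed

lemma act_zero: "b \<in> carrier B \<Longrightarrow> act b \<zero>\<^bsub>V\<^esub> = \<zero>\<^bsub>V\<^esub>"
  using V.end_zero[OF rep_closed] by simp

lemma act_uminus: "b \<in> carrier B \<Longrightarrow> v \<in> carrier V \<Longrightarrow> act b (\<ominus>\<^bsub>V\<^esub> v) = \<ominus>\<^bsub>V\<^esub> act b v"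
  using V.end_uminus[OF rep_closed, of b v] by simp

lemma K_zero_one: "\<zero>\<^bsub>End\<^esub> \<in> K" "\<one>\<^bsub>End\<^esub> \<in> K"
  by (rule K_maximal; simp add: V.end_ops act_zero act_closed V.end_zero[OF K_End])+

lemma K_ops:
  assumes "\<kappa> \<in> K" "\<mu> \<in> K"
  shows "\<kappa> \<oplus>\<^bsub>End\<^esub> \<mu> \<in> K" "\<kappa> \<otimes>\<^bsub>End\<^esub> \<mu> \<in> K"
proof -
  show "\<kappa> \<oplus>\<^bsub>End\<^esub> \<mu> \<in> K"
    by (rule K_maximal)
      (use assms K_End in \<open>auto simp: V.end_ops K_act act_closed act_add K_add K_comm\<close>)
  show "\<kappa> \<otimes>\<^bsub>End\<^esub> \<mu> \<in> K"
    by (rule K_maximal)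
      (use assms K_End in \<open>auto simp: V.end_ops K_act act_closed K_comm\<close>)
qed

lemma K_uminus: assumes "\<kappa> \<in> K" shows "\<ominus>\<^bsub>End\<^esub> \<kappa> \<in> K"
proof -
  have e: "(\<ominus>\<^bsub>End\<^esub> \<kappa>) v = \<ominus>\<^bsub>V\<^esub> \<kappa> v" if "v \<in> carrier V" for v
  proof -
    have "(\<ominus>\<^bsub>End\<^esub> \<kappa> \<oplus>\<^bsub>End\<^esub> \<kappa>) v = \<zero>\<^bsub>V\<^esub>"
      using E.l_neg[OF K_End[OF assms]] that by (simp add: V.end_ops)
    then show ?thesis
      using that assms K_End V.end_closed[of "\<ominus>\<^bsub>End\<^esub> \<kappa>" v] by (intro V.minus_equality[symmetric]) (auto simp: V.end_ops)
  qed
  show ?thesis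
    by (rule K_maximal)
      (use assms K_End in \<open>auto simp: e K_act act_closed act_uminus K_comm V.end_uminus\<close>)
qed

lemma K_cring: "cring (End\<lparr>carrier := K\<rparr>)"
proof -
  have "subcring K End"
    by (rule E.subcringI, rule E.subringI)
      (use K_End K_zero_one K_uminus K_ops in \<open>auto intro!: V.end_eqI simp: V.end_ops K_comm E.m_closed\<close>)
  then show ?thesis
    using E.subcring_iff[of K] K_End by auto
qed

text \<open>Takes the place of division by nonzero scalars: one nonzero vector generates the module,
  so its image determines an element of \<open>K\<close>.\<close>

lemma K_unique:
  assumes "\<kappa> \<in> K" "\<mu> \<in> K" "v \<in> carrier V" "v \<noteq> \<zero>\<^bsub>V\<^esub>" "\<kappa> v = \<mu> v"
  shows "\<kappa> = \<mu>"
proof (rule V.end_eqI)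
  fix u assume "u \<in> carrier V"
  then obtain b where "b \<in> carrier B" "act b v = u" using irreducible assms by blast
  then show "\<kappa> u = \<mu> u" using assms K_act by metis
qed (use assms K_End in auto)

text \<open>Enlarging the action by \<open>K\<close> cuts the centralizer down to \<open>K\<close>
  itself, so coordinates will be commutative. Since \<open>K\<close> is central in this algebra, it
  satisfies the same multilinear identities as \<open>B\<close>.\<close>

inductive_set alg :: "('c \<Rightarrow> 'c) set" where
  base: "\<kappa> \<in> K \<Longrightarrow> b \<in> carrier B \<Longrightarrow> \<kappa> \<otimes>\<^bsub>End\<^esub> rep b \<in> alg"
| add: "e \<in> alg \<Longrightarrow> f \<in> alg \<Longrightarrow> e \<oplus>\<^bsub>End\<^esub> f \<in> alg"

lemma alg_End: "e \<in> alg \<Longrightarrow> e \<in> carrier End"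
  by (induction rule: alg.induct) (auto simp: K_End rep_closed)

lemma alg_K: "e \<in> alg \<Longrightarrow> \<kappa> \<in> K \<Longrightarrow> v \<in> carrier V \<Longrightarrow> e (\<kappa> v) = \<kappa> (e v)"
proof (induction rule: alg.induct)
  case (base \<mu> b)
  then show ?case by (simp add: V.end_ops K_act[symmetric] K_comm act_closed)
next
  case (add e f)
  then show ?case using alg_End V.end_closed by (simp add: V.end_ops K_add)
qed

lemma rep_alg: "b \<in> carrier B \<Longrightarrow> rep b \<in> alg"
  using alg.base[OF K_zero_one(2), of b] rep_closed by simp

lemma K_alg: "\<kappa> \<in> K \<Longrightarrow> \<kappa> \<in> alg"
  using alg.base[of \<kappa> "\<one>\<^bsub>B\<^esub>"] K_End ring_hom_one[OF rep_hom] by simp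

lemma alg_mult:
  assumes "e \<in> alg" "f \<in> alg" shows "e \<otimes>\<^bsub>End\<^esub> f \<in> alg"
  using assms(1)
proof (induction rule: alg.induct)
  case e: (base \<kappa> b)
  show ?case
    using assms(2)
  proof (induction rule: alg.induct)
    case (base \<mu> c)
    have "\<kappa> \<otimes>\<^bsub>End\<^esub> rep b \<otimes>\<^bsub>End\<^esub> (\<mu> \<otimes>\<^bsub>End\<^esub> rep c) = (\<kappa> \<otimes>\<^bsub>End\<^esub> \<mu>) \<otimes>\<^bsub>End\<^esub> rep (b \<otimes>\<^bsub>B\<^esub> c)"
      by (rule V.end_eqI)
        (use e base K_End rep_closed in \<open>auto simp: V.end_ops act_closed mult_act K_act\<close>)
    then show ?case using alg.base e base K_ops by simp
  next
    case (add f g)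
    then show ?case using e K_End rep_closed alg_End by (simp add: E.r_distr alg.add)
  qed
next
  case (add e g)
  then show ?case using alg_End assms(2) by (simp add: E.l_distr alg.add)
qed

lemma alg_subring: "subring alg End"
proof (rule E.subringI)
  show "\<ominus>\<^bsub>End\<^esub> e \<in> alg" if "e \<in> alg" for e
  proof -
    have "\<ominus>\<^bsub>End\<^esub> e = (\<ominus>\<^bsub>End\<^esub> \<one>\<^bsub>End\<^esub>) \<otimes>\<^bsub>End\<^esub> e" using alg_End[OF that] by (simp add: E.l_minus)
    then show ?thesis using alg_mult[OF K_alg[OF K_uminus[OF K_zero_one(2)]] that] by simp
  qed
qed (use alg_End alg_mult alg.add K_alg K_zero_one in auto)

abbreviation "Alg \<equiv> End\<lparr>carrier := alg\<rparr>"

lemma Alg_ring: "ring Alg"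
  using E.subring_is_ring[OF alg_subring] .

lemma rep_hom_Alg: "rep \<in> ring_hom B Alg"
  using rep_hom rep_alg by (auto simp: ring_hom_def)

lemma alg_span: "alg \<subseteq> central_span Alg (rep ` carrier B)"
proof
  fix e assume "e \<in> alg"
  then show "e \<in> central_span Alg (rep ` carrier B)"
  proof (induction rule: alg.induct)
    case (base \<kappa> b)
    have "\<kappa> \<in> ring_center Alg"
      using base K_alg alg_End K_End
      by (auto simp: ring_center_def V.end_ops intro!: V.end_eqI intro: alg_K[symmetric])
    then show ?case using central_span.scale[of \<kappa> Alg "rep b"] base by simp
  next
    case (add e f)
    then show ?case using central_span.add[of e Alg _ f] by simp
  qed
qed

section \<open>Separation of vectors, the core of the density theorem\<close>

primrec kspan :: "'c list \<Rightarrow> 'c set" where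
  "kspan [] = {\<zero>\<^bsub>V\<^esub>}"
| "kspan (v # vs) = {\<kappa> v \<oplus>\<^bsub>V\<^esub> u |\<kappa> u. \<kappa> \<in> K \<and> u \<in> kspan vs}"

lemma alg_transitive:
  assumes "e \<in> alg" "v \<in> carrier V" "e v \<noteq> \<zero>\<^bsub>V\<^esub>" "u \<in> carrier V"
  obtains f where "f \<in> alg" "f v = u" "\<And>w. w \<in> carrier V \<Longrightarrow> e w = \<zero>\<^bsub>V\<^esub> \<Longrightarrow> f w = \<zero>\<^bsub>V\<^esub>"
proof -
  obtain b where b: "b \<in> carrier B" "act b (e v) = u"
    using irreducible[OF assms(4) _ assms(3)] V.end_closed alg_End assms by blast
  show thesis
    by (rule that[of "rep b \<otimes>\<^bsub>End\<^esub> e"])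
      (use b assms in \<open>auto simp: alg_mult rep_alg V.end_ops alg_End V.end_closed act_zero\<close>)
qed

text \<open>Jacobson's argument, by induction on the list. Let \<open>J\<close> be the annihilator
  of \<open>vs\<close>. If \<open>J\<close> kills \<open>v\<close>, the induction hypothesis applies
  to \<open>w\<close> itself. Otherwise \<open>J v\<close> is the whole module. If all elements of
  \<open>J\<close> that kill \<open>v\<close> also killed \<open>w\<close>, then
  \<open>e v \<mapsto> e w\<close> would be a well-defined map commuting with the action and with
  \<open>K\<close>, hence some \<open>\<theta>\<close> in \<open>K\<close>. Then \<open>J\<close>
  annihilates \<open>w - \<theta> v\<close>, which by induction puts \<open>w\<close> into the span
  of \<open>v # vs\<close>.\<close>

lemma kspan_nonmem_separated:
  assumes "set vs \<subseteq> carrier V" "w \<in> carrier V" "w \<notin> kspan vs"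
  shows "\<exists>e\<in>alg. (\<forall>v\<in>set vs. e v = \<zero>\<^bsub>V\<^esub>) \<and> e w \<noteq> \<zero>\<^bsub>V\<^esub>"
  using assms
proof (induction vs arbitrary: w)
  case Nil
  then show ?case using K_alg[OF K_zero_one(2)] by (auto intro!: bexI[of _ "\<one>\<^bsub>End\<^esub>"] simp: V.end_ops)
next
  case (Cons v vs)
  have v: "v \<in> carrier V" and vs: "set vs \<subseteq> carrier V" using Cons.prems by auto
  define J where "J = {e \<in> alg. \<forall>v\<in>set vs. e v = \<zero>\<^bsub>V\<^esub>}"
  have J: "e u \<in> carrier V" "e \<in> alg" "e \<in> carrier End" if "e \<in> J" "u \<in> carrier V" for e u
    using that alg_End V.end_closed by (auto simp: J_def)
  show ?case
  proof (cases "\<exists>e\<in>J. e v \<noteq> \<zero>\<^bsub>V\<^esub>")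
    case False
    have "w \<notin> kspan vs"
    proof
      assume w: "w \<in> kspan vs"
      then have "w = \<zero>\<^bsub>End\<^esub> v \<oplus>\<^bsub>V\<^esub> w" using v Cons.prems by (simp add: V.end_ops)
      then have "w \<in> kspan (v # vs)" using w K_zero_one(1) by (simp only: kspan.simps) blast
      then show False using Cons.prems by simp
    qed
    then obtain e where "e \<in> alg" "\<forall>v\<in>set vs. e v = \<zero>\<^bsub>V\<^esub>" "e w \<noteq> \<zero>\<^bsub>V\<^esub>"
      using Cons.IH[OF vs Cons.prems(2)] by blast
    then show ?thesis using False by (auto simp: J_def)
  next
    case True
    then obtain e0 where e0: "e0 \<in> J" "e0 v \<noteq> \<zero>\<^bsub>V\<^esub>" by blast
    have onto: "\<exists>e\<in>J. e v = u" if u: "u \<in> carrier V" for u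
    proof -
      have "e0 \<in> alg" using e0 by (simp add: J_def)
      then obtain f where f: "f \<in> alg" "f v = u" "\<And>w. w \<in> carrier V \<Longrightarrow> e0 w = \<zero>\<^bsub>V\<^esub> \<Longrightarrow> f w = \<zero>\<^bsub>V\<^esub>"
        using alg_transitive[of e0 v u, OF _ v e0(2) u] by blast
      have "f w = \<zero>\<^bsub>V\<^esub>" if "w \<in> set vs" for w
        by (rule f(3)) (use that vs e0(1) in \<open>auto simp: J_def\<close>)
      then show ?thesis using f(1,2) unfolding J_def by blast
    qed
    show ?thesis
    proof (rule ccontr)
      assume "\<not> ?thesis"
      then have kill: "e w = \<zero>\<^bsub>V\<^esub>" if "e \<in> J" "e v = \<zero>\<^bsub>V\<^esub>" for e
        using that by (auto simp: J_def)
      have J_add: "e \<oplus>\<^bsub>End\<^esub> f \<in> J" if "e \<in> J" "f \<in> J" for e f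
        using that vs by (auto simp: J_def V.end_ops alg.add)
      have J_mult: "f \<otimes>\<^bsub>End\<^esub> e \<in> J" if "e \<in> J" "f \<in> alg" for e f
        using that vs by (auto simp: J_def V.end_ops alg_mult V.end_zero[OF alg_End])
      have well: "e w = f w" if ef: "e \<in> J" "f \<in> J" "e v = f v" for e f
      proof -
        define g where "g = \<ominus>\<^bsub>End\<^esub> \<one>\<^bsub>End\<^esub> \<otimes>\<^bsub>End\<^esub> f"
        have g: "g \<in> J" unfolding g_def by (rule J_mult) (use ef K_alg K_uminus K_zero_one in auto)
        have "g \<oplus>\<^bsub>End\<^esub> f = \<zero>\<^bsub>End\<^esub>" using J(3)[OF ef(2) v] by (simp add: g_def E.l_minus E.l_neg)
        then have gf: "g u \<oplus>\<^bsub>V\<^esub> f u = \<zero>\<^bsub>V\<^esub>" if "u \<in> carrier V" for u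
          using that V.end_ops(2,4)[OF that] by metis
        have "(g \<oplus>\<^bsub>End\<^esub> e) v = \<zero>\<^bsub>V\<^esub>" using gf[OF v] ef v by (simp add: V.end_ops)
        then have "(g \<oplus>\<^bsub>End\<^esub> e) w = \<zero>\<^bsub>V\<^esub>" using kill J_add g ef by blast
        then have "g w \<oplus>\<^bsub>V\<^esub> e w = g w \<oplus>\<^bsub>V\<^esub> f w" using gf Cons.prems by (simp add: V.end_ops)
        then show ?thesis using J(1) g ef Cons.prems(2) by (metis V.add.l_cancel)
      qed
      \<comment> \<open>The choice of \<open>e\<close> is harmless: by \<open>well\<close>,
        \<open>e w\<close> depends only on \<open>e v\<close>.\<close>
      define \<theta> where "\<theta> = (\<lambda>u\<in>carrier V. (SOME e. e \<in> J \<and> e v = u) w)"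
      have \<theta>: "\<theta> (e v) = e w" if "e \<in> J" for e
      proof -
        have "(SOME f. f \<in> J \<and> f v = e v) \<in> J \<and> (SOME f. f \<in> J \<and> f v = e v) v = e v"
          by (rule someI[of _ e]) (use that in simp)
        then show ?thesis using well[of "SOME f. f \<in> J \<and> f v = e v" e] that J(1)[OF that v] by (simp add: \<theta>_def)
      qed
      have "\<theta> \<in> K"
      proof (rule K_maximal)
        show "\<theta> \<in> carrier End"
          unfolding \<theta>_def
        proof (rule V.endI)
          fix u assume "u \<in> carrier V"
          then obtain e where "e \<in> J" "e v = u" using onto by blast
          then show "(SOME e. e \<in> J \<and> e v = u) w \<in> carrier V"
            using \<theta>[of e] J(1)[of e w] \<open>u \<in> carrier V\<close> Cons.prems by (simp add: \<theta>_def)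
        next
          fix u u' assume u: "u \<in> carrier V" "u' \<in> carrier V"
          then obtain e e' where e: "e \<in> J" "e v = u" "e' \<in> J" "e' v = u'" using onto by meson
          have "\<theta> (u \<oplus>\<^bsub>V\<^esub> u') = \<theta> u \<oplus>\<^bsub>V\<^esub> \<theta> u'"
            using \<theta>[OF J_add[OF e(1,3)]] \<theta>[OF e(1)] \<theta>[OF e(3)] e v Cons.prems by (simp add: V.end_ops)
          then show "(SOME e. e \<in> J \<and> e v = u \<oplus>\<^bsub>V\<^esub> u') w =
              (SOME e. e \<in> J \<and> e v = u) w \<oplus>\<^bsub>V\<^esub> (SOME e. e \<in> J \<and> e v = u') w"
            using u by (simp add: \<theta>_def)
        qed
        show "\<theta> (act b u) = act b (\<theta> u)" if bu: "b \<in> carrier B" "u \<in> carrier V" for b u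
        proof -
          obtain e where e: "e \<in> J" "e v = u" using onto[OF bu(2)] by blast
          show ?thesis
            using \<theta>[OF J_mult[OF e(1) rep_alg[OF bu(1)]]] \<theta>[OF e(1)] e v Cons.prems bu J(1)[OF e(1), of w]
            by (simp add: V.end_ops)
        qed
        show "\<theta> (\<kappa> u) = \<kappa> (\<theta> u)" if bu: "\<kappa> \<in> K" "u \<in> carrier V" for \<kappa> u
        proof -
          obtain e where e: "e \<in> J" "e v = u" using onto[OF bu(2)] by blast
          show ?thesis
            using \<theta>[OF J_mult[OF e(1) K_alg[OF bu(1)]]] \<theta>[OF e(1)] e v Cons.prems bu J(1)[OF e(1), of w]
            by (simp add: V.end_ops)
        qed
      qed
      let ?w = "w \<ominus>\<^bsub>V\<^esub> \<theta> v"
      have w: "?w \<in> carrier V" using \<open>\<theta> \<in> K\<close> v Cons.prems by simp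
      have "?w \<notin> kspan vs"
      proof
        assume "?w \<in> kspan vs"
        moreover have "w = \<theta> v \<oplus>\<^bsub>V\<^esub> ?w"
          using \<open>\<theta> \<in> K\<close> v Cons.prems by (simp add: a_minus_def V.a_lcomm V.r_neg)
        ultimately have "w \<in> kspan (v # vs)" using \<open>\<theta> \<in> K\<close> by (simp only: kspan.simps) blast
        then show False using Cons.prems by simp
      qed
      then obtain e where e: "e \<in> alg" "\<forall>v\<in>set vs. e v = \<zero>\<^bsub>V\<^esub>" "e ?w \<noteq> \<zero>\<^bsub>V\<^esub>"
        using Cons.IH[OF vs w] by blast
      then have eJ: "e \<in> J" by (simp add: J_def)
      have "e (\<theta> v) = e w" using alg_K[OF e(1) \<open>\<theta> \<in> K\<close> v] \<theta>[OF eJ] by simp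
      then have "e ?w = \<zero>\<^bsub>V\<^esub>"
        using V.end_add[OF alg_End[OF e(1)], of w "\<ominus>\<^bsub>V\<^esub> \<theta> v"] V.end_uminus[OF alg_End[OF e(1)], of "\<theta> v"]
          J(1)[OF eJ Cons.prems(2)] \<open>\<theta> \<in> K\<close> v Cons.prems
        by (simp add: a_minus_def V.r_neg)
      then show False using e by simp
    qed
  qed
qed

end

context irreducible_action_field
begin

sublocale A: ring Alg by (rule Alg_ring)

lemma separated:
  assumes "set vs \<subseteq> carrier V" "w \<in> carrier V" "w \<notin> kspan vs" "u \<in> carrier V"
  obtains e where "e \<in> alg" "\<And>v. v \<in> set vs \<Longrightarrow> e v = \<zero>\<^bsub>V\<^esub>" "e w = u"
proof -
  obtain e where e: "e \<in> alg" "\<forall>v\<in>set vs. e v = \<zero>\<^bsub>V\<^esub>" "e w \<noteq> \<zero>\<^bsub>V\<^esub>"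
    using kspan_nonmem_separated[OF assms(1-3)] by blast
  obtain f where f: "f \<in> alg" "f w = u" "\<And>w. w \<in> carrier V \<Longrightarrow> e w = \<zero>\<^bsub>V\<^esub> \<Longrightarrow> f w = \<zero>\<^bsub>V\<^esub>"
    using alg_transitive[OF e(1) assms(2) e(3) assms(4)] by blast
  show thesis by (rule that[OF f(1) _ f(2)]) (use f e assms(1) in auto)
qed

text \<open>Each vector avoids the span of the later ones. This triangular form follows the
  recursion of \<open>kspan\<close>, and \<open>separated\<close> turns it into operators killing
  the later vectors.\<close>

primrec indep :: "'c list \<Rightarrow> bool" where
  "indep [] \<longleftrightarrow> True"
| "indep (v # vs) \<longleftrightarrow> v \<notin> kspan vs \<and> indep vs"

lemma indep_drop: "indep vs \<Longrightarrow> indep (drop n vs)"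
proof (induction vs arbitrary: n)
  case (Cons v vs)
  then show ?case by (cases n) auto
qed simp

lemma indep_nth: "indep vs \<Longrightarrow> i < length vs \<Longrightarrow> vs ! i \<notin> kspan (drop (Suc i) vs)"
  using indep_drop[of vs i] by (simp add: Cons_nth_drop_Suc[symmetric])

lemma zero_in_kspan: "set vs \<subseteq> carrier V \<Longrightarrow> \<zero>\<^bsub>V\<^esub> \<in> kspan vs"
proof (induction vs)
  case (Cons v vs)
  then have "\<zero>\<^bsub>V\<^esub> = \<zero>\<^bsub>End\<^esub> v \<oplus>\<^bsub>V\<^esub> \<zero>\<^bsub>V\<^esub>" by (simp add: V.end_ops)
  then show ?case using Cons K_zero_one(1) by (simp only: kspan.simps) force
qed simp

text \<open>The \<open>e\<^sub>p\<close> send \<open>v\<^sub>p\<^sub>+\<^sub>1\<close> to \<open>v\<^sub>p\<close> and kill the later vectors, so of all the products of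
  \<open>e\<^sub>0, \<dots>, e\<^sub>N\<^sub>-\<^sub>1\<close> in some order only \<open>e\<^sub>0 \<cdots> e\<^sub>N\<^sub>-\<^sub>1\<close> does not kill \<open>v\<^sub>N\<close>.\<close>

lemma indep_length_le:
  assumes id: "ml_identity Alg N c" and vs: "set vs \<subseteq> carrier V" "indep vs"
  shows "length vs \<le> N"
proof (rule ccontr)
  assume "\<not> length vs \<le> N"
  \<comment> \<open>Taking a final segment keeps independence, which only looks to the
    right.\<close>
  define ws where "ws = drop (length vs - Suc N) vs"
  have ws: "length ws = Suc N" "indep ws" "set ws \<subseteq> carrier V"
    using \<open>\<not> length vs \<le> N\<close> vs indep_drop set_drop_subset[of "length vs - Suc N" vs] by (auto simp: ws_def)
  have wsV: "ws ! i \<in> carrier V" if "i \<le> N" for i using ws that by auto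
  have "\<exists>e. e \<in> alg \<and> (p < N \<longrightarrow> (\<forall>j\<le>N. j > Suc p \<longrightarrow> e (ws ! j) = \<zero>\<^bsub>V\<^esub>) \<and> e (ws ! Suc p) = ws ! p)" for p
  proof (cases "p < N")
    case True
    have "ws ! Suc p \<notin> kspan (drop (Suc (Suc p)) ws)" using indep_nth[OF ws(2), of "Suc p"] ws(1) True by simp
    moreover have "set (drop (Suc (Suc p)) ws) \<subseteq> carrier V" using ws(3) set_drop_subset by fast
    ultimately obtain e where e: "e \<in> alg" "\<And>v. v \<in> set (drop (Suc (Suc p)) ws) \<Longrightarrow> e v = \<zero>\<^bsub>V\<^esub>" "e (ws ! Suc p) = ws ! p"
      using separated[of "drop (Suc (Suc p)) ws" "ws ! Suc p" "ws ! p"] wsV True by auto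
    have "e (ws ! j) = \<zero>\<^bsub>V\<^esub>" if jj: "j \<le> N" "j > Suc p" for j
    proof -
      obtain l where l: "j = Suc (Suc p) + l" using jj(2) by (metis Suc_leI le_Suc_ex)
      then have "drop (Suc (Suc p)) ws ! l = ws ! j" "l < length (drop (Suc (Suc p)) ws)"
        using jj(1) ws(1) by simp_all
      then have "ws ! j \<in> set (drop (Suc (Suc p)) ws)" by (metis nth_mem)
      then show ?thesis by (rule e(2))
    qed
    then show ?thesis using e by blast
  next
    case False
    then show ?thesis using K_alg[OF K_zero_one(1)] by blast
  qed
  then obtain x where x: "\<And>p. x p \<in> alg"
    "\<And>p j. p < N \<Longrightarrow> j \<le> N \<Longrightarrow> Suc p < j \<Longrightarrow> x p (ws ! j) = \<zero>\<^bsub>V\<^esub>"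
    "\<And>p. p < N \<Longrightarrow> x p (ws ! Suc p) = ws ! p"
    by metis
  have xA: "x \<in> UNIV \<rightarrow> carrier Alg" using x by auto
  have wA: "word_prod Alg x w \<in> alg" for w using A.word_prod_closed[of w x] x by simp
  \<comment> \<open>The last letter acts first. On vector number \<open>k + 1\<close> the letter
    \<open>k\<close> gives vector number \<open>k\<close>, and every smaller letter gives zero, so
    the word is peeled from the right.\<close>
  have val: "word_prod Alg x w (ws ! k) = (if w = [0..<k] then ws ! 0 else \<zero>\<^bsub>V\<^esub>)"
    if "distinct w" "set w = {..<k}" "k \<le> N" for w k
    using that
  proof (induction k arbitrary: w)
    case 0
    then show ?case using wsV[of 0] by (simp add: V.end_ops)
  next
    case (Suc k)
    then obtain w' p where w: "w = w' @ [p]" by (cases w rule: rev_cases) auto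
    have p: "p < Suc k" using Suc.prems w by auto
    have xp: "x p \<in> alg" "x p \<in> carrier End" using x(1) alg_End by auto
    have "word_prod Alg x w = word_prod Alg x w' \<otimes>\<^bsub>End\<^esub> x p"
      using A.word_prod_append[OF xA, of w' "[p]"] w xp by simp
    then have e: "word_prod Alg x w (ws ! Suc k) = word_prod Alg x w' (x p (ws ! Suc k))"
      using wsV Suc.prems by (simp add: V.end_ops)
    show ?case
    proof (cases "p = k")
      case True
      have "set w' = {..<Suc k} - {k}" using Suc.prems w True by auto
      also have "\<dots> = {..<k}" by auto
      finally have "word_prod Alg x w' (ws ! k) = (if w' = [0..<k] then ws ! 0 else \<zero>\<^bsub>V\<^esub>)"
        using Suc.prems w by (intro Suc.IH) auto
      moreover have "x p (ws ! Suc k) = ws ! k" using x(3)[of k] True Suc.prems by simp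
      ultimately show ?thesis using e w True by simp
    next
      case False
      then have "x p (ws ! Suc k) = \<zero>\<^bsub>V\<^esub>" using p Suc.prems by (intro x(2)) auto
      then show ?thesis using e w False V.end_zero[OF alg_End[OF wA]] by simp
    qed
  qed
  let ?v = "ws ! N"
  have v: "?v \<in> carrier V" using wsV by simp
  have ev: "(\<lambda>e. e ?v) \<in> carrier Alg \<rightarrow> carrier V" "\<zero>\<^bsub>Alg\<^esub> ?v = \<zero>\<^bsub>V\<^esub>"
    "\<And>e f. (e \<oplus>\<^bsub>Alg\<^esub> f) ?v = e ?v \<oplus>\<^bsub>V\<^esub> f ?v"
    using v V.end_closed alg_End by (auto simp: V.end_ops)
  have summand: "add_pow Alg (c w) (word_prod Alg x w) ?v = (if w = [0..<N] then ws ! 0 else \<zero>\<^bsub>V\<^esub>)"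
    if "w \<in> permutations_of_set {..<N}" for w
  proof -
    have "add_pow Alg (c w) (word_prod Alg x w) ?v = add_pow V (c w) (word_prod Alg x w ?v)"
      using additive_int_multiple[of Alg V "\<lambda>e. e ?v", OF A.abelian_group_axioms V.abelian_group_axioms ev(1) ev(3)] wA by simp
    also have "word_prod Alg x w ?v = (if w = [0..<N] then ws ! 0 else \<zero>\<^bsub>V\<^esub>)"
      using permutations_of_setD[OF that] by (intro val) auto
    finally show ?thesis using id wsV[of 0] by (simp add: ml_identity_def V.add.int_pow_1)
  qed
  have "\<zero>\<^bsub>V\<^esub> = mlpoly Alg N c x ?v" using id xA ev(2) by (simp add: ml_identity_def)
  also have "\<dots> = (\<Oplus>\<^bsub>V\<^esub>w\<in>permutations_of_set {..<N}. add_pow Alg (c w) (word_prod Alg x w) ?v)"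
    unfolding mlpoly_def
    by (rule finsum_additive[where h = "\<lambda>e. e ?v"])
      (use ev A.abelian_monoid_axioms V.abelian_monoid_axioms wA A.int_multiple_closed in auto)
  also have "\<dots> = add_pow Alg (c [0..<N]) (word_prod Alg x [0..<N]) ?v"
    by (rule V.finsum_eq_single) (use summand wsV[of 0] in auto)
  also have "\<dots> = ws ! 0" by (subst summand) auto
  finally have "ws ! 0 = \<zero>\<^bsub>V\<^esub>" ..
  moreover have "ws ! 0 \<notin> kspan (drop 1 ws)" using indep_nth[OF ws(2), of 0] ws(1) by simp
  moreover have "set (drop 1 ws) \<subseteq> carrier V" using ws(3) set_drop_subset by fast
  ultimately show False using zero_in_kspan by metis
qed

text \<open>The bound on independent lists makes a longest one exist. A vector outside its span
  could be put in front of it.\<close>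

lemma ex_basis:
  assumes id: "ml_identity Alg N c"
  obtains vs where "set vs \<subseteq> carrier V" "indep vs" "length vs \<le> N" "carrier V \<subseteq> kspan vs" "0 < length vs"
proof -
  define P where "P n \<longleftrightarrow> (\<exists>vs. set vs \<subseteq> carrier V \<and> indep vs \<and> length vs = n)" for n
  have P0: "P 0" by (auto simp: P_def intro!: exI[of _ "[]"])
  have PN: "n \<le> N" if "P n" for n using that indep_length_le[OF id] by (auto simp: P_def)
  define n where "n = Greatest P"
  have "P n" unfolding n_def using GreatestI_nat[of P, OF P0] PN by blast
  moreover have n: "m \<le> n" if "P m" for m unfolding n_def using Greatest_le_nat[of P, OF that] PN by blast
  ultimately obtain vs where vs: "set vs \<subseteq> carrier V" "indep vs" "length vs = n" by (auto simp: P_def)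
  have span: "carrier V \<subseteq> kspan vs"
  proof (rule ccontr)
    assume "\<not> carrier V \<subseteq> kspan vs"
    then obtain v where "v \<in> carrier V" "v \<notin> kspan vs" by blast
    then have "P (Suc n)" using vs by (auto simp: P_def intro!: exI[of _ "v # vs"])
    then show False using n by fastforce
  qed
  have "vs \<noteq> []"
  proof
    assume "vs = []"
    then show False using span nontrivial V.zero_closed by auto
  qed
  then show thesis using that[OF vs(1,2) indep_length_le[OF id vs(1,2)] span] by simp
qed

text \<open>The value at \<open>v\<close> is corrected by an operator that kills the remaining
  vectors, so the values already arranged are kept.\<close>

lemma density:
  assumes "set vs \<subseteq> carrier V" "indep vs" "length us = length vs" "set us \<subseteq> carrier V"
  shows "\<exists>e\<in>alg. \<forall>i<length vs. e (vs ! i) = us ! i"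
  using assms
proof (induction vs arbitrary: us)
  case Nil
  then show ?case using K_alg[OF K_zero_one(1)] by auto
next
  case (Cons v vs)
  then obtain u us' where us: "us = u # us'" by (cases us) auto
  obtain e where e: "e \<in> alg" "\<And>i. i < length vs \<Longrightarrow> e (vs ! i) = us' ! i"
    using Cons.IH[of us'] Cons.prems us by auto
  have ev: "e v \<in> carrier V" using V.end_closed[OF alg_End[OF e(1)]] Cons.prems by simp
  obtain f where f: "f \<in> alg" "\<And>v. v \<in> set vs \<Longrightarrow> f v = \<zero>\<^bsub>V\<^esub>" "f v = u \<ominus>\<^bsub>V\<^esub> e v"
    using separated[of vs v "u \<ominus>\<^bsub>V\<^esub> e v"] Cons.prems us ev by auto
  have "(e \<oplus>\<^bsub>End\<^esub> f) ((v # vs) ! i) = us ! i" if i: "i < length (v # vs)" for i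
  proof (cases i)
    case 0
    then show ?thesis using f ev Cons.prems us by (simp add: V.end_ops a_minus_def V.a_lcomm V.r_neg)
  next
    case (Suc j)
    then have "vs ! j \<in> set vs" using i by simp
    then show ?thesis using Suc e f i Cons.prems us by (auto simp: V.end_ops subset_iff)
  qed
  then show ?case using alg.add[OF e(1) f(1)] by blast
qed


lemma kspan_finsum:
  assumes "set vs \<subseteq> carrier V" "w \<in> kspan vs"
  shows "\<exists>\<kappa>. (\<forall>i. \<kappa> i \<in> K) \<and> w = (\<Oplus>\<^bsub>V\<^esub>i\<in>{..<length vs}. \<kappa> i (vs ! i))"
  using assms
proof (induction vs arbitrary: w)
  case Nil
  then show ?case using K_zero_one(1) by (auto intro!: exI[of _ "\<lambda>_. \<zero>\<^bsub>End\<^esub>"])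
next
  case (Cons v vs)
  then obtain \<mu> u where u: "\<mu> \<in> K" "u \<in> kspan vs" "w = \<mu> v \<oplus>\<^bsub>V\<^esub> u" by auto
  then obtain \<kappa> where k: "\<forall>i. \<kappa> i \<in> K" "u = (\<Oplus>\<^bsub>V\<^esub>i\<in>{..<length vs}. \<kappa> i (vs ! i))"
    using Cons by auto
  let ?\<kappa> = "\<lambda>i. case i of 0 \<Rightarrow> \<mu> | Suc j \<Rightarrow> \<kappa> j"
  have vsV: "vs ! i \<in> carrier V" if "i < length vs" for i using that Cons.prems(1) by auto
  have cl: "?\<kappa> i ((v # vs) ! i) \<in> carrier V" if "i < length (v # vs)" for i
    using that Cons.prems u k vsV by (cases i) auto
  have "(\<Oplus>\<^bsub>V\<^esub>i\<in>{..<length (v # vs)}. ?\<kappa> i ((v # vs) ! i)) =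
      (\<Oplus>\<^bsub>V\<^esub>i\<in>insert 0 (Suc ` {..<length vs}). ?\<kappa> i ((v # vs) ! i))"
    by (simp add: lessThan_Suc_eq_insert_0)
  also have "\<dots> = \<mu> v \<oplus>\<^bsub>V\<^esub> (\<Oplus>\<^bsub>V\<^esub>i\<in>Suc ` {..<length vs}. ?\<kappa> i ((v # vs) ! i))"
    using cl u Cons.prems vsV k by (subst V.finsum_insert) auto
  also have "(\<Oplus>\<^bsub>V\<^esub>i\<in>Suc ` {..<length vs}. ?\<kappa> i ((v # vs) ! i)) = u"
    unfolding k(2) using vsV k(1) by (subst V.finsum_reindex) auto
  finally have "w = (\<Oplus>\<^bsub>V\<^esub>i\<in>{..<length (v # vs)}. ?\<kappa> i ((v # vs) ! i))" using u by simp
  moreover have "\<forall>i. ?\<kappa> i \<in> K" using u(1) k(1) by (auto split: nat.split)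
  ultimately show ?case by blast
qed

end

section \<open>Coordinates and the matrix representation of a simple module\<close>

locale irreducible_action_basis = irreducible_action_field +
  fixes vs assumes vs: "set vs \<subseteq> carrier V" "indep vs" and span: "carrier V \<subseteq> kspan vs"
    and nonempty: "0 < length vs"
begin

abbreviation "d \<equiv> length vs"

lemma vsV [simp]: "i < d \<Longrightarrow> vs ! i \<in> carrier V"
  using vs by auto

lemma vs_nonzero: "i < d \<Longrightarrow> vs ! i \<noteq> \<zero>\<^bsub>V\<^esub>"
  using indep_nth[OF vs(2)] zero_in_kspan[of "drop (Suc i) vs"] vs(1) set_drop_subset[of "Suc i" vs] by fastforce

text \<open>The matrix unit for row \<open>fst p\<close> and column \<open>snd p\<close> in the
  chosen basis, supplied by density.\<close>

definition unit :: "nat \<times> nat \<Rightarrow> 'c \<Rightarrow> 'c" where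
  "unit p = (SOME e. e \<in> alg \<and> (\<forall>l<d. e (vs ! l) = (if l = snd p then vs ! fst p else \<zero>\<^bsub>V\<^esub>)))"

lemma unit:
  assumes "fst p < d"
  shows "unit p \<in> alg" "l < d \<Longrightarrow> unit p (vs ! l) = (if l = snd p then vs ! fst p else \<zero>\<^bsub>V\<^esub>)"
proof -
  let ?us = "map (\<lambda>l. if l = snd p then vs ! fst p else \<zero>\<^bsub>V\<^esub>) [0..<d]"
  have "\<exists>e\<in>alg. \<forall>i<d. e (vs ! i) = ?us ! i"
    by (rule density[OF vs]) (use assms in auto)
  then have "\<exists>e. e \<in> alg \<and> (\<forall>l<d. e (vs ! l) = (if l = snd p then vs ! fst p else \<zero>\<^bsub>V\<^esub>))" by auto
  from someI_ex[OF this] show "unit p \<in> alg" "l < d \<Longrightarrow> unit p (vs ! l) = (if l = snd p then vs ! fst p else \<zero>\<^bsub>V\<^esub>)"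
    unfolding unit_def by blast+
qed

lemma unit_End: "fst p < d \<Longrightarrow> unit p \<in> carrier End"
  using unit(1) alg_End by blast

abbreviation comb :: "(nat \<Rightarrow> 'c \<Rightarrow> 'c) \<Rightarrow> 'c" where
  "comb \<kappa> \<equiv> (\<Oplus>\<^bsub>V\<^esub>i\<in>{..<d}. \<kappa> i (vs ! i))"

text \<open>The diagonal unit \<open>unit (i, i)\<close> isolates the term number \<open>i\<close>,
  because elements of \<open>alg\<close> commute with \<open>K\<close>; \<open>K_unique\<close> then
  compares the coefficients.\<close>

lemma comb_unique:
  assumes k: "\<And>i. i < d \<Longrightarrow> \<kappa> i \<in> K" and m: "\<And>i. i < d \<Longrightarrow> \<mu> i \<in> K" and eq: "comb \<kappa> = comb \<mu>" and i: "i < d"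
  shows "\<kappa> i = \<mu> i"
proof -
  have "unit (i, i) (comb \<nu>) = \<nu> i (vs ! i)" if n: "\<And>i. i < d \<Longrightarrow> \<nu> i \<in> K" for \<nu>
  proof -
    have "unit (i, i) (comb \<nu>) = (\<Oplus>\<^bsub>V\<^esub>l\<in>{..<d}. unit (i, i) (\<nu> l (vs ! l)))"
      by (rule finsum_additive)
        (use V.abelian_monoid_axioms n i unit_End[of "(i, i)"] in \<open>auto simp: V.end_closed V.end_zero V.end_add\<close>)
    also have "\<dots> = unit (i, i) (\<nu> i (vs ! i))"
    proof (rule V.finsum_eq_single)
      fix l assume l: "l \<in> {..<d}" "l \<noteq> i"
      then have "unit (i, i) (\<nu> l (vs ! l)) = \<nu> l (unit (i, i) (vs ! l))"
        using n i by (intro alg_K unit) auto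
      also have "unit (i, i) (vs ! l) = \<zero>\<^bsub>V\<^esub>" using unit(2)[of "(i, i)" l] i l by simp
      finally show "unit (i, i) (\<nu> l (vs ! l)) = \<zero>\<^bsub>V\<^esub>"
        using V.end_zero[OF K_End[OF n]] l by simp
    qed (use n i unit_End[of "(i, i)"] in \<open>auto simp: V.end_closed\<close>)
    also have "\<dots> = \<nu> i (unit (i, i) (vs ! i))"
      using n i by (intro alg_K unit) auto
    also have "\<dots> = \<nu> i (vs ! i)" using unit(2)[of "(i, i)" i] i by simp
    finally show ?thesis .
  qed
  from this[of \<kappa>] this[of \<mu>] have "\<kappa> i (vs ! i) = \<mu> i (vs ! i)" using k m eq by simp
  then show ?thesis using k m i vs_nonzero by (intro K_unique[of "\<kappa> i" "\<mu> i" "vs ! i"]) auto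
qed

definition coord :: "'c \<Rightarrow> nat \<Rightarrow> 'c \<Rightarrow> 'c" where
  "coord w = (SOME \<kappa>. (\<forall>i. \<kappa> i \<in> K) \<and> w = comb \<kappa>)"

lemma coord:
  assumes "w \<in> carrier V"
  shows "coord w i \<in> K" "w = comb (coord w)"
proof -
  have "\<exists>\<kappa>. (\<forall>i. \<kappa> i \<in> K) \<and> w = comb \<kappa>" using kspan_finsum[OF vs(1)] assms span by blast
  from someI_ex[OF this] show "coord w i \<in> K" "w = comb (coord w)" unfolding coord_def by blast+
qed

lemma coord_eqI:
  assumes "\<And>i. i < d \<Longrightarrow> \<kappa> i \<in> K" "w = comb \<kappa>" "i < d"
  shows "coord w i = \<kappa> i"
proof -
  have "w \<in> carrier V" unfolding assms(2) using assms(1) by (intro V.finsum_closed) auto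
  then show ?thesis using comb_unique[of "coord w" \<kappa> i] coord assms by metis
qed

abbreviation "Kring \<equiv> End\<lparr>carrier := K\<rparr>"

sublocale K: cring Kring by (rule K_cring)

definition matrep :: "'a \<Rightarrow> nat \<times> nat \<Rightarrow> 'c \<Rightarrow> 'c" where
  "matrep b = (\<lambda>(i, j)\<in>{..<d} \<times> {..<d}. coord (act b (vs ! j)) i)"

lemma eval_additive:
  assumes "v \<in> carrier V" "f \<in> A \<rightarrow> K"
  shows "finsum Kring f A v = (\<Oplus>\<^bsub>V\<^esub>i\<in>A. f i v)"
  by (rule finsum_additive[where h = "\<lambda>e. e v"])
    (use assms K.abelian_monoid_axioms V.abelian_monoid_axioms in \<open>auto simp: V.end_ops\<close>)

lemma matrep_hom: "matrep \<in> ring_hom B (matrix_ring Kring d)"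
proof (rule ring_hom_memI)
  show c: "matrep b \<in> carrier (matrix_ring Kring d)" if "b \<in> carrier B" for b
    unfolding matrep_def by (rule K.matI) (use that in \<open>auto intro!: coord act_closed\<close>)
  have e: "matrep b (i, j) = coord (act b (vs ! j)) i" if "i < d" "j < d" for b i j
    using that by (simp add: matrep_def)
  show "matrep (a \<oplus>\<^bsub>B\<^esub> b) = matrep a \<oplus>\<^bsub>matrix_ring Kring d\<^esub> matrep b" if ab: "a \<in> carrier B" "b \<in> carrier B" for a b
  proof (rule K.mat_eqI)
    fix i j assume ij: "i < d" "j < d"
    let ?a = "coord (act a (vs ! j))" and ?b = "coord (act b (vs ! j))"
    have k: "?a l \<in> K" "?b l \<in> K" for l using ab ij by (auto intro!: coord act_closed)
    have "coord (act (a \<oplus>\<^bsub>B\<^esub> b) (vs ! j)) i = ?a i \<oplus>\<^bsub>End\<^esub> ?b i"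
    proof (rule coord_eqI)
      have "act (a \<oplus>\<^bsub>B\<^esub> b) (vs ! j) = comb ?a \<oplus>\<^bsub>V\<^esub> comb ?b"
        using ab ij coord(2)[of "act a (vs ! j)"] coord(2)[of "act b (vs ! j)"] by (simp add: add_act act_closed)
      also have "\<dots> = (\<Oplus>\<^bsub>V\<^esub>l\<in>{..<d}. ?a l (vs ! l) \<oplus>\<^bsub>V\<^esub> ?b l (vs ! l))"
        by (rule V.finsum_addf[symmetric]) (use k in auto)
      also have "\<dots> = comb (\<lambda>l. ?a l \<oplus>\<^bsub>End\<^esub> ?b l)"
        by (rule V.finsum_cong') (use k K_ops in \<open>auto simp: V.end_ops\<close>)
      finally show "act (a \<oplus>\<^bsub>B\<^esub> b) (vs ! j) = comb (\<lambda>l. ?a l \<oplus>\<^bsub>End\<^esub> ?b l)" .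
    qed (use k ij K_ops in auto)
    then show "matrep (a \<oplus>\<^bsub>B\<^esub> b) (i, j) = (matrep a \<oplus>\<^bsub>matrix_ring Kring d\<^esub> matrep b) (i, j)"
      using ij by (simp add: e K.mat_ops)
  qed (use ab c in \<open>auto intro!: K.mat_closed\<close>)
  show "matrep (a \<otimes>\<^bsub>B\<^esub> b) = matrep a \<otimes>\<^bsub>matrix_ring Kring d\<^esub> matrep b" if ab: "a \<in> carrier B" "b \<in> carrier B" for a b
  proof (rule K.mat_eqI)
    fix i j assume ij: "i < d" "j < d"
    let ?a = "\<lambda>l. coord (act a (vs ! l))" and ?b = "coord (act b (vs ! j))"
    have k: "l < d \<Longrightarrow> ?a l m \<in> K" "?b l \<in> K" for l m using ab ij by (auto intro!: coord act_closed)
    let ?m = "\<lambda>i. \<Oplus>\<^bsub>Kring\<^esub>l\<in>{..<d}. ?a l i \<otimes>\<^bsub>Kring\<^esub> ?b l"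
    have mK: "?m i \<in> K" for i using K.finsum_closed[of "\<lambda>l. ?a l i \<otimes>\<^bsub>Kring\<^esub> ?b l" "{..<d}"] k K_ops by auto
    have "coord (act (a \<otimes>\<^bsub>B\<^esub> b) (vs ! j)) i = ?m i"
    proof (rule coord_eqI)
      have "act (a \<otimes>\<^bsub>B\<^esub> b) (vs ! j) = rep a (comb ?b)"
        using ab ij coord(2)[of "act b (vs ! j)"] by (simp add: mult_act act_closed)
      also have "\<dots> = (\<Oplus>\<^bsub>V\<^esub>l\<in>{..<d}. rep a (?b l (vs ! l)))"
        by (rule finsum_additive)
          (use V.abelian_monoid_axioms k rep_closed[OF ab(1)] in \<open>auto simp: V.end_zero V.end_add act_closed act_zero act_add ab\<close>)
      also have "\<dots> = (\<Oplus>\<^bsub>V\<^esub>l\<in>{..<d}. \<Oplus>\<^bsub>V\<^esub>m\<in>{..<d}. ?b l (?a l m (vs ! m)))"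
      proof (rule V.finsum_cong')
        fix l assume l: "l \<in> {..<d}"
        have "rep a (?b l (vs ! l)) = ?b l (act a (vs ! l))" using l k ab K_act by simp
        also have "\<dots> = ?b l (comb (?a l))" using coord(2)[of "act a (vs ! l)"] l ab act_closed by simp
        also have "\<dots> = (\<Oplus>\<^bsub>V\<^esub>m\<in>{..<d}. ?b l (?a l m (vs ! m)))"
          by (rule finsum_additive)
            (use V.abelian_monoid_axioms k l V.end_zero[OF K_End[OF k(2)]] in \<open>auto simp: K_add\<close>)
        finally show "rep a (?b l (vs ! l)) = (\<Oplus>\<^bsub>V\<^esub>m\<in>{..<d}. ?b l (?a l m (vs ! m)))" .
      qed (use k in \<open>auto intro!: V.finsum_closed\<close>)
      also have "\<dots> = (\<Oplus>\<^bsub>V\<^esub>m\<in>{..<d}. \<Oplus>\<^bsub>V\<^esub>l\<in>{..<d}. ?b l (?a l m (vs ! m)))"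
        by (rule V.finsum_swap) (use k in auto)
      also have "\<dots> = comb ?m"
      proof (rule V.finsum_cong')
        fix m assume m: "m \<in> {..<d}"
        have "?m m (vs ! m) = (\<Oplus>\<^bsub>V\<^esub>l\<in>{..<d}. (?a l m \<otimes>\<^bsub>Kring\<^esub> ?b l) (vs ! m))"
          by (rule eval_additive) (use m k K_ops in auto)
        \<comment> \<open>Commutativity of \<open>K\<close> is used here: operators compose with the
          coefficient of \<open>b\<close> outermost, whereas the matrix product has the coefficient
          of \<open>a\<close> on the left.\<close>
        also have "\<dots> = (\<Oplus>\<^bsub>V\<^esub>l\<in>{..<d}. ?b l (?a l m (vs ! m)))"
          by (rule V.finsum_cong') (use m k in \<open>auto simp: V.end_ops K_comm\<close>)
        finally show "(\<Oplus>\<^bsub>V\<^esub>l\<in>{..<d}. ?b l (?a l m (vs ! m))) = ?m m (vs ! m)" ..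
      qed (use mK in auto)
      finally show "act (a \<otimes>\<^bsub>B\<^esub> b) (vs ! j) = comb ?m" .
    qed (use mK ij in auto)
    then show "matrep (a \<otimes>\<^bsub>B\<^esub> b) (i, j) = (matrep a \<otimes>\<^bsub>matrix_ring Kring d\<^esub> matrep b) (i, j)"
      unfolding K.mat_ops(2)[OF ij] e[OF ij]
      by simp (rule K.finsum_cong', use ij k K_ops in \<open>auto simp: e\<close>)
  qed (use ab c in \<open>auto intro!: K.mat_closed\<close>)
  show "matrep \<one>\<^bsub>B\<^esub> = \<one>\<^bsub>matrix_ring Kring d\<^esub>"
  proof (rule K.mat_eqI)
    fix i j assume ij: "i < d" "j < d"
    let ?\<kappa> = "\<lambda>i. if i = j then \<one>\<^bsub>End\<^esub> else \<zero>\<^bsub>End\<^esub>"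
    have "coord (act \<one>\<^bsub>B\<^esub> (vs ! j)) i = ?\<kappa> i"
    proof (rule coord_eqI)
      have "comb ?\<kappa> = ?\<kappa> j (vs ! j)"
        by (rule V.finsum_eq_single) (use ij in \<open>auto simp: V.end_ops\<close>)
      then show "act \<one>\<^bsub>B\<^esub> (vs ! j) = comb ?\<kappa>" using ij by (simp add: one_act V.end_ops)
    qed (use ij K_zero_one in auto)
    then show "matrep \<one>\<^bsub>B\<^esub> (i, j) = \<one>\<^bsub>matrix_ring Kring d\<^esub> (i, j)"
      using ij by (simp add: e K.mat_ops)
  qed (use c in \<open>auto intro!: K.mat_closed\<close>)
qed

lemma matrep_kernel:
  assumes b: "b \<in> carrier B" and z: "matrep b = \<zero>\<^bsub>matrix_ring Kring d\<^esub>" and v: "v \<in> carrier V"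
  shows "act b v = \<zero>\<^bsub>V\<^esub>"
proof -
  have vb: "act b (vs ! j) = \<zero>\<^bsub>V\<^esub>" if j: "j < d" for j
  proof -
    have "coord (act b (vs ! j)) i = \<zero>\<^bsub>End\<^esub>" if "i < d" for i
      using fun_cong[OF z, of "(i, j)"] K.mat_ops(3)[OF that j] that j by (simp add: matrep_def)
    then have "comb (coord (act b (vs ! j))) = \<zero>\<^bsub>V\<^esub>"
      by (intro V.finsum_eq_zero) (auto simp: V.end_ops)
    then show ?thesis using coord(2)[of "act b (vs ! j)"] b j by (simp add: act_closed)
  qed
  have "act b v = rep b (comb (coord v))" using coord(2)[OF v] v by simp
  also have "\<dots> = (\<Oplus>\<^bsub>V\<^esub>l\<in>{..<d}. rep b (coord v l (vs ! l)))"
    by (rule finsum_additive)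
      (use V.abelian_monoid_axioms coord(1)[OF v] rep_closed[OF b] in \<open>auto simp: act_closed act_zero act_add b\<close>)
  also have "\<dots> = \<zero>\<^bsub>V\<^esub>"
    by (rule V.finsum_eq_zero) (use vb b coord(1)[OF v] V.end_zero[OF K_End] in \<open>auto simp: K_act[symmetric]\<close>)
  finally show ?thesis .
qed

text \<open>With the second arguments chosen as below, deleting a first argument other than the one at
  hand kills \<open>v\<^sub>0\<close>.\<close>

lemma capelli_units:
  assumes "distinct ps" "set ps \<subseteq> {..<d} \<times> {..<d}"
  shows "capelli Alg (map unit ps) (map (\<lambda>(i, j). (unit (0, i), unit (j, 0))) ps) (vs ! 0) = vs ! 0"
  using assms
proof (induction ps)
  case Nil
  then show ?case using nonempty by (simp add: V.end_ops)
next
  case (Cons p ps)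
  obtain i j where p: "p = (i, j)" by (cases p)
  have ij: "i < d" "j < d" using Cons.prems p by auto
  let ?xys = "map (\<lambda>(i, j). (unit (0, i), unit (j, 0))) ps" and ?as = "map unit (p # ps)"
  have U: "unit q \<in> alg" if "fst q < d" for q using unit(1) that by blast
  have as: "set ?as \<subseteq> carrier Alg" using Cons.prems U by auto
  have xys: "set ?xys \<subseteq> carrier Alg \<times> carrier Alg" using Cons.prems U nonempty by auto
  let ?t = "\<lambda>l. capelli Alg (remove_nth l ?as) ?xys \<otimes>\<^bsub>Alg\<^esub> (unit (0, i) \<otimes>\<^bsub>Alg\<^esub> ?as ! l \<otimes>\<^bsub>Alg\<^esub> unit (j, 0))"
  let ?f = "\<lambda>l. add_pow Alg ((-1) ^ l :: int) (?t l)"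
  have t: "?t l \<in> alg" if "l < length ?as" for l
    using A.capelli_term_closed[OF as xys, of "unit (0, i)" "unit (j, 0)" l] that U nonempty ij by simp
  let ?v = "vs ! 0"
  have v: "?v \<in> carrier V" using nonempty by simp
  have ev: "(\<lambda>e. e ?v) \<in> carrier Alg \<rightarrow> carrier V" "\<zero>\<^bsub>Alg\<^esub> ?v = \<zero>\<^bsub>V\<^esub>"
    "\<And>e f. (e \<oplus>\<^bsub>Alg\<^esub> f) ?v = e ?v \<oplus>\<^bsub>V\<^esub> f ?v"
    using v V.end_closed alg_End by (auto simp: V.end_ops)
  have tv: "?t l ?v = (if l = 0 then ?v else \<zero>\<^bsub>V\<^esub>)" if l: "l < length ?as" for l
  proof -
    obtain i' j' where q: "(p # ps) ! l = (i', j')" by (cases "(p # ps) ! l")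
    have "(p # ps) ! l \<in> set (p # ps)" using l by (intro nth_mem) simp
    then have "(i', j') \<in> {..<d} \<times> {..<d}" using Cons.prems(2) q by (metis subsetD)
    then have ij': "i' < d" "j' < d" by auto
    have c: "capelli Alg (remove_nth l ?as) ?xys \<in> carrier End"
      using A.capelli_closed[OF set_remove_nth_subset[OF as] xys] alg_End by simp
    have asl: "?as ! l = unit (i', j')" using l q by (metis length_map nth_map)
    have "(unit (0, i) \<otimes>\<^bsub>Alg\<^esub> ?as ! l \<otimes>\<^bsub>Alg\<^esub> unit (j, 0)) ?v = unit (0, i) (unit (i', j') (unit (j, 0) ?v))"
      using v unit_End[of "(j, 0)"] ij unfolding asl by (simp add: V.end_ops V.end_closed)
    also have "\<dots> = (if j' = j \<and> i' = i then ?v else \<zero>\<^bsub>V\<^esub>)"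
      using unit(2)[of "(j, 0)" 0] unit(2)[of "(i', j')" j] unit(2)[of "(0, i)" i'] ij ij' nonempty
        V.end_zero[OF unit_End[of "(0, i)"]] by auto
    finally have m: "(unit (0, i) \<otimes>\<^bsub>Alg\<^esub> ?as ! l \<otimes>\<^bsub>Alg\<^esub> unit (j, 0)) ?v = (if (i', j') = p then ?v else \<zero>\<^bsub>V\<^esub>)"
      using p by auto
    have "(i', j') = p \<longleftrightarrow> l = 0"
      using Cons.prems(1) l q nth_eq_iff_index_eq[of "p # ps" l 0] by auto
    then have "?t l ?v = capelli Alg (remove_nth l ?as) ?xys (if l = 0 then ?v else \<zero>\<^bsub>V\<^esub>)"
      using m v by (simp add: V.end_ops)
    then show ?thesis using Cons c by (auto simp: V.end_zero)
  qed
  have "capelli Alg ?as (map (\<lambda>(i, j). (unit (0, i), unit (j, 0))) (p # ps)) ?v = finsum Alg ?f {..<length ?as} ?v"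
    by (simp add: p)
  also have "\<dots> = (\<Oplus>\<^bsub>V\<^esub>l\<in>{..<length ?as}. ?f l ?v)"
    by (rule finsum_additive[where h = "\<lambda>e. e ?v"])
      (use ev A.abelian_monoid_axioms V.abelian_monoid_axioms t A.int_multiple_closed in auto)
  also have "\<dots> = ?f 0 ?v"
  proof (rule V.finsum_eq_single)
    fix l assume l: "l \<in> {..<length ?as}" "l \<noteq> 0"
    have "?t l \<in> carrier Alg" using t[of l] l(1) by simp
    then have "?f l ?v = add_pow V ((-1) ^ l :: int) (?t l ?v)"
      by (rule additive_int_multiple[of Alg V "\<lambda>e. e ?v", OF A.abelian_group_axioms V.abelian_group_axioms ev(1) ev(3)])
    also have "?t l ?v = \<zero>\<^bsub>V\<^esub>" using tv[of l] l by simp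
    finally show "?f l ?v = \<zero>\<^bsub>V\<^esub>" by simp
  next
    show "(\<lambda>l. ?f l ?v) \<in> {..<length ?as} \<rightarrow> carrier V"
      using t A.int_multiple_closed ev(1) by auto
  qed auto
  also have "\<dots> = ?t 0 ?v" using A.add.int_pow_1 t[of 0] by simp
  finally show ?case using tv[of 0] by simp
qed

text \<open>An identity of \<open>B\<close> would pass to \<open>Alg\<close>, where the
  \<open>d * d\<close> matrix units yield a value fixing the nonzero vector
  \<open>vs ! 0\<close>.\<close>

lemma not_capelli_identity: "\<not> capelli_identity B (d * d)"
proof
  assume id: "capelli_identity B (d * d)"
  obtain ps where ps: "distinct ps" "set ps = {..<d} \<times> {..<d}"
    using finite_distinct_list[of "{..<d} \<times> {..<d}"] by auto
  have len: "length ps = d * d" using distinct_card[OF ps(1)] ps(2) by simp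
  have "capelli_identity Alg (d * d)"
    by (rule capelli_identity_central_extension[OF B.ring_axioms Alg_ring rep_hom_Alg _ id]) (use alg_span in simp)
  then have "capelli Alg (map unit ps) (map (\<lambda>(i, j). (unit (0, i), unit (j, 0))) ps) = \<zero>\<^bsub>Alg\<^esub>"
    by (rule capelli_identityD) (use unit(1) ps(2) nonempty len in force)+
  then have "vs ! 0 = \<zero>\<^bsub>V\<^esub>" using capelli_units[OF ps(1)] ps(2) nonempty by (simp add: V.end_ops)
  then show False using vs_nonzero nonempty by blast
qed

end

text \<open>The two conclusions about \<open>k\<close> work against each other. A Capelli value that
  survives under \<open>\<phi>\<close> has at most \<open>k * k\<close> alternating arguments, while
  the Capelli polynomial with \<open>k * k\<close> of them is not an identity of
  \<open>B\<close>.\<close>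

theorem irreducible_action_matrix_rep:
  fixes B :: "('b, 'm) ring_scheme" and V :: "('v, 'k) ring_scheme"
  assumes "irreducible_action B V act" and id: "ml_identity B N c"
  shows "\<exists>k (K :: ('v \<Rightarrow> 'v) ring) \<phi>. 0 < k \<and> k \<le> N \<and> cring K \<and> \<phi> \<in> ring_hom B (matrix_ring K k) \<and>
    (\<forall>b\<in>carrier B. \<phi> b = \<zero>\<^bsub>matrix_ring K k\<^esub> \<longrightarrow> (\<forall>v\<in>carrier V. act b v = \<zero>\<^bsub>V\<^esub>)) \<and>
    \<not> capelli_identity B (k * k)"
proof -
  interpret irreducible_action B V act by fact
  obtain K where "max_commuting K" using ex_max_commuting by blast
  then interpret irreducible_action_field B V act K by unfold_locales
  have "ml_identity Alg N c"
    by (rule ml_identity_central_extension[OF B.ring_axioms Alg_ring rep_hom_Alg _ id]) (use alg_span in simp)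
  then obtain vs where vs: "set vs \<subseteq> carrier V" "indep vs" "length vs \<le> N" "carrier V \<subseteq> kspan vs" "0 < length vs"
    by (rule ex_basis)
  note len = vs(3)
  interpret irreducible_action_basis B V act K vs by unfold_locales (use vs in auto)
  show ?thesis
    by (intro exI[of _ d] exI[of _ Kring] exI[of _ matrep] conjI nonempty len K_cring matrep_hom not_capelli_identity
        ballI impI) (rule matrep_kernel)
qed

subsection \<open>Simple modules\<close>

context ring
begin

text \<open>Maximality elementwise: adding any \<open>x\<close> from outside produces 1. Multiplied
  by an arbitrary element, such an equation shows that the class of \<open>x\<close> generates the
  quotient module.\<close>

definition max_left_ideal :: "'a set \<Rightarrow> bool" where
  "max_left_ideal L \<longleftrightarrow> left_ideal L \<and> \<one> \<notin> L \<and> (\<forall>x\<in>carrier R - L. \<exists>r\<in>carrier R. \<exists>l\<in>L. r \<otimes> x \<oplus> l = \<one>)"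

lemma left_ideal_adjoin:
  assumes L: "left_ideal L" and x: "x \<in> carrier R"
  shows "left_ideal {r \<otimes> x \<oplus> l |r l. r \<in> carrier R \<and> l \<in> L}" (is "left_ideal ?M")
    and "L \<subseteq> {r \<otimes> x \<oplus> l |r l. r \<in> carrier R \<and> l \<in> L}" "x \<in> {r \<otimes> x \<oplus> l |r l. r \<in> carrier R \<and> l \<in> L}"
proof -
  note D = left_idealD[OF L]
  show "left_ideal ?M"
    unfolding left_ideal_def
  proof (intro conjI ballI)
    show "?M \<subseteq> carrier R" using D x by auto
    have "\<zero> = \<zero> \<otimes> x \<oplus> \<zero>" using x by simp
    then show "\<zero> \<in> ?M" using D(2) by blast
    fix u assume "u \<in> ?M"
    then obtain r l where u: "u = r \<otimes> x \<oplus> l" "r \<in> carrier R" "l \<in> L" by blast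
    note lc = D(1)[OF u(3)]
    { fix v assume "v \<in> ?M"
      then obtain s m where v: "v = s \<otimes> x \<oplus> m" "s \<in> carrier R" "m \<in> L" by blast
      note mc = D(1)[OF v(3)]
      have "u \<oplus> v = (r \<oplus> s) \<otimes> x \<oplus> (l \<oplus> m)" using u v x lc mc by (simp add: l_distr a_ac)
      then show "u \<oplus> v \<in> ?M" using u v D(3) by blast }
    { fix s assume s: "s \<in> carrier R"
      have "s \<otimes> u = (s \<otimes> r) \<otimes> x \<oplus> s \<otimes> l" using u s x lc by (simp add: r_distr m_assoc)
      then show "s \<otimes> u \<in> ?M" using u s D(4) by blast }
  qed
  show "L \<subseteq> ?M"
  proof
    fix l assume "l \<in> L"
    moreover from this have "l = \<zero> \<otimes> x \<oplus> l" using x D(1) by simp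
    ultimately show "l \<in> ?M" by blast
  qed
  have "x = \<one> \<otimes> x \<oplus> \<zero>" using x by simp
  then show "x \<in> ?M" using D(2) by blast
qed

lemma ex_max_left_ideal:
  assumes L0: "left_ideal L0" "\<one> \<notin> L0"
  obtains L where "max_left_ideal L" "L0 \<subseteq> L"
proof -
  define A where "A = {L. left_ideal L \<and> \<one> \<notin> L \<and> L0 \<subseteq> L}"
  have "\<exists>M\<in>A. \<forall>N\<in>A. M \<subseteq> N \<longrightarrow> N = M"
  proof (rule subset_Zorn_nonempty)
    show "A \<noteq> {}" using L0 by (auto simp: A_def)
    fix \<C> assume C: "\<C> \<noteq> {}" "subset.chain A \<C>"
    have CA: "left_ideal L" "\<one> \<notin> L" "L0 \<subseteq> L" if "L \<in> \<C>" for L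
      using C(2) that unfolding subset_chain_def A_def by blast+
    have "left_ideal (\<Union>\<C>)"
      unfolding left_ideal_def
    proof (intro conjI ballI)
      show "\<Union>\<C> \<subseteq> carrier R" using CA(1) left_idealD(1) by blast
      show "\<zero> \<in> \<Union>\<C>" using C(1) CA(1) left_idealD(2) by blast
      show "u \<oplus> v \<in> \<Union>\<C>" if uv: "u \<in> \<Union>\<C>" "v \<in> \<Union>\<C>" for u v
      proof -
        obtain M N where MN: "M \<in> \<C>" "N \<in> \<C>" "u \<in> M" "v \<in> N" using uv by blast
        then have "M \<subseteq> N \<or> N \<subseteq> M" using C(2) unfolding subset_chain_def by blast
        then obtain Z where "Z \<in> \<C>" "u \<in> Z" "v \<in> Z" using MN by blast
        then show ?thesis using CA(1) left_idealD(3) by blast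
      qed
      show "r \<otimes> u \<in> \<Union>\<C>" if "r \<in> carrier R" "u \<in> \<Union>\<C>" for r u
        using that CA(1) left_idealD(4) by blast
    qed
    then show "\<Union>\<C> \<in> A" using C(1) CA unfolding A_def by blast
  qed
  then obtain L where L: "L \<in> A" "\<And>N. N \<in> A \<Longrightarrow> L \<subseteq> N \<Longrightarrow> N = L" by blast
  have "max_left_ideal L"
    unfolding max_left_ideal_def
  proof (intro conjI ballI)
    show "left_ideal L" "\<one> \<notin> L" using L(1) by (auto simp: A_def)
    fix x assume x: "x \<in> carrier R - L"
    let ?M = "{r \<otimes> x \<oplus> l |r l. r \<in> carrier R \<and> l \<in> L}"
    have M: "left_ideal ?M" "L \<subseteq> ?M" "x \<in> ?M" using left_ideal_adjoin[of L x] L(1) x by (auto simp: A_def)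
    have "\<one> \<in> ?M"
    proof (rule ccontr)
      assume "\<one> \<notin> ?M"
      then have "?M \<in> A" using M(1,2) L(1) unfolding A_def by blast
      then have "?M = L" using M(2) by (rule L(2))
      then show False using M(3) x by blast
    qed
    then obtain r l where "r \<in> carrier R" "l \<in> L" "\<one> = r \<otimes> x \<oplus> l" by blast
    then show "\<exists>r\<in>carrier R. \<exists>l\<in>L. r \<otimes> x \<oplus> l = \<one>" by metis
  qed
  then show thesis using that L(1) by (auto simp: A_def)
qed

text \<open>The additive group \<open>R / L\<close>, given as a ring record because
  \<open>abelian_group\<close> is a predicate on such records.\<close>

definition quotient_module :: "'a set \<Rightarrow> 'a set ring" where
  "quotient_module L = \<lparr>carrier = a_rcosets L, monoid.mult = set_add R, monoid.one = L, ring.zero = L, ring.add = set_add R\<rparr>"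

text \<open>The union over all representatives avoids choosing one. Since \<open>L\<close> is a left
  ideal, each of them contributes the same coset.\<close>

definition quotient_act :: "'a set \<Rightarrow> 'a \<Rightarrow> 'a set \<Rightarrow> 'a set" where
  "quotient_act L b S = (\<Union>x\<in>S. L +> (b \<otimes> x))"

lemma left_ideal_abelian_subgroup:
  assumes "left_ideal L" shows "abelian_subgroup L R"
proof (rule abelian_subgroupI3)
  have "subgroup L (add_monoid R)"
    by (rule add.subgroupI)
      (use left_idealD[OF assms] left_ideal_uminus[OF assms] in \<open>auto simp: a_inv_def\<close>)
  then show "additive_subgroup L R" by (rule additive_subgroup.intro)
qed (rule abelian_group_axioms)

lemma quotient_module_irreducible:
  assumes max: "max_left_ideal L"
  shows "irreducible_action R (quotient_module L) (quotient_act L)"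
    and "\<And>x b. x \<in> carrier R \<Longrightarrow> b \<in> carrier R \<Longrightarrow> quotient_act L b (L +> x) = L +> (b \<otimes> x)"
    and "\<And>x. x \<in> carrier R \<Longrightarrow> L +> x \<in> carrier (quotient_module L)"
    and "\<And>x. x \<in> carrier R \<Longrightarrow> L +> x = \<zero>\<^bsub>quotient_module L\<^esub> \<longleftrightarrow> x \<in> L"
proof -
  let ?V = "quotient_module L"
  have L: "left_ideal L" and one: "\<one> \<notin> L" using max by (auto simp: max_left_ideal_def)
  note D = left_idealD[OF L]
  interpret L: abelian_subgroup L R by (rule left_ideal_abelian_subgroup[OF L])
  have V: "carrier ?V = (\<lambda>x. L +> x) ` carrier R"
    by (auto simp: quotient_module_def A_RCOSETS_def')
  show mem: "L +> x \<in> carrier ?V" if "x \<in> carrier R" for x using that V by blast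
  have z: "\<zero>\<^bsub>?V\<^esub> = L" "\<zero>\<^bsub>?V\<^esub> = L +> \<zero>" using L.a_subset by (simp_all add: quotient_module_def a_coset_add_zero)
  have add: "(L +> x) \<oplus>\<^bsub>?V\<^esub> (L +> y) = L +> (x \<oplus> y)" if "x \<in> carrier R" "y \<in> carrier R" for x y
    using that L.a_rcos_sum by (simp add: quotient_module_def)
  have eq: "L +> x = L +> y" if "x \<in> carrier R" "l \<in> L" "y = l \<oplus> x" for x y l
    using L.a_repr_independence'[of y x] that by (auto simp: a_r_coset_def')
  show zero_iff: "L +> x = \<zero>\<^bsub>?V\<^esub> \<longleftrightarrow> x \<in> L" if x: "x \<in> carrier R" for x
  proof
    assume "L +> x = \<zero>\<^bsub>?V\<^esub>"
    moreover have "x \<in> L +> x" using L.a_rcos_self[OF x] .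
    ultimately show "x \<in> L" using z(1) by simp
  next
    assume "x \<in> L"
    then show "L +> x = \<zero>\<^bsub>?V\<^esub>" using eq[of \<zero> x x] x z(2) by simp
  qed
  show act: "quotient_act L b (L +> x) = L +> (b \<otimes> x)" if x: "x \<in> carrier R" and b: "b \<in> carrier R" for x b
  proof -
    have "L +> (b \<otimes> y) = L +> (b \<otimes> x)" if y: "y \<in> L +> x" for y
    proof -
      obtain l where l: "l \<in> L" "y = l \<oplus> x" using y by (auto simp: a_r_coset_def')
      then show ?thesis using eq[of "b \<otimes> x" "b \<otimes> l" "b \<otimes> y"] D(1)[OF l(1)] D(4)[OF b l(1)] b x by (simp add: r_distr)
    qed
    moreover have "x \<in> L +> x" using L.a_rcos_self[OF x] .
    ultimately show ?thesis unfolding quotient_act_def by blast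
  qed
  have Vgroup: "abelian_group ?V"
  proof (rule abelian_groupI)
    show "u \<oplus>\<^bsub>?V\<^esub> v \<in> carrier ?V" if "u \<in> carrier ?V" "v \<in> carrier ?V" for u v
      using that unfolding V by (auto simp: add)
    show "\<zero>\<^bsub>?V\<^esub> \<in> carrier ?V" unfolding V z(2) by blast
    show "u \<oplus>\<^bsub>?V\<^esub> v \<oplus>\<^bsub>?V\<^esub> w = u \<oplus>\<^bsub>?V\<^esub> (v \<oplus>\<^bsub>?V\<^esub> w)" if "u \<in> carrier ?V" "v \<in> carrier ?V" "w \<in> carrier ?V" for u v w
      using that unfolding V by (auto simp: add a_assoc)
    show "u \<oplus>\<^bsub>?V\<^esub> v = v \<oplus>\<^bsub>?V\<^esub> u" if "u \<in> carrier ?V" "v \<in> carrier ?V" for u v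
      using that unfolding V by (auto simp: add a_comm)
    show "\<zero>\<^bsub>?V\<^esub> \<oplus>\<^bsub>?V\<^esub> u = u" if "u \<in> carrier ?V" for u
      using that unfolding V z(2) by (auto simp: add)
    show "\<exists>v\<in>carrier ?V. v \<oplus>\<^bsub>?V\<^esub> u = \<zero>\<^bsub>?V\<^esub>" if "u \<in> carrier ?V" for u
    proof -
      obtain x where "x \<in> carrier R" "u = L +> x" using \<open>u \<in> _\<close> unfolding V by blast
      then show ?thesis by (intro bexI[of _ "L +> (\<ominus> x)"]) (auto simp: add l_neg z(2) V)
    qed
  qed
  show "irreducible_action R ?V (quotient_act L)"
  proof (intro irreducible_action.intro irreducible_action_axioms.intro ring_axioms Vgroup)
    show "quotient_act L b v \<in> carrier ?V" if "b \<in> carrier R" "v \<in> carrier ?V" for b v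
      using that unfolding V by (auto simp: act)
    show "quotient_act L b (u \<oplus>\<^bsub>?V\<^esub> v) = quotient_act L b u \<oplus>\<^bsub>?V\<^esub> quotient_act L b v"
      if "b \<in> carrier R" "u \<in> carrier ?V" "v \<in> carrier ?V" for b u v
      using that unfolding V by (auto simp: act add r_distr)
    show "quotient_act L (a \<oplus> b) v = quotient_act L a v \<oplus>\<^bsub>?V\<^esub> quotient_act L b v"
      if "a \<in> carrier R" "b \<in> carrier R" "v \<in> carrier ?V" for a b v
      using that unfolding V by (auto simp: act add l_distr)
    show "quotient_act L (a \<otimes> b) v = quotient_act L a (quotient_act L b v)"
      if "a \<in> carrier R" "b \<in> carrier R" "v \<in> carrier ?V" for a b v
      using that unfolding V by (auto simp: act m_assoc)
    show "quotient_act L \<one> v = v" if "v \<in> carrier ?V" for v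
      using that unfolding V by (auto simp: act)
    show "\<exists>b\<in>carrier R. quotient_act L b v = u" if uv: "u \<in> carrier ?V" "v \<in> carrier ?V" "v \<noteq> \<zero>\<^bsub>?V\<^esub>" for u v
    proof -
      obtain x y where xy: "x \<in> carrier R" "v = L +> x" "y \<in> carrier R" "u = L +> y" using uv unfolding V by blast
      then have "x \<in> carrier R - L" using uv zero_iff by blast
      then obtain r l where r: "r \<in> carrier R" "l \<in> L" "r \<otimes> x \<oplus> l = \<one>"
        using max unfolding max_left_ideal_def by blast
      note lc = D(1)[OF r(2)]
      have "y = y \<otimes> (r \<otimes> x \<oplus> l)" using xy r by simp
      also have "\<dots> = y \<otimes> l \<oplus> y \<otimes> r \<otimes> x" using xy r(1) lc by (simp add: r_distr m_assoc a_comm)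
      finally have "L +> (y \<otimes> r \<otimes> x) = L +> y"
        using eq[of "y \<otimes> r \<otimes> x" "y \<otimes> l" y] xy r D(4) by simp
      then show ?thesis using act[of x "y \<otimes> r"] xy r by (intro bexI[of _ "y \<otimes> r"]) auto
    qed
    show "carrier ?V \<noteq> {\<zero>\<^bsub>?V\<^esub>}" using zero_iff[of \<one>] one mem[of \<one>] by auto
  qed
qed

end

subsection \<open>Adjoining a central variable\<close>

context UP_ring
begin

lemma const_hom: "(\<lambda>a. up_ring.monom P a 0) \<in> ring_hom R P"
  by (rule ring_hom_memI) (simp_all add: monom_mult[of _ _ 0 0, simplified])

lemma monom_commute: "p \<in> carrier P \<Longrightarrow> up_ring.monom P \<one> n \<otimes>\<^bsub>P\<^esub> p = p \<otimes>\<^bsub>P\<^esub> up_ring.monom P \<one> n"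
proof -
  assume p: "p \<in> carrier P"
  let ?f = "\<lambda>i. up_ring.monom P (up_ring.coeff P p i) i"
  have "up_ring.monom P \<one> n \<otimes>\<^bsub>P\<^esub> finsum P ?f {..deg R p} = (\<Oplus>\<^bsub>P\<^esub>i\<in>{..deg R p}. up_ring.monom P \<one> n \<otimes>\<^bsub>P\<^esub> ?f i)"
    using p by (intro P.finsum_rdistr) auto
  also have "\<dots> = (\<Oplus>\<^bsub>P\<^esub>i\<in>{..deg R p}. ?f i \<otimes>\<^bsub>P\<^esub> up_ring.monom P \<one> n)"
    by (rule P.finsum_cong') (use p in \<open>auto simp: monom_mult[symmetric] add.commute\<close>)
  also have "\<dots> = finsum P ?f {..deg R p} \<otimes>\<^bsub>P\<^esub> up_ring.monom P \<one> n"
    using p by (intro P.finsum_ldistr[symmetric]) auto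
  finally show ?thesis using up_repr[OF p] by simp
qed

lemma UP_central_span: "carrier P \<subseteq> central_span P ((\<lambda>a. up_ring.monom P a 0) ` carrier R)"
proof
  fix p assume p: "p \<in> carrier P"
  let ?G = "(\<lambda>a. up_ring.monom P a 0) ` carrier R"
  have "(\<Oplus>\<^bsub>P\<^esub>i\<in>{..deg R p}. up_ring.monom P (up_ring.coeff P p i) i) \<in> central_span P ?G"
  proof (rule P.central_span_finsum)
    fix i
    have "up_ring.monom P \<one> i \<in> ring_center P" using monom_commute by (simp add: ring_center_def)
    then have "up_ring.monom P \<one> i \<otimes>\<^bsub>P\<^esub> up_ring.monom P (up_ring.coeff P p i) 0 \<in> central_span P ?G"
      using p by (intro central_span.scale) auto
    then show "up_ring.monom P (up_ring.coeff P p i) i \<in> central_span P ?G"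
      using p monom_mult[of \<one> "up_ring.coeff P p i" i 0] by simp
  qed auto
  then show "p \<in> central_span P ?G" using up_repr[OF p] by simp
qed

lemma coeff_mult_linear:
  assumes p: "p \<in> carrier P" and a: "a \<in> carrier R"
  shows "up_ring.coeff P (p \<otimes>\<^bsub>P\<^esub> up_ring.monom P a 1) 0 = \<zero>" "up_ring.coeff P (p \<otimes>\<^bsub>P\<^esub> up_ring.monom P a 1) (Suc n) = up_ring.coeff P p n \<otimes> a"
proof -
  show "up_ring.coeff P (p \<otimes>\<^bsub>P\<^esub> up_ring.monom P a 1) 0 = \<zero>" using p a by simp
  have "up_ring.coeff P (p \<otimes>\<^bsub>P\<^esub> up_ring.monom P a 1) (Suc n) = (\<Oplus>i\<in>{..Suc n}. up_ring.coeff P p i \<otimes> up_ring.coeff P (up_ring.monom P a 1) (Suc n - i))"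
    using p a by (simp del: coeff_monom)
  also have "\<dots> = up_ring.coeff P p n \<otimes> up_ring.coeff P (up_ring.monom P a 1) (Suc n - n)"
    by (rule R.finsum_eq_single) (use p a in auto)
  finally show "up_ring.coeff P (p \<otimes>\<^bsub>P\<^esub> up_ring.monom P a 1) (Suc n) = up_ring.coeff P p n \<otimes> a" using a by simp
qed

text \<open>The only possible left inverse of \<open>1 - a t\<close> is \<open>1 + a t + a\<^sup>2 t\<^sup>2 + \<dots>\<close>.\<close>

lemma left_inverse_imp_nilp:
  assumes p: "p \<in> carrier P" and a: "a \<in> carrier R" and inv: "p \<otimes>\<^bsub>P\<^esub> (\<one>\<^bsub>P\<^esub> \<ominus>\<^bsub>P\<^esub> up_ring.monom P a 1) = \<one>\<^bsub>P\<^esub>"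
  shows "R.nilp a"
proof -
  have "p = p \<otimes>\<^bsub>P\<^esub> (\<one>\<^bsub>P\<^esub> \<ominus>\<^bsub>P\<^esub> up_ring.monom P a 1) \<oplus>\<^bsub>P\<^esub> p \<otimes>\<^bsub>P\<^esub> up_ring.monom P a 1"
    using p a by (simp add: P.minus_eq P.r_distr[symmetric] P.a_assoc P.l_neg)
  also have "\<dots> = \<one>\<^bsub>P\<^esub> \<oplus>\<^bsub>P\<^esub> p \<otimes>\<^bsub>P\<^esub> up_ring.monom P a 1" by (simp only: inv)
  finally have eq: "up_ring.coeff P p n = up_ring.coeff P \<one>\<^bsub>P\<^esub> n \<oplus> up_ring.coeff P (p \<otimes>\<^bsub>P\<^esub> up_ring.monom P a 1) n" for n
    using p a by (metis P.m_closed P.one_closed coeff_add monom_closed)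
  have pow: "up_ring.coeff P p n = a [^] n" for n
  proof (induction n)
    case 0
    then show ?case using eq[of 0] coeff_mult_linear(1)[OF p a] by simp
  next
    case (Suc n)
    then show ?case using eq[of "Suc n"] coeff_mult_linear(2)[OF p a, of n] p a by simp
  qed
  have "up_ring.coeff P p (Suc (deg R p)) = \<zero>" using p by (intro deg_aboveD) auto
  then show ?thesis using pow unfolding R.nilp_def by metis
qed

end

text \<open>Modulo a left ideal containing \<open>1 - a t\<close>, the class of \<open>a t\<close>
  is that of 1, so \<open>a\<close> acts nontrivially on the class of \<open>t\<close>. The type of
  \<open>K\<close> records the construction: polynomials are functions on \<open>nat\<close>,
  vectors are sets of them, scalars are maps between vectors.\<close>

theorem (in ring) matrix_rep_of_non_nilpotent:
  assumes id: "ml_identity R N c" and a: "a \<in> carrier R" "\<not> nilp a"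
  shows "\<exists>k (K :: ((nat \<Rightarrow> 'a) set \<Rightarrow> (nat \<Rightarrow> 'a) set) ring) \<phi>. 0 < k \<and> k \<le> N \<and> cring K \<and>
    \<phi> \<in> ring_hom R (matrix_ring K k) \<and> \<phi> a \<noteq> \<zero>\<^bsub>matrix_ring K k\<^esub> \<and> \<not> capelli_identity R (k * k)"
proof -
  note R_ring = ring_axioms
  define P where "P = UP R"
  interpret UP_ring R P by unfold_locales (simp add: P_def)
  let ?\<iota> = "\<lambda>a. up_ring.monom P a 0" and ?u = "\<one>\<^bsub>P\<^esub> \<ominus>\<^bsub>P\<^esub> up_ring.monom P a 1"
  have u: "?u \<in> carrier P" using a by simp
  have Pid: "ml_identity P N c"
    by (rule ml_identity_central_extension[OF R_ring P.ring_axioms const_hom UP_central_span id])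
  let ?L0 = "(\<lambda>p. p \<otimes>\<^bsub>P\<^esub> ?u) ` carrier P"
  have "P.left_ideal (carrier P)" by (simp add: P.left_ideal_def)
  then have L0: "P.left_ideal ?L0" using u by (rule P.left_ideal_rmult)
  have "\<one>\<^bsub>P\<^esub> \<notin> ?L0" using left_inverse_imp_nilp[OF _ a(1)] a(2) by force
  then obtain L where L: "P.max_left_ideal L" "?L0 \<subseteq> L" using P.ex_max_left_ideal[OF L0] by blast
  note Q = P.quotient_module_irreducible[OF L(1)]
  let ?V = "P.quotient_module L" and ?act = "P.quotient_act L"
  obtain k and K :: "((nat \<Rightarrow> 'a) set \<Rightarrow> (nat \<Rightarrow> 'a) set) ring" and \<phi> where
    k: "0 < k" "k \<le> N" and K: "cring K" and \<phi>: "\<phi> \<in> ring_hom P (matrix_ring K k)"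
    and ker: "\<And>b v. b \<in> carrier P \<Longrightarrow> \<phi> b = \<zero>\<^bsub>matrix_ring K k\<^esub> \<Longrightarrow> v \<in> carrier ?V \<Longrightarrow> ?act b v = \<zero>\<^bsub>?V\<^esub>"
    and cap: "\<not> capelli_identity P (k * k)"
    using irreducible_action_matrix_rep[OF Q(1) Pid] by (elim exE conjE) blast
  have "\<phi> (?\<iota> a) \<noteq> \<zero>\<^bsub>matrix_ring K k\<^esub>"
  proof
    let ?t = "up_ring.monom P \<one> 1"
    assume "\<phi> (?\<iota> a) = \<zero>\<^bsub>matrix_ring K k\<^esub>"
    then have "?act (?\<iota> a) (L +>\<^bsub>P\<^esub> ?t) = \<zero>\<^bsub>?V\<^esub>" using a Q(3) by (intro ker) auto
    then have "?\<iota> a \<otimes>\<^bsub>P\<^esub> ?t \<in> L" using Q(2)[of ?t "?\<iota> a"] Q(4)[of "?\<iota> a \<otimes>\<^bsub>P\<^esub> ?t"] a by simp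
    then have "up_ring.monom P a 1 \<in> L" using monom_mult[of a \<one> 0 1] a by simp
    moreover have "\<one>\<^bsub>P\<^esub> \<otimes>\<^bsub>P\<^esub> ?u \<in> L" using L(2) P.one_closed by blast
    then have "?u \<in> L" using u by simp
    ultimately have "?u \<oplus>\<^bsub>P\<^esub> up_ring.monom P a 1 \<in> L"
      using L(1) P.left_idealD(3) unfolding P.max_left_ideal_def by blast
    moreover have "?u \<oplus>\<^bsub>P\<^esub> up_ring.monom P a 1 = \<one>\<^bsub>P\<^esub>"
      using a by (simp add: P.minus_eq P.a_assoc P.l_neg)
    ultimately show False using L(1) unfolding P.max_left_ideal_def by simp
  qed
  moreover have "\<phi> \<circ> ?\<iota> \<in> ring_hom R (matrix_ring K k)"
    using ring_hom_trans[OF const_hom \<phi>] by simp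
  moreover have "\<not> capelli_identity R (k * k)"
    using cap capelli_identity_central_extension[OF R_ring P.ring_axioms const_hom UP_central_span] by blast
  ultimately show ?thesis using k K by (intro exI[of _ k] exI[of _ K] exI[of _ "\<phi> \<circ> ?\<iota>"]) simp
qed

subsection \<open>Prime PI-rings\<close>

lemma (in ring) capelli_identity_Suc:
  assumes "capelli_identity R m" shows "capelli_identity R (Suc m)"
  unfolding capelli_identity_def
proof (intro allI impI)
  fix as xys assume a: "set as \<subseteq> carrier R" "set xys \<subseteq> carrier R \<times> carrier R" "length as = Suc m" "length xys = Suc m"
  then obtain x y zs where xys: "xys = (x, y) # zs" by (metis length_Suc_conv surj_pair)
  have "capelli R (remove_nth j as) zs = \<zero>" if "j < length as" for j
    using a xys that set_remove_nth[of j as] by (intro capelli_identityD[OF assms]) auto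
  moreover have "as ! j \<in> carrier R" if "j < length as" for j using a that by auto
  ultimately show "capelli R as xys = \<zero>"
    using a xys by (auto intro!: finsum_eq_zero)
qed

lemma (in ring) capelli_identity_mono:
  assumes "capelli_identity R m" "m \<le> n" shows "capelli_identity R n"
  using assms(2,1) by (induction rule: dec_induct) (auto intro: capelli_identity_Suc)

text \<open>The representations detect non-nilpotent elements only. This supplies one from any
  nonzero \<open>b\<close>: the left ideal \<open>R b\<close> is nonzero, hence not nil.\<close>

lemma (in ring) non_nilpotent_multiple:
  assumes prime: "nc_prime_ideal {\<zero>} R" and id: "ml_identity R N c" and b: "b \<in> carrier R" "b \<noteq> \<zero>"
  obtains r where "r \<in> carrier R" "\<not> nilp (r \<otimes> b)"
proof -
  have "left_ideal (carrier R)" by (simp add: left_ideal_def)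
  then have "left_ideal ((\<lambda>z. z \<otimes> b) ` carrier R)" using b by (intro left_ideal_rmult)
  moreover have "(\<lambda>z. z \<otimes> b) ` carrier R \<noteq> {\<zero>}"
    using b by (metis imageI l_one one_closed singletonD)
  ultimately show thesis using nil_left_ideal_trivial[OF prime id] that by blast
qed

lemma not_zero_of_mult_hom:
  assumes R: "ring R" and S: "ring S" and h: "h \<in> ring_hom R S"
    and "r \<in> carrier R" "b \<in> carrier R" "h (r \<otimes>\<^bsub>R\<^esub> b) \<noteq> \<zero>\<^bsub>S\<^esub>"
  shows "h b \<noteq> \<zero>\<^bsub>S\<^esub>"
proof
  assume "h b = \<zero>\<^bsub>S\<^esub>"
  then have "h (r \<otimes>\<^bsub>R\<^esub> b) = h r \<otimes>\<^bsub>S\<^esub> \<zero>\<^bsub>S\<^esub>" using ring_hom_mult[OF h] assms by simp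
  also have "\<dots> = \<zero>\<^bsub>S\<^esub>" using ring.ring_simprules(27)[OF S] ring_hom_closed[OF h] assms(4) ring.is_abelian_group S
    by (simp add: ring.ring_simprules)
  finally show False using assms by simp
qed

text \<open>A nonzero value with \<open>m\<close> alternating arguments survives in some matrix
  representation of size \<open>k\<close>, after passing to a non-nilpotent left multiple. This
  forces \<open>m \<le> k * k\<close>, hence \<open>j \<le> k\<close>. The same representation shows
  that length \<open>k * k\<close>, and so also the smaller \<open>j * j\<close>, gives no
  identity.\<close>

lemma (in ring) capelli_rank_square:
  assumes prime: "nc_prime_ideal {\<zero>} R" and id: "ml_identity R N c"
    and m: "\<not> capelli_identity R m" and j: "\<And>k. m \<le> k * k \<Longrightarrow> j \<le> k"
  shows "\<not> capelli_identity R (j * j)"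
proof -
  obtain as xys where a: "set as \<subseteq> carrier R" "set xys \<subseteq> carrier R \<times> carrier R" "length as = m" "length xys = m"
    and nz: "capelli R as xys \<noteq> \<zero>"
    using m unfolding capelli_identity_def by blast
  let ?b = "capelli R as xys"
  have b: "?b \<in> carrier R" using capelli_closed a by simp
  obtain r where r: "r \<in> carrier R" "\<not> nilp (r \<otimes> ?b)"
    using non_nilpotent_multiple[OF prime id b nz] by blast
  then have rb: "r \<otimes> ?b \<in> carrier R" using b by simp
  obtain k and K :: "((nat \<Rightarrow> 'a) set \<Rightarrow> (nat \<Rightarrow> 'a) set) ring" and \<phi> where
    K: "cring K" and \<phi>: "\<phi> \<in> ring_hom R (matrix_ring K k)"
    and ne: "\<phi> (r \<otimes> ?b) \<noteq> \<zero>\<^bsub>matrix_ring K k\<^esub>" and cap: "\<not> capelli_identity R (k * k)"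
    using matrix_rep_of_non_nilpotent[OF id rb r(2)] by (elim exE conjE) blast
  interpret K: cring K by fact
  have M: "ring (matrix_ring K k)" by (rule K.matrix_ring_ring)
  have "\<phi> ?b \<noteq> \<zero>\<^bsub>matrix_ring K k\<^esub>"
    by (rule not_zero_of_mult_hom[OF ring_axioms M \<phi> r(1) b ne])
  then have nz': "capelli (matrix_ring K k) (map \<phi> as) (map (\<lambda>(x, y). (\<phi> x, \<phi> y)) xys) \<noteq> \<zero>\<^bsub>matrix_ring K k\<^esub>"
    using capelli_hom[OF ring_axioms M \<phi> a(1,2)] by simp
  have "m \<le> k * k"
  proof (rule ccontr)
    assume "\<not> m \<le> k * k"
    then have "capelli (matrix_ring K k) (map \<phi> as) (map (\<lambda>(x, y). (\<phi> x, \<phi> y)) xys) = \<zero>\<^bsub>matrix_ring K k\<^esub>"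
      using a ring_hom_closed[OF \<phi>] by (intro K.capelli_matrix_ring[of k m]) auto
    then show False using nz' by blast
  qed
  then have "j * j \<le> k * k" using j mult_le_mono by blast
  then show ?thesis using capelli_identity_mono cap by blast
qed

section \<open>Embedding in matrices over a single commutative ring\<close>

definition product_ring :: "'i set \<Rightarrow> ('i \<Rightarrow> 'k ring) \<Rightarrow> ('i \<Rightarrow> 'k) ring" where
  "product_ring I K =
     \<lparr>carrier = (\<Pi>\<^sub>E i\<in>I. carrier (K i)),
      monoid.mult = (\<lambda>f g. \<lambda>i\<in>I. f i \<otimes>\<^bsub>K i\<^esub> g i),
      monoid.one = (\<lambda>i\<in>I. \<one>\<^bsub>K i\<^esub>),
      ring.zero = (\<lambda>i\<in>I. \<zero>\<^bsub>K i\<^esub>),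
      ring.add = (\<lambda>f g. \<lambda>i\<in>I. f i \<oplus>\<^bsub>K i\<^esub> g i)\<rparr>"

lemma product_ring_eqI:
  "f \<in> carrier (product_ring I K) \<Longrightarrow> g \<in> carrier (product_ring I K) \<Longrightarrow> (\<And>i. i \<in> I \<Longrightarrow> f i = g i) \<Longrightarrow> f = g"
  by (rule PiE_ext[of f I "\<lambda>i. carrier (K i)" g]) (auto simp: product_ring_def)

lemma product_ring_cring:
  assumes K: "\<And>i. i \<in> I \<Longrightarrow> cring (K i)" shows "cring (product_ring I K)"
proof -
  let ?C = "product_ring I K"
  have rg: "ring (K i)" if "i \<in> I" for i using K[OF that] by (rule cring.axioms)
  have cl: "f i \<in> carrier (K i)" if "f \<in> carrier ?C" "i \<in> I" for f i
    using that by (auto simp: product_ring_def)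
  have ops: "(f \<oplus>\<^bsub>?C\<^esub> g) i = f i \<oplus>\<^bsub>K i\<^esub> g i" "(f \<otimes>\<^bsub>?C\<^esub> g) i = f i \<otimes>\<^bsub>K i\<^esub> g i"
    "\<zero>\<^bsub>?C\<^esub> i = \<zero>\<^bsub>K i\<^esub>" "\<one>\<^bsub>?C\<^esub> i = \<one>\<^bsub>K i\<^esub>" if "i \<in> I" for f g i
    using that by (simp_all add: product_ring_def)
  have closed: "f \<oplus>\<^bsub>?C\<^esub> g \<in> carrier ?C" "f \<otimes>\<^bsub>?C\<^esub> g \<in> carrier ?C" "\<zero>\<^bsub>?C\<^esub> \<in> carrier ?C" "\<one>\<^bsub>?C\<^esub> \<in> carrier ?C"
    if "f \<in> carrier ?C" "g \<in> carrier ?C" for f g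
    using that rg by (auto simp: product_ring_def PiE_iff ring.ring_simprules)
  have z: "\<zero>\<^bsub>?C\<^esub> \<in> carrier ?C" "\<one>\<^bsub>?C\<^esub> \<in> carrier ?C"
    using rg by (auto simp: product_ring_def ring.ring_simprules)
  show ?thesis
  proof (rule cringI)
    show "abelian_group ?C"
    proof (rule abelian_groupI)
      fix f assume f: "f \<in> carrier ?C"
      have "(\<lambda>i\<in>I. \<ominus>\<^bsub>K i\<^esub> f i) \<in> carrier ?C"
        using cl[OF f] rg by (auto simp: product_ring_def ring.ring_simprules)
      moreover from this have "(\<lambda>i\<in>I. \<ominus>\<^bsub>K i\<^esub> f i) \<oplus>\<^bsub>?C\<^esub> f = \<zero>\<^bsub>?C\<^esub>"
        by (intro product_ring_eqI[of _ I K] closed z f) (use cl[OF f] rg in \<open>auto simp: ops ring.ring_simprules\<close>)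
      ultimately show "\<exists>g\<in>carrier ?C. g \<oplus>\<^bsub>?C\<^esub> f = \<zero>\<^bsub>?C\<^esub>" by blast
      show "\<zero>\<^bsub>?C\<^esub> \<oplus>\<^bsub>?C\<^esub> f = f"
        by (intro product_ring_eqI[of _ I K] closed z f) (use cl[OF f] rg in \<open>auto simp: ops ring.ring_simprules\<close>)
      fix g assume g: "g \<in> carrier ?C"
      show "f \<oplus>\<^bsub>?C\<^esub> g \<in> carrier ?C" using closed f g by blast
      show "f \<oplus>\<^bsub>?C\<^esub> g = g \<oplus>\<^bsub>?C\<^esub> f"
        by (intro product_ring_eqI[of _ I K] closed f g)
          (use cl[OF f] cl[OF g] rg in \<open>auto simp: ops abelian_monoid.a_comm abelian_group.axioms(1) ring.is_abelian_group\<close>)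
      fix h assume h: "h \<in> carrier ?C"
      show "f \<oplus>\<^bsub>?C\<^esub> g \<oplus>\<^bsub>?C\<^esub> h = f \<oplus>\<^bsub>?C\<^esub> (g \<oplus>\<^bsub>?C\<^esub> h)"
        by (intro product_ring_eqI[of _ I K] closed f g h)
          (use cl[OF f] cl[OF g] cl[OF h] rg in \<open>auto simp: ops ring.ring_simprules\<close>)
    qed (rule z)
    show "comm_monoid ?C"
    proof (rule comm_monoidI)
      fix f g h assume fgh: "f \<in> carrier ?C" "g \<in> carrier ?C" "h \<in> carrier ?C"
      show "f \<otimes>\<^bsub>?C\<^esub> g \<otimes>\<^bsub>?C\<^esub> h = f \<otimes>\<^bsub>?C\<^esub> (g \<otimes>\<^bsub>?C\<^esub> h)"
        by (intro product_ring_eqI[of _ I K] closed fgh)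
          (use cl[OF fgh(1)] cl[OF fgh(2)] cl[OF fgh(3)] rg in \<open>auto simp: ops ring.ring_simprules\<close>)
    next
      fix f g assume fg: "f \<in> carrier ?C" "g \<in> carrier ?C"
      show "f \<otimes>\<^bsub>?C\<^esub> g \<in> carrier ?C" using closed fg by blast
      show "f \<otimes>\<^bsub>?C\<^esub> g = g \<otimes>\<^bsub>?C\<^esub> f"
        by (intro product_ring_eqI[of _ I K] closed fg)
          (use cl[OF fg(1)] cl[OF fg(2)] K in \<open>auto simp: ops cring.cring_simprules\<close>)
    next
      fix f assume f: "f \<in> carrier ?C"
      show "\<one>\<^bsub>?C\<^esub> \<otimes>\<^bsub>?C\<^esub> f = f"
        by (intro product_ring_eqI[of _ I K] closed z f) (use cl[OF f] rg in \<open>auto simp: ops ring.ring_simprules\<close>)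
    qed (rule z)
    fix f g h assume fgh: "f \<in> carrier ?C" "g \<in> carrier ?C" "h \<in> carrier ?C"
    show "(f \<oplus>\<^bsub>?C\<^esub> g) \<otimes>\<^bsub>?C\<^esub> h = f \<otimes>\<^bsub>?C\<^esub> h \<oplus>\<^bsub>?C\<^esub> g \<otimes>\<^bsub>?C\<^esub> h"
      by (intro product_ring_eqI[of _ I K] closed fgh)
        (use cl[OF fgh(1)] cl[OF fgh(2)] cl[OF fgh(3)] rg in \<open>auto simp: ops ring.ring_simprules\<close>)
  qed
qed

lemma embeds_in_matrix_ring_product:
  assumes R: "ring R" and K: "\<And>i. i \<in> I \<Longrightarrow> cring (K i)" and \<phi>: "\<And>i. i \<in> I \<Longrightarrow> \<phi> i \<in> ring_hom R (matrix_ring (K i) n)"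
    and ker: "\<And>x. x \<in> carrier R \<Longrightarrow> (\<And>i. i \<in> I \<Longrightarrow> \<phi> i x = \<zero>\<^bsub>matrix_ring (K i) n\<^esub>) \<Longrightarrow> x = \<zero>\<^bsub>R\<^esub>"
  shows "embeds_in_matrix_ring R (product_ring I K) n"
proof -
  let ?C = "product_ring I K"
  interpret R: ring R by fact
  interpret C: cring ?C by (rule product_ring_cring[OF K])
  define h where "h x = (\<lambda>(i, j)\<in>{..<n} \<times> {..<n}. \<lambda>a\<in>I. \<phi> a x (i, j))" for x
  have ent: "\<phi> a x (i, j) \<in> carrier (K a)" if "a \<in> I" "x \<in> carrier R" "i < n" "j < n" for a x i j
    using cring.mat_entry[OF K[OF that(1)] ring_hom_closed[OF \<phi>[OF that(1)] that(2)] that(3,4)] .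
  have hc: "h x \<in> carrier (matrix_ring ?C n)" if "x \<in> carrier R" for x
    unfolding h_def by (rule C.matI) (use ent that in \<open>auto simp: product_ring_def\<close>)
  have he: "h x (i, j) = (\<lambda>a\<in>I. \<phi> a x (i, j))" if "i < n" "j < n" for x i j using that by (simp add: h_def)
  have hC: "(\<lambda>a\<in>I. \<phi> a x (i, j)) \<in> carrier ?C" if "x \<in> carrier R" "i < n" "j < n" for x i j
    using ent that by (auto simp: product_ring_def)
  have sum: "finsum ?C f {..<n} a = (\<Oplus>\<^bsub>K a\<^esub>k\<in>{..<n}. f k a)" if "a \<in> I" "f \<in> {..<n} \<rightarrow> carrier ?C" for f a
    by (rule finsum_additive[where h = "\<lambda>f. f a"])
      (use that C.abelian_monoid_axioms K[OF that(1)] in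
        \<open>auto simp: product_ring_def cring_def abelian_group.axioms(1) ring.is_abelian_group\<close>)
  have "h \<in> ring_hom R (matrix_ring ?C n)"
  proof (rule ring_hom_memI)
    fix x y assume xy: "x \<in> carrier R" "y \<in> carrier R"
    show "h (x \<oplus>\<^bsub>R\<^esub> y) = h x \<oplus>\<^bsub>matrix_ring ?C n\<^esub> h y"
    proof (rule C.mat_eqI)
      fix i j assume ij: "i < n" "j < n"
      have "\<phi> a (x \<oplus>\<^bsub>R\<^esub> y) (i, j) = \<phi> a x (i, j) \<oplus>\<^bsub>K a\<^esub> \<phi> a y (i, j)" if "a \<in> I" for a
        using ring_hom_add[OF \<phi>[OF that] xy] cring.mat_ops(1)[OF K[OF that] ij] by simp
      then show "h (x \<oplus>\<^bsub>R\<^esub> y) (i, j) = (h x \<oplus>\<^bsub>matrix_ring ?C n\<^esub> h y) (i, j)"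
        using ij by (simp add: he C.mat_ops(1)) (auto simp: product_ring_def)
    qed (use xy hc in \<open>auto intro!: C.mat_closed\<close>)
    show "h (x \<otimes>\<^bsub>R\<^esub> y) = h x \<otimes>\<^bsub>matrix_ring ?C n\<^esub> h y"
    proof (rule C.mat_eqI)
      fix i j assume ij: "i < n" "j < n"
      let ?f = "\<lambda>k. h x (i, k) \<otimes>\<^bsub>?C\<^esub> h y (k, j)"
      have f: "?f \<in> {..<n} \<rightarrow> carrier ?C" using ij xy hC by (auto simp: he intro!: C.m_closed)
      have "finsum ?C ?f {..<n} = (\<lambda>a\<in>I. \<phi> a (x \<otimes>\<^bsub>R\<^esub> y) (i, j))"
      proof (rule product_ring_eqI)
        show "finsum ?C ?f {..<n} \<in> carrier ?C" using f by (rule C.finsum_closed)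
        show "(\<lambda>a\<in>I. \<phi> a (x \<otimes>\<^bsub>R\<^esub> y) (i, j)) \<in> carrier ?C" using hC xy ij by simp
        fix a assume a: "a \<in> I"
        interpret Ka: cring "K a" by (rule K[OF a])
        have "finsum ?C ?f {..<n} a = (\<Oplus>\<^bsub>K a\<^esub>k\<in>{..<n}. ?f k a)" using a f by (rule sum)
        also have "\<dots> = (\<Oplus>\<^bsub>K a\<^esub>k\<in>{..<n}. \<phi> a x (i, k) \<otimes>\<^bsub>K a\<^esub> \<phi> a y (k, j))"
          by (rule Ka.finsum_cong') (use a ij xy ent in \<open>auto simp: he product_ring_def\<close>)
        also have "\<dots> = \<phi> a (x \<otimes>\<^bsub>R\<^esub> y) (i, j)"
          using ring_hom_mult[OF \<phi>[OF a] xy] Ka.mat_ops(2)[OF ij] by simp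
        finally show "finsum ?C ?f {..<n} a = (\<lambda>a\<in>I. \<phi> a (x \<otimes>\<^bsub>R\<^esub> y) (i, j)) a" using a by simp
      qed
      then show "h (x \<otimes>\<^bsub>R\<^esub> y) (i, j) = (h x \<otimes>\<^bsub>matrix_ring ?C n\<^esub> h y) (i, j)"
        using ij by (simp add: he[OF ij] C.mat_ops(2))
    qed (use xy hc in \<open>auto intro!: C.mat_closed\<close>)
  next
    show "h \<one>\<^bsub>R\<^esub> = \<one>\<^bsub>matrix_ring ?C n\<^esub>"
    proof (rule C.mat_eqI)
      fix i j assume ij: "i < n" "j < n"
      have "\<phi> a \<one>\<^bsub>R\<^esub> (i, j) = (if i = j then \<one>\<^bsub>K a\<^esub> else \<zero>\<^bsub>K a\<^esub>)" if "a \<in> I" for a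
        using ring_hom_one[OF \<phi>[OF that]] cring.mat_ops(4)[OF K[OF that] ij] by simp
      then show "h \<one>\<^bsub>R\<^esub> (i, j) = \<one>\<^bsub>matrix_ring ?C n\<^esub> (i, j)"
        using ij by (simp add: he C.mat_ops(4)) (auto simp: product_ring_def)
    qed (use hc in \<open>auto intro!: C.mat_closed\<close>)
  qed (use hc in auto)
  moreover have "inj_on h (carrier R)"
  proof (rule inj_onI)
    fix x y assume xy: "x \<in> carrier R" "y \<in> carrier R" and eq: "h x = h y"
    have "x \<ominus>\<^bsub>R\<^esub> y = \<zero>\<^bsub>R\<^esub>"
    proof (rule ker)
      fix a assume a: "a \<in> I"
      interpret Ka: cring "K a" by (rule K[OF a])
      interpret M: ring "matrix_ring (K a) n" by (rule Ka.matrix_ring_ring)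
      interpret f: ring_hom_ring R "matrix_ring (K a) n" "\<phi> a"
        using R M.ring_axioms \<phi>[OF a] by (simp add: ring_hom_ringI2)
      have "\<phi> a x = \<phi> a y"
      proof (rule Ka.mat_eqI)
        fix i j assume ij: "i < n" "j < n"
        have "h x (i, j) a = h y (i, j) a" using eq by simp
        then show "\<phi> a x (i, j) = \<phi> a y (i, j)" using a ij by (simp add: he)
      qed (use xy in auto)
      then show "\<phi> a (x \<ominus>\<^bsub>R\<^esub> y) = \<zero>\<^bsub>matrix_ring (K a) n\<^esub>"
        using xy by (simp add: a_minus_def M.r_neg)
    qed (use xy in simp)
    then show "x = y" using xy R.r_right_minus_eq by simp
  qed
  ultimately show ?thesis unfolding embeds_in_matrix_ring_def by blast
qed

text \<open>Each non-nilpotent \<open>a\<close> has a representation not killing it, of a size at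
  most \<open>N\<close> that varies with \<open>a\<close>. Representations of equal size combine
  over the product of their base rings; primeness shows that for one size \<open>l\<close> they are
  jointly injective.\<close>

theorem (in ring) prime_PI_ring_embeds:
  assumes prime: "nc_prime_ideal {\<zero>} R" and id: "ml_identity R N c"
  shows "\<exists>n (C :: ('a \<Rightarrow> (nat \<Rightarrow> 'a) set \<Rightarrow> (nat \<Rightarrow> 'a) set) ring). cring C \<and> embeds_in_matrix_ring R C n"
proof -
  let ?X = "{a \<in> carrier R. \<not> nilp a}"
  define Q where "Q a t \<longleftrightarrow> (case t of (k, K :: ((nat \<Rightarrow> 'a) set \<Rightarrow> (nat \<Rightarrow> 'a) set) ring, \<phi>) \<Rightarrow>
    k \<le> N \<and> cring K \<and> \<phi> \<in> ring_hom R (matrix_ring K k) \<and> \<phi> a \<noteq> \<zero>\<^bsub>matrix_ring K k\<^esub>)" for a t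
  have "\<exists>t. Q a t" if "a \<in> ?X" for a
    using matrix_rep_of_non_nilpotent[OF id, of a] that unfolding Q_def split_paired_Ex by blast
  then have "\<forall>a\<in>?X. \<exists>t. Q a t" by blast
  from bchoice[OF this] obtain f where f: "\<forall>a\<in>?X. Q a (f a)" ..
  define k K \<phi> where "k a = fst (f a)" and "K a = fst (snd (f a))" and "\<phi> a = snd (snd (f a))" for a
  have Qa: "Q a (k a, K a, \<phi> a)" if "a \<in> ?X" for a using f that by (simp add: k_def K_def \<phi>_def)
  have k: "\<And>a. a \<in> ?X \<Longrightarrow> k a \<le> N" and K: "\<And>a. a \<in> ?X \<Longrightarrow> cring (K a)"
    and \<phi>: "\<And>a. a \<in> ?X \<Longrightarrow> \<phi> a \<in> ring_hom R (matrix_ring (K a) (k a))"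
    and ne: "\<And>a. a \<in> ?X \<Longrightarrow> \<phi> a a \<noteq> \<zero>\<^bsub>matrix_ring (K a) (k a)\<^esub>"
    using Qa unfolding Q_def by auto
  have M: "ring (matrix_ring (K a) (k a))" if "a \<in> ?X" for a by (rule cring.matrix_ring_ring[OF K[OF that]])
  define J where "J l = {x \<in> carrier R. \<forall>a\<in>?X. k a = l \<longrightarrow> \<phi> a x = \<zero>\<^bsub>matrix_ring (K a) (k a)\<^esub>}" for l
  have mult: "\<phi> a (x \<otimes> y) = \<zero>\<^bsub>matrix_ring (K a) (k a)\<^esub>"
    if a: "a \<in> ?X" and xy: "x \<in> carrier R" "y \<in> carrier R"
      and z: "\<phi> a x = \<zero>\<^bsub>matrix_ring (K a) (k a)\<^esub> \<or> \<phi> a y = \<zero>\<^bsub>matrix_ring (K a) (k a)\<^esub>" for a x y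
  proof -
    interpret M: ring "matrix_ring (K a) (k a)" by (rule M[OF a])
    show ?thesis using ring_hom_mult[OF \<phi>[OF a] xy] ring_hom_closed[OF \<phi>[OF a]] xy z by auto
  qed
  have "\<exists>l. J l \<subseteq> {\<zero>}"
  proof (rule ccontr)
    assume "\<nexists>l. J l \<subseteq> {\<zero>}"
    then have J: "\<exists>x\<in>J l. x \<noteq> \<zero>" for l by auto
    \<comment> \<open>If every common kernel \<open>J l\<close> were nonzero, primeness would allow
      nonzero elements of \<open>J 0\<close>, \<open>J 1\<close>, ... to be multiplied, with
      suitable factors in between, to a nonzero element of all of them.\<close>
    have "\<exists>y\<in>carrier R. y \<noteq> \<zero> \<and> (\<forall>a\<in>?X. k a < l \<longrightarrow> \<phi> a y = \<zero>\<^bsub>matrix_ring (K a) (k a)\<^esub>)" for l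
    proof (induction l)
      case 0
      then show ?case using J[of 0] by (auto simp: J_def)
    next
      case (Suc l)
      then obtain y where y: "y \<in> carrier R" "y \<noteq> \<zero>"
        "\<And>a. a \<in> ?X \<Longrightarrow> k a < l \<Longrightarrow> \<phi> a y = \<zero>\<^bsub>matrix_ring (K a) (k a)\<^esub>" by blast
      obtain x where x: "x \<in> J l" "x \<noteq> \<zero>" using J by blast
      then have xc: "x \<in> carrier R" by (simp add: J_def)
      obtain r where r: "r \<in> carrier R" "y \<otimes> r \<otimes> x \<noteq> \<zero>"
        using prime y(1,2) xc x(2) unfolding nc_prime_ideal_def by blast
      have "\<phi> a (y \<otimes> r \<otimes> x) = \<zero>\<^bsub>matrix_ring (K a) (k a)\<^esub>" if a: "a \<in> ?X" "k a < Suc l" for a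
      proof (cases "k a = l")
        case True
        then have "\<phi> a x = \<zero>\<^bsub>matrix_ring (K a) (k a)\<^esub>" using x a by (simp add: J_def)
        then show ?thesis using a y(1) r(1) xc by (intro mult) auto
      next
        case False
        then have "\<phi> a y = \<zero>\<^bsub>matrix_ring (K a) (k a)\<^esub>" using y(3) a by simp
        then have "\<phi> a (y \<otimes> r) = \<zero>\<^bsub>matrix_ring (K a) (k a)\<^esub>" using a y(1) r(1) by (intro mult) auto
        then show ?thesis using a y(1) r(1) xc by (intro mult) auto
      qed
      then show ?case using y(1) r xc by (intro bexI[of _ "y \<otimes> r \<otimes> x"]) auto
    qed
    from this[of "Suc N"] obtain y where y: "y \<in> carrier R" "y \<noteq> \<zero>"
      "\<forall>a\<in>?X. k a < Suc N \<longrightarrow> \<phi> a y = \<zero>\<^bsub>matrix_ring (K a) (k a)\<^esub>" by blast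
    \<comment> \<open>All chosen representations kill \<open>y\<close>, including the one chosen for
      the non-nilpotent multiple \<open>r \<otimes> y\<close>, which it must not kill.\<close>
    obtain r where r: "r \<in> carrier R" "\<not> nilp (r \<otimes> y)" using non_nilpotent_multiple[OF prime id y(1,2)] by blast
    then have X: "r \<otimes> y \<in> ?X" using y by simp
    then have "\<phi> (r \<otimes> y) y = \<zero>\<^bsub>matrix_ring (K (r \<otimes> y)) (k (r \<otimes> y))\<^esub>"
      using y(3) k[OF X] by (simp only: less_Suc_eq_le)
    then show False using ne[OF X] mult[OF X r(1) y(1)] by blast
  qed
  then obtain l where l: "J l \<subseteq> {\<zero>}" by blast
  let ?I = "{a \<in> ?X. k a = l}"
  have "embeds_in_matrix_ring R (product_ring ?I K) l"
  proof (rule embeds_in_matrix_ring_product[OF ring_axioms, where \<phi> = \<phi>])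
    show "cring (K i)" if "i \<in> ?I" for i using K that by blast
    show "\<phi> i \<in> ring_hom R (matrix_ring (K i) l)" if "i \<in> ?I" for i using \<phi>[of i] that by auto
    show "x = \<zero>" if "x \<in> carrier R" "\<And>i. i \<in> ?I \<Longrightarrow> \<phi> i x = \<zero>\<^bsub>matrix_ring (K i) l\<^esub>" for x
      using l that by (auto simp: J_def)
  qed
  moreover have "cring (product_ring ?I K)" by (rule product_ring_cring) (use K in blast)
  ultimately show ?thesis by blast
qed

lemma capelli_identity_of_embedding:
  assumes R: "ring R" and C: "cring C" and emb: "embeds_in_matrix_ring R C n"
  shows "capelli_identity R (Suc (n * n))"
  unfolding capelli_identity_def
proof (intro allI impI)
  fix as xys assume a: "set as \<subseteq> carrier R" "set xys \<subseteq> carrier R \<times> carrier R" "length as = Suc (n * n)" "length xys = Suc (n * n)"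
  interpret R: ring R by fact
  interpret C: cring C by fact
  obtain h where h: "h \<in> ring_hom R (matrix_ring C n)" "inj_on h (carrier R)"
    using emb unfolding embeds_in_matrix_ring_def by blast
  have "h (capelli R as xys) = capelli (matrix_ring C n) (map h as) (map (\<lambda>(x, y). (h x, h y)) xys)"
    by (rule capelli_hom[OF R C.matrix_ring_ring h(1) a(1,2)])
  also have "\<dots> = \<zero>\<^bsub>matrix_ring C n\<^esub>"
    using a ring_hom_closed[OF h(1)] by (intro C.capelli_matrix_ring[of n "Suc (n * n)"]) auto
  also have "\<dots> = h \<zero>\<^bsub>R\<^esub>" by (rule ring_hom_zero[OF h(1) R C.matrix_ring_ring, symmetric])
  finally show "capelli R as xys = \<zero>\<^bsub>R\<^esub>"
    using inj_onD[OF h(2)] R.capelli_closed[OF a(1,2)] by blast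
qed

subsection \<open>Unions of chains of prime ideals\<close>

context ring
begin

text \<open>Formulated for arbitrary subsets so that it also applies to nonprime unions. It is
  monotone in \<open>P\<close>, which is why the rank can only fall going up a chain.\<close>

definition capelli_mod :: "nat \<Rightarrow> 'a set \<Rightarrow> bool" where
  "capelli_mod m P \<longleftrightarrow> (\<forall>as xys. set as \<subseteq> carrier R \<longrightarrow> set xys \<subseteq> carrier R \<times> carrier R \<longrightarrow>
     length as = m \<longrightarrow> length xys = m \<longrightarrow> capelli R as xys \<in> P)"

lemma capelli_one: "capelli R [\<one>] [(\<one>, \<one>)] = \<one>"
  by (simp add: lessThan_Suc add.int_pow_1)

lemma capelli_modD:
  "capelli_mod m P \<Longrightarrow> set as \<subseteq> carrier R \<Longrightarrow> set xys \<subseteq> carrier R \<times> carrier R \<Longrightarrow>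
     length as = m \<Longrightarrow> length xys = m \<Longrightarrow> capelli R as xys \<in> P"
  unfolding capelli_mod_def by blast

lemma capelli_mod_mono: "capelli_mod m P \<Longrightarrow> P \<subseteq> Q \<Longrightarrow> capelli_mod m Q"
  unfolding capelli_mod_def by blast

lemma capelli_mod_iff_quotient:
  assumes P: "ideal P R"
  shows "capelli_mod m P \<longleftrightarrow> capelli_identity (R Quot P) m"
proof -
  interpret P: ideal P R by fact
  let ?h = "(+>) P" and ?Q = "R Quot P"
  have Q: "ring ?Q" by (rule P.quotient_is_ring)
  have h: "?h \<in> ring_hom R ?Q" by (rule P.rcos_ring_hom)
  have surj: "?h ` carrier R = carrier ?Q" by (auto simp: FactRing_def A_RCOSETS_def')
  have zero: "\<zero>\<^bsub>?Q\<^esub> = P" by (simp add: FactRing_def)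
  have mem: "P +> x = P \<longleftrightarrow> x \<in> P" if "x \<in> carrier R" for x
    using P.a_rcos_self[OF that] P.a_rcos_const[of x] by auto
  show ?thesis
  proof
    assume id: "capelli_identity ?Q m"
    show "capelli_mod m P"
      unfolding capelli_mod_def
    proof (intro allI impI)
      fix as xys assume a: "set as \<subseteq> carrier R" "set xys \<subseteq> carrier R \<times> carrier R" "length as = m" "length xys = m"
      have "P +> capelli R as xys = capelli ?Q (map ?h as) (map (\<lambda>(x, y). (P +> x, P +> y)) xys)"
        by (rule capelli_hom[OF ring_axioms Q h a(1,2)])
      also have "\<dots> = \<zero>\<^bsub>?Q\<^esub>"
        by (rule capelli_identityD[OF id]) (use a ring_hom_closed[OF h] in auto)
      also note zero
      finally show "capelli R as xys \<in> P" using mem capelli_closed[OF a(1,2)] by blast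
    qed
  next
    assume md: "capelli_mod m P"
    show "capelli_identity ?Q m"
      unfolding capelli_identity_def
    proof (intro allI impI)
      fix es fgs assume es: "set es \<subseteq> carrier ?Q" "set fgs \<subseteq> carrier ?Q \<times> carrier ?Q" "length es = m" "length fgs = m"
      have "?h (capelli R as xys) = \<zero>\<^bsub>?Q\<^esub>"
        if a: "set as \<subseteq> carrier R" "set xys \<subseteq> carrier R \<times> carrier R" "length as = m" "length xys = m" for as xys
        using capelli_modD[OF md a] mem[OF capelli_closed[OF a(1,2)]] zero by simp
      then show "capelli ?Q es fgs = \<zero>\<^bsub>?Q\<^esub>"
        by (rule capelli_hom_image_zero[OF ring_axioms Q h]) (use es surj in auto)
    qed
  qed
qed

lemma nc_prime_quotient:
  assumes P: "nc_prime_ideal P R"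
  shows "nc_prime_ideal {\<zero>\<^bsub>R Quot P\<^esub>} (R Quot P)"
proof -
  interpret P: ideal P R using P by (simp add: nc_prime_ideal_def)
  let ?Q = "R Quot P"
  interpret Q: ring ?Q by (rule P.quotient_is_ring)
  have h: "(+>) P \<in> ring_hom R ?Q" by (rule P.rcos_ring_hom)
  have carr: "carrier ?Q = (+>) P ` carrier R" by (auto simp: FactRing_def A_RCOSETS_def')
  have zero: "\<zero>\<^bsub>?Q\<^esub> = P" by (simp add: FactRing_def)
  have mem: "P +> x = P \<longleftrightarrow> x \<in> P" if "x \<in> carrier R" for x
    using P.a_rcos_self[OF that] P.a_rcos_const[of x] by auto
  show ?thesis
    unfolding nc_prime_ideal_def
  proof (intro conjI ballI impI)
    show "ideal {\<zero>\<^bsub>?Q\<^esub>} ?Q" by (rule Q.zeroideal)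
    show "{\<zero>\<^bsub>?Q\<^esub>} \<noteq> carrier ?Q"
    proof
      assume e: "{\<zero>\<^bsub>?Q\<^esub>} = carrier ?Q"
      have "P = carrier R"
      proof
        show "carrier R \<subseteq> P"
        proof
          fix x assume x: "x \<in> carrier R"
          then have "P +> x \<in> {\<zero>\<^bsub>?Q\<^esub>}" unfolding e carr by blast
          then show "x \<in> P" using mem[OF x] zero by simp
        qed
      qed (rule P.a_subset)
      then show False using P by (simp add: nc_prime_ideal_def)
    qed
    fix u v assume uv: "u \<in> carrier ?Q" "v \<in> carrier ?Q" and z: "\<forall>r\<in>carrier ?Q. u \<otimes>\<^bsub>?Q\<^esub> r \<otimes>\<^bsub>?Q\<^esub> v \<in> {\<zero>\<^bsub>?Q\<^esub>}"
    obtain x y where xy: "x \<in> carrier R" "u = P +> x" "y \<in> carrier R" "v = P +> y" using uv unfolding carr by blast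
    have "x \<otimes> r \<otimes> y \<in> P" if r: "r \<in> carrier R" for r
    proof -
      have "P +> r \<in> carrier ?Q" using r carr by blast
      then have "(P +> x) \<otimes>\<^bsub>?Q\<^esub> (P +> r) \<otimes>\<^bsub>?Q\<^esub> (P +> y) = P" using z xy zero by blast
      moreover have "P +> (x \<otimes> r \<otimes> y) = (P +> x) \<otimes>\<^bsub>?Q\<^esub> (P +> r) \<otimes>\<^bsub>?Q\<^esub> (P +> y)"
        using ring_hom_mult[OF h] xy r by simp
      ultimately show ?thesis using mem[of "x \<otimes> r \<otimes> y"] xy r by simp
    qed
    then have "x \<in> P \<or> y \<in> P" using P xy unfolding nc_prime_ideal_def by blast
    then show "u \<in> {\<zero>\<^bsub>?Q\<^esub>} \<or> v \<in> {\<zero>\<^bsub>?Q\<^esub>}" using xy mem zero by auto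
  qed
qed

lemma capelli_mod_rank_square:
  assumes P: "nc_prime_ideal P R" and id: "ml_identity R N c"
    and m: "\<not> capelli_mod m P" and j: "\<And>k. m \<le> k * k \<Longrightarrow> j \<le> k"
  shows "\<not> capelli_mod (j * j) P"
proof -
  interpret P: ideal P R using P by (simp add: nc_prime_ideal_def)
  let ?Q = "R Quot P"
  interpret Q: ring ?Q by (rule P.quotient_is_ring)
  have "(+>) P ` carrier R = carrier ?Q" by (auto simp: FactRing_def A_RCOSETS_def')
  then have "ml_identity ?Q N c"
    using ml_identity_surj_hom[OF ring_axioms Q.ring_axioms P.rcos_ring_hom _ id] by simp
  then show ?thesis
    using Q.capelli_rank_square[OF nc_prime_quotient[OF P] _ _ j] m capelli_mod_iff_quotient[OF P.ideal_axioms] by blast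
qed

lemma ideal_finsum:
  assumes P: "ideal P R" and f: "\<And>i. i \<in> A \<Longrightarrow> f i \<in> P"
  shows "finsum R f A \<in> P"
proof -
  interpret P: ideal P R by fact
  show ?thesis
    using f
  proof (induction A rule: infinite_finite_induct)
    case (insert a A)
    then have "f \<in> A \<rightarrow> carrier R" "f a \<in> carrier R" using P.a_Hcarr by auto
    then show ?case using insert by (simp add: P.a_closed)
  qed (auto simp: P.zero_closed)
qed

lemma ideal_int_multiple:
  assumes P: "ideal P R" and a: "a \<in> P" shows "add_pow R (k::int) a \<in> P"
proof -
  interpret P: ideal P R by fact
  have "add_pow R k a = add_pow R k \<one> \<otimes> a"
    using add_pow_ldistr_int[of \<one> a k] P.a_Hcarr[OF a] by simp
  then show ?thesis using P.I_l_closed[OF a, of "add_pow R k \<one>"] by simp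
qed

text \<open>Modulo an ideal satisfying the next Capelli identity, a Capelli value \<open>e\<close> of
  \<open>a\<^sub>1, \<dots>, a\<^sub>m\<close> is a denominator: \<open>e x r y\<close> lies in the sum of the \<open>R x a\<^sub>j y\<close> for all \<open>r\<close>. So the
  \<open>a\<^sub>j\<close> act like a finite basis, and membership of all \<open>x r y\<close> reduces to that of finitely many
  \<open>x a\<^sub>j y\<close>, which lie in one member of a chain.\<close>

lemma capelli_denominator:
  assumes P: "ideal P R" and cap: "capelli_mod (Suc m) P0" "P0 \<subseteq> P"
    and as: "set as \<subseteq> carrier R" "set xys \<subseteq> carrier R \<times> carrier R" "length as = m" "length xys = m"
    and xy: "x \<in> carrier R" "y \<in> carrier R" and mem: "\<And>j. j < m \<Longrightarrow> x \<otimes> as ! j \<otimes> y \<in> P" and r: "r \<in> carrier R"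
  shows "capelli R as xys \<otimes> (x \<otimes> r \<otimes> y) \<in> P"
proof -
  interpret P: ideal P R by fact
  \<comment> \<open>With \<open>r\<close> in front, term 0 of the expansion along
    \<open>(x, y)\<close> is the element wanted; every other term contains some
    \<open>x \<otimes> as ! j \<otimes> y\<close>.\<close>
  let ?as = "r # as"
  let ?f = "\<lambda>j. add_pow R ((-1) ^ j :: int) (capelli R (remove_nth j ?as) xys \<otimes> (x \<otimes> ?as ! j \<otimes> y))"
  have as': "set ?as \<subseteq> carrier R" using as r by simp
  have fc: "?f j \<in> carrier R" if "j < length ?as" for j
    using capelli_term_closed[OF as' as(2) xy that] by (rule int_multiple_closed)
  have "capelli R ?as ((x, y) # xys) \<in> P"
    using capelli_modD[OF cap(1), of ?as "(x, y) # xys"] as xy as' cap(2) by auto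
  then have sum: "finsum R ?f {..<length ?as} \<in> P" by (simp only: capelli.simps)
  have "finsum R ?f ({..<length ?as} - {0}) \<in> P"
  proof (rule ideal_finsum[OF P])
    fix j assume j: "j \<in> {..<length ?as} - {0}"
    then obtain i where i: "j = Suc i" "i < m" using as(3) by (cases j) auto
    have "capelli R (remove_nth j ?as) xys \<in> carrier R"
      by (rule capelli_closed[OF set_remove_nth_subset[OF as'] as(2)])
    moreover have "x \<otimes> ?as ! j \<otimes> y \<in> P" using mem[OF i(2)] i(1) by simp
    ultimately show "?f j \<in> P" by (rule ideal_int_multiple[OF P P.I_l_closed[rotated]])
  qed
  then have t: "finsum R ?f ({..<length ?as} - {0}) \<in> P" (is "?t \<in> P") .
  have "finsum R ?f {..<length ?as} = ?f 0 \<oplus> ?t"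
    by (rule finsum_split_off) (use fc in auto)
  moreover have "?f 0 \<in> carrier R" by (rule fc) simp
  moreover have "?t \<in> carrier R" using t by (rule P.a_Hcarr)
  ultimately have "?f 0 = finsum R ?f {..<length ?as} \<oplus> (\<ominus> ?t)"
    by (simp only: a_assoc a_inv_closed r_neg r_zero)
  then have "?f 0 \<in> P" using P.a_closed[OF sum P.a_inv_closed[OF t]] by (simp only:)
  moreover have "?f 0 = capelli R as xys \<otimes> (x \<otimes> r \<otimes> y)"
    using capelli_term_closed[OF as' as(2) xy, of 0] by (simp add: add.int_pow_1)
  ultimately show ?thesis by simp
qed

text \<open>Primeness cancels the denominator \<open>e\<close>: applying the previous lemma to
  \<open>s \<otimes> x\<close> for all \<open>s\<close> gives
  \<open>e R (x r y) \<subseteq> P\<close>, and \<open>e\<close> is outside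
  \<open>P\<close>.\<close>

lemma capelli_finite_test:
  assumes P: "nc_prime_ideal P R" and cap: "capelli_mod (Suc m) P0" "P0 \<subseteq> P"
    and as: "set as \<subseteq> carrier R" "set xys \<subseteq> carrier R \<times> carrier R" "length as = m" "length xys = m"
    and e: "capelli R as xys \<notin> P"
    and xy: "x \<in> carrier R" "y \<in> carrier R" and mem: "\<And>j. j < m \<Longrightarrow> x \<otimes> as ! j \<otimes> y \<in> P" and r: "r \<in> carrier R"
  shows "x \<otimes> r \<otimes> y \<in> P"
proof -
  interpret P: ideal P R using P by (simp add: nc_prime_ideal_def)
  let ?e = "capelli R as xys"
  have ec: "?e \<in> carrier R" using capelli_closed as by simp
  have "?e \<otimes> s \<otimes> (x \<otimes> r \<otimes> y) \<in> P" if s: "s \<in> carrier R" for s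
  proof -
    have "s \<otimes> x \<otimes> as ! j \<otimes> y \<in> P" if j: "j < m" for j
    proof -
      have "as ! j \<in> carrier R" using as j by auto
      then have "s \<otimes> x \<otimes> as ! j \<otimes> y = s \<otimes> (x \<otimes> as ! j \<otimes> y)" using s xy by (simp add: m_assoc)
      then show ?thesis using P.I_l_closed[OF mem[OF j] s] by simp
    qed
    then have "?e \<otimes> (s \<otimes> x \<otimes> r \<otimes> y) \<in> P"
      using s xy r by (intro capelli_denominator[OF P.ideal_axioms cap as]) auto
    then show ?thesis using s xy r ec by (simp add: m_assoc)
  qed
  then show ?thesis using P e ec xy r unfolding nc_prime_ideal_def by blast
qed

lemma finite_subset_of_chain_Union:
  assumes chain: "\<And>P Q. P \<in> \<D> \<Longrightarrow> Q \<in> \<D> \<Longrightarrow> P \<subseteq> Q \<or> Q \<subseteq> P" and P0: "P0 \<in> \<D>"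
    and F: "finite F" "F \<subseteq> \<Union>\<D>"
  shows "\<exists>P\<in>\<D>. P0 \<subseteq> P \<and> F \<subseteq> P"
  using F
proof (induction F)
  case empty
  then show ?case using P0 by blast
next
  case (insert a F)
  then obtain P Q where PQ: "P \<in> \<D>" "P0 \<subseteq> P" "F \<subseteq> P" "Q \<in> \<D>" "a \<in> Q" by auto
  from chain[OF PQ(1,4)] show ?case
  proof
    assume "P \<subseteq> Q"
    then show ?thesis using PQ by (intro bexI[of _ Q]) auto
  next
    assume "Q \<subseteq> P"
    then show ?thesis using PQ by (intro bexI[of _ P]) auto
  qed
qed

lemma chain_Union_prime:
  assumes prime: "\<And>P. P \<in> \<D> \<Longrightarrow> nc_prime_ideal P R"
    and chain: "\<And>P Q. P \<in> \<D> \<Longrightarrow> Q \<in> \<D> \<Longrightarrow> P \<subseteq> Q \<or> Q \<subseteq> P" and P0: "P0 \<in> \<D>"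
    and cap: "capelli_mod (Suc m) P0" and e: "\<not> capelli_mod m (\<Union>\<D>)"
  shows "nc_prime_ideal (\<Union>\<D>) R"
proof -
  obtain as xys where as: "set as \<subseteq> carrier R" "set xys \<subseteq> carrier R \<times> carrier R" "length as = m" "length xys = m"
    and eU: "capelli R as xys \<notin> \<Union>\<D>"
    using e unfolding capelli_mod_def by blast
  define e where "e = capelli R as xys"
  have ec: "e \<in> carrier R" using capelli_closed as by (simp add: e_def)
  have asc: "as ! j \<in> carrier R" if "j < m" for j using as that by auto
  have id: "ideal P R" "\<one> \<notin> P" if "P \<in> \<D>" for P
    using prime[OF that] ideal.one_imp_carrier[of P R] by (auto simp: nc_prime_ideal_def)
  have "subset.chain {I. ideal I R} \<D>" using id(1) chain by (auto simp: subset_chain_def)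
  then have U: "ideal (\<Union>\<D>) R" using chain_Union_is_ideal[of \<D>] P0 by (auto split: if_splits)
  interpret U: ideal "\<Union>\<D>" R by (rule U)
  \<comment> \<open>The finitely many test elements lie in one \<open>P\<close> of the chain, which
    may be taken above \<open>P0\<close>. There the longer Capelli polynomial still vanishes, and
    \<open>e\<close> is outside \<open>P\<close> since it is outside the union.\<close>
  have test: "\<exists>P\<in>\<D>. \<forall>r\<in>carrier R. x \<otimes> r \<otimes> y \<in> P"
    if xy: "x \<in> carrier R" "y \<in> carrier R" and mem: "\<And>j. j < m \<Longrightarrow> x \<otimes> as ! j \<otimes> y \<in> \<Union>\<D>" for x y
  proof -
    obtain P where P: "P \<in> \<D>" "P0 \<subseteq> P" "(\<lambda>j. x \<otimes> as ! j \<otimes> y) ` {..<m} \<subseteq> P"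
      using finite_subset_of_chain_Union[OF chain P0, of "(\<lambda>j. x \<otimes> as ! j \<otimes> y) ` {..<m}"] mem by auto
    have "x \<otimes> r \<otimes> y \<in> P" if "r \<in> carrier R" for r
      by (rule capelli_finite_test[OF prime[OF P(1)] cap P(2) as _ xy _ that]) (use P eU in auto)
    then show ?thesis using P(1) by blast
  qed
  show ?thesis
    unfolding nc_prime_ideal_def
  proof (intro conjI ballI impI U)
    show "\<Union>\<D> \<noteq> carrier R" using id(2) by (metis UnionE one_closed)
    fix u v assume uv: "u \<in> carrier R" "v \<in> carrier R" and z: "\<forall>r\<in>carrier R. u \<otimes> r \<otimes> v \<in> \<Union>\<D>"
    show "u \<in> \<Union>\<D> \<or> v \<in> \<Union>\<D>"
    proof (rule ccontr)
      assume neg: "\<not> (u \<in> \<Union>\<D> \<or> v \<in> \<Union>\<D>)"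
      \<comment> \<open>The test is used first for \<open>u\<close> and
        \<open>e \<otimes> w \<otimes> v\<close>. As \<open>u\<close> is in no member, this puts all
        of \<open>e R v\<close> into the union; a second use, for \<open>e\<close> and
        \<open>v\<close>, then contradicts the choice of \<open>e\<close> and
        \<open>v\<close>.\<close>
      have ezv: "e \<otimes> w \<otimes> v \<in> \<Union>\<D>" if w: "w \<in> carrier R" for w
      proof -
        have "u \<otimes> as ! j \<otimes> (e \<otimes> w \<otimes> v) \<in> \<Union>\<D>" if j: "j < m" for j
        proof -
          have "u \<otimes> as ! j \<otimes> (e \<otimes> w \<otimes> v) = u \<otimes> (as ! j \<otimes> e \<otimes> w) \<otimes> v"
            using uv ec w asc[OF j] by (simp add: m_assoc)
          then show ?thesis using z ec w asc[OF j] by simp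
        qed
        then obtain P where P: "P \<in> \<D>" "\<forall>r\<in>carrier R. u \<otimes> r \<otimes> (e \<otimes> w \<otimes> v) \<in> P"
          using test[of u "e \<otimes> w \<otimes> v"] uv ec w by auto
        then have "u \<in> P \<or> e \<otimes> w \<otimes> v \<in> P"
          using prime[OF P(1)] uv ec w unfolding nc_prime_ideal_def by blast
        then show ?thesis using P(1) neg by blast
      qed
      obtain P where P: "P \<in> \<D>" "\<forall>r\<in>carrier R. e \<otimes> r \<otimes> v \<in> P"
        using test[OF ec uv(2)] ezv asc by blast
      then have "e \<in> P \<or> v \<in> P" using prime[OF P(1)] uv ec unfolding nc_prime_ideal_def by blast
      then show False using P(1) neg eU e_def by blast
    qed
  qed
qed

text \<open>For a prime of a PI-ring whose quotient satisfies some Capelli identity, the Capelli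
  rank is the square of this number: minimality puts the rank above \<open>(k - 1)^2\<close> and at
  most \<open>k^2\<close>, and \<open>capelli_mod_rank_square\<close> leaves only
  \<open>k^2\<close>.\<close>

definition ideal_rank :: "'a set \<Rightarrow> nat" where
  "ideal_rank P = (LEAST k. capelli_mod (Suc (k * k)) P)"

text \<open>A nonprime union \<open>U\<close> is labelled by \<open>g U\<close>, the least rank of a
  chain member inside it. Nonprimeness forces every chain member above \<open>U\<close> to have
  smaller rank, so labels strictly decrease from a union to a larger one, and they lie between 2 and
  \<open>n\<close>.\<close>

lemma nonprime_unions_card:
  assumes id: "ml_identity R N c" and n: "capelli_mod (Suc (n * n)) {\<zero>}" and C: "prime_chain R \<C>"
  shows "finite (nonprime_unions R \<C>)" "card (nonprime_unions R \<C>) \<le> n - 1"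
proof -
  have prime: "nc_prime_ideal P R" if "P \<in> \<C>" for P
    using C that unfolding prime_chain_def subset_chain_def by blast
  have chain: "P \<subseteq> Q \<or> Q \<subseteq> P" if "P \<in> \<C>" "Q \<in> \<C>" for P Q
    using C that unfolding prime_chain_def subset_chain_def by blast
  have idl: "ideal P R" "\<zero> \<in> P" "\<one> \<notin> P" if "P \<in> \<C>" for P
    using prime[OF that] ideal.one_imp_carrier[of P R] additive_subgroup.zero_closed ideal.axioms(1)
    by (fastforce simp: nc_prime_ideal_def)+
  have capn: "capelli_mod (Suc (n * n)) P" if "P \<in> \<C>" for P
    using capelli_mod_mono[OF n] idl(2)[OF that] by simp
  have rank: "capelli_mod (Suc (ideal_rank P * ideal_rank P)) P" "ideal_rank P \<le> n" if "P \<in> \<C>" for P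
    unfolding ideal_rank_def using LeastI[of "\<lambda>k. capelli_mod (Suc (k * k)) P", OF capn[OF that]]
      Least_le[of "\<lambda>k. capelli_mod (Suc (k * k)) P", OF capn[OF that]] by blast+
  define g where "g U = (LEAST k. \<exists>P\<in>\<C>. P \<subseteq> U \<and> ideal_rank P = k)" for U
  have g_le: "g U \<le> ideal_rank P" if "P \<in> \<C>" "P \<subseteq> U" for P U
    unfolding g_def by (rule Least_le) (use that in blast)
  let ?N = "nonprime_unions R \<C>"
  have U: "(\<exists>P\<in>\<C>. P \<subseteq> U \<and> ideal_rank P = g U) \<and> capelli_mod (g U * g U) U" if U: "U \<in> ?N" for U
  proof -
    obtain \<D> where D: "U = \<Union>\<D>" "\<D> \<subseteq> \<C>" "\<D> \<noteq> {}" "\<not> nc_prime_ideal U R"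
      using U unfolding nonprime_unions_def by blast
    then have "\<exists>k. \<exists>P\<in>\<C>. P \<subseteq> U \<and> ideal_rank P = k" by blast
    then have ex: "\<exists>P\<in>\<C>. P \<subseteq> U \<and> ideal_rank P = g U" unfolding g_def by (rule LeastI_ex)
    then obtain P0 where P0: "P0 \<in> \<C>" "P0 \<subseteq> U" "ideal_rank P0 = g U" by blast
    \<comment> \<open>Passing to the members between \<open>P0\<close> and \<open>U\<close> does not
      change the union, and the criterion then applies with \<open>P0\<close>, whose rank is
      \<open>g U\<close>.\<close>
    let ?D = "{P \<in> \<C>. P0 \<subseteq> P \<and> P \<subseteq> U}"
    have "\<Union>?D = U"
    proof
      show "U \<subseteq> \<Union>?D"
      proof
        fix x assume "x \<in> U"
        then obtain P where P: "P \<in> \<D>" "x \<in> P" using D(1) by blast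
        then have "P \<in> \<C>" "P \<subseteq> U" using D(1,2) by blast+
        then show "x \<in> \<Union>?D" using chain[OF P0(1), of P] P(2) P0(1,2) by blast
      qed
    qed blast
    then have "capelli_mod (g U * g U) U"
      using chain_Union_prime[of ?D P0 "g U * g U"] prime chain P0 rank(1)[OF P0(1)] D(4) by auto
    then show ?thesis using ex by blast
  qed
  \<comment> \<open>An element of \<open>U'\<close> outside \<open>U\<close> lies in a member
    \<open>Q\<close> of the second subchain; no member of the first contains it, so all of them lie
    below \<open>Q\<close>.\<close>
  have between: "\<exists>Q\<in>\<C>. U \<subseteq> Q \<and> Q \<subseteq> U'" if UU: "U \<in> ?N" "U' \<in> ?N" "\<not> U' \<subseteq> U" for U U'
  proof -
    obtain \<D> where D: "U = \<Union>\<D>" "\<D> \<subseteq> \<C>" using UU(1) unfolding nonprime_unions_def by blast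
    obtain \<D>' where D': "U' = \<Union>\<D>'" "\<D>' \<subseteq> \<C>" using UU(2) unfolding nonprime_unions_def by blast
    obtain x Q where x: "x \<in> Q" "Q \<in> \<D>'" "x \<notin> U" using UU(3) D' by blast
    have "P \<subseteq> Q" if "P \<in> \<D>" for P
      using chain[of P Q] that D D' x by blast
    then show ?thesis using D D' x(2) by blast
  qed
  \<comment> \<open>The Capelli polynomial of length 0 is 1, and that of length 1 takes the value 1.
    A union labelled 0 or 1 would therefore contain 1. Excluding both labels is what leaves only
    \<open>n - 1\<close> of them.\<close>
  have pos: "2 \<le> g U" if "U \<in> ?N" for U
  proof (rule ccontr)
    assume "\<not> 2 \<le> g U"
    then consider "g U = 0" | "g U = 1" by linarith
    then have "\<one> \<in> U"
    proof cases
      case 1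
      then show ?thesis using capelli_modD[of 0 U "[]" "[]"] U[OF that] by simp
    next
      case 2
      then show ?thesis using capelli_modD[of 1 U "[\<one>]" "[(\<one>, \<one>)]"] U[OF that] capelli_one by simp
    qed
    then show False using that idl(3) unfolding nonprime_unions_def by blast
  qed
  have less: "g U' < g U" if UU: "U \<in> ?N" "U' \<in> ?N" "\<not> U' \<subseteq> U" for U U'
  proof -
    obtain Q where Q: "Q \<in> \<C>" "U \<subseteq> Q" "Q \<subseteq> U'" using between[OF UU] by blast
    have "\<not> g U \<le> ideal_rank Q"
    proof
      assume le: "g U \<le> ideal_rank Q"
      define j where "j = g U"
      \<comment> \<open>As \<open>j - 1\<close> is below the rank of \<open>Q\<close>, minimality of
        the rank applies to it. The least square not below \<open>(j - 1)^2 + 1\<close> is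
        \<open>j^2\<close>, so length \<open>j * j\<close> does not vanish modulo \<open>Q\<close>
        either, although it vanishes modulo the smaller \<open>U\<close>.\<close>
      have "\<not> capelli_mod (Suc ((j - 1) * (j - 1))) Q"
        using not_less_Least[of "j - 1" "\<lambda>k. capelli_mod (Suc (k * k)) Q"] le pos[OF UU(1)]
        unfolding ideal_rank_def j_def by linarith
      moreover have "j \<le> k" if k: "Suc ((j - 1) * (j - 1)) \<le> k * k" for k
      proof (rule ccontr)
        assume "\<not> j \<le> k"
        then have "k \<le> j - 1" by simp
        then have "k * k \<le> (j - 1) * (j - 1)" by (rule mult_le_mono) fact
        then show False using k by simp
      qed
      ultimately have "\<not> capelli_mod (j * j) Q" using capelli_mod_rank_square[OF prime[OF Q(1)] id] by blast
      then show False using U[OF UU(1)] capelli_mod_mono Q(2) j_def by blast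
    qed
    moreover have "g U' \<le> ideal_rank Q" by (rule g_le) (use Q in auto)
    ultimately show ?thesis by simp
  qed
  have inj: "inj_on g ?N"
  proof (rule inj_onI)
    fix U U' assume "U \<in> ?N" "U' \<in> ?N" "g U = g U'"
    then have "U' \<subseteq> U" "U \<subseteq> U'" using less by (metis less_irrefl)+
    then show "U = U'" by blast
  qed
  have img: "g ` ?N \<subseteq> {2..n}"
  proof
    fix k assume "k \<in> g ` ?N"
    then obtain U' where "U' \<in> ?N" "k = g U'" by blast
    then show "k \<in> {2..n}" using pos U rank(2) by fastforce
  qed
  show "finite ?N" using inj_on_finite[OF inj img] by simp
  have "card ?N \<le> card {2..n}" by (rule card_inj_on_le[OF inj img]) simp
  then show "card ?N \<le> n - 1" by simp
qed

end

theorem theorem6p2: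
  fixes R :: "('a, 'm) ring_scheme"
  assumes "nc_prime_ring R" and "PI_ring R"
  shows "P_up_index R < enat (PI_class R)"
proof -
  interpret ring R using assms(1) by (simp add: nc_prime_ring_def)
  have prime: "nc_prime_ideal {\<zero>\<^bsub>R\<^esub>} R" using assms(1) by (simp add: nc_prime_ring_def)
  obtain N c where id: "ml_identity R N c" using PI_ring_ml_identity[OF assms(2)] by blast
  let ?n = "PI_class R"
  \<comment> \<open>The least \<open>n\<close> in \<open>PI_class\<close> is attained only if some
    embedding exists over the prescribed type, so the product ring has to be transferred to that
    type.\<close>
  have "\<exists>n. \<exists>C :: ('a + nat) ring. cring C \<and> embeds_in_matrix_ring R C n"
    using prime_PI_ring_embeds[OF prime id] embeds_in_matrix_ring_universal by blast
  then have "\<exists>C :: ('a + nat) ring. cring C \<and> embeds_in_matrix_ring R C ?n"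
    unfolding PI_class_def by (rule LeastI_ex)
  then have "capelli_identity R (Suc (?n * ?n))"
    using capelli_identity_of_embedding[OF ring_axioms] by blast
  then have n: "capelli_mod (Suc (?n * ?n)) {\<zero>\<^bsub>R\<^esub>}"
    unfolding capelli_mod_def capelli_identity_def by simp
  \<comment> \<open>For \<open>n = 0\<close> the Capelli polynomial of length 1 would be an
    identity, but it takes the value 1. Positivity of \<open>n\<close> makes the bound
    \<open>n - 1\<close>, a truncated difference, strictly smaller than \<open>n\<close>.\<close>
  have "?n \<noteq> 0"
  proof
    assume "?n = 0"
    then have "\<one>\<^bsub>R\<^esub> = \<zero>\<^bsub>R\<^esub>"
      using capelli_modD[OF n, of "[\<one>\<^bsub>R\<^esub>]" "[(\<one>\<^bsub>R\<^esub>, \<one>\<^bsub>R\<^esub>)]"] capelli_one by simp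
    then have "carrier R = {\<zero>\<^bsub>R\<^esub>}" using one_zeroD by blast
    then show False using prime by (simp add: nc_prime_ideal_def)
  qed
  have "chain_index R \<C> \<le> enat (?n - 1)" if "prime_chain R \<C>" for \<C>
    using nonprime_unions_card[OF id n that] by (simp add: chain_index_def)
  then have "P_up_index R \<le> enat (?n - 1)"
    unfolding P_up_index_def by (intro SUP_least) auto
  also have "\<dots> < enat ?n" using \<open>?n \<noteq> 0\<close> by simp
  finally show ?thesis .
qed

end
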